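(* Let $a,b\in\mathbf{C}$ with $0<|b|<|a|$, let $\kappa>5/2$, and let $\delta=\delta(N)\asymp N^{-\kappa}$, i.e. $C_0^{-1}N^{-\kappa}\le\delta\le C_0N^{-\kappa}$ for a fixed constant $C_0\ge 1$. Let $P_\delta=P_{\mathrm I}+\delta Q_\omega$ be the randomly perturbed $N\times N$ matrix defined in the context. Let $\gamma$ be a segment (closed connected arc, possibly the whole curve) of the ellipse $E_1=P_{\mathrm I}(S^1)$, and let $\delta_0>0$ be small and fixed. Then there exist constants $C>0$ and $N_0$ such that for all $N\ge N_0$ and all $r$ with $C(\ln N)/N\le r\le 1/C$ (that is, in the regime $(\ln N)/N\ll r\ll 1$), setting $$\Gamma=\Gamma(r,\gamma)=\{z\in\mathbf{C};\ \mathrm{dist}(z,E_1)=\mathrm{dist}(z,\gamma)<r\},$$ we have, with probability $$\ge 1-C\left(\frac1r+\ln N\right)N^{2\kappa}e^{-2N^{\delta_0}},$$ that $$\left|\#(\sigma(P_\delta)\cap\Gamma)-\frac{1}{2\pi}\mathrm{vol}_{]0,N]\times S^1}\,P_{\mathrm I}^{-1}(\Gamma)\right|\le C\,N^{\delta_0}\left(\frac1r+\ln N\right).$$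
   Context: For $a,b\in\mathbf{C}\setminus\{0\}$, $P_{\mathrm I}$ denotes the $N\times N$ Toeplitz matrix with all entries $(j,j+1)$ equal to $a$, all entries $(j+1,j)$ equal to $b$ ($1\le j\le N-1$), and all other entries $0$. Its symbol, denoted by the same letter, is $P_{\mathrm I}(\xi)=ae^{i\xi}+be^{-i\xi}$, a function on $S^1\simeq\mathbf{R}/2\pi\mathbf{Z}$. $E_1=P_{\mathrm I}(S^1)=\{ae^{i\xi}+be^{-i\xi};\ \xi\in\mathbf{R}\}$ is the ellipse (curve) with focal points $\pm2\sqrt{ab}$ and major semi-axis of length $|a|+|b|$. The symbol is viewed as a function on $]0,N]\times S^1$ that does not depend on the first variable, so $\mathrm{vol}_{]0,N]\times S^1}P_{\mathrm I}^{-1}(\Gamma)=N\cdot\mathrm{length}\{\xi\in\mathbf{R}/2\pi\mathbf{Z};\ P_{\mathrm I}(\xi)\in\Gamma\}$. $P_\delta=P_{\mathrm I}+\delta Q_\omega$, where $Q_\omega=(q_{j,k}(\omega))_{1\le j,k\le N}$ has independent identically distributed entries with the complex Gaussian law $\mathcal{N}_{\mathbf{C}}(0,1)$ (density $\pi^{-1}e^{-|q|^2}$ with respect to Lebesgue measure on $\mathbf{C}$). $\sigma(P_\delta)$ is the spectrum; eigenvalues are counted with algebraic multiplicity. Constants are independent of $N$ and $r$ (they may depend on $a,b,\kappa,C_0,\gamma,\delta_0$). *)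

theory Defs
  imports "HOL-Probability.Probability" "Jordan_Normal_Form.Spectral_Radius"
begin

definition symbol_I :: "complex \<Rightarrow> complex \<Rightarrow> real \<Rightarrow> complex" where
  "symbol_I a b \<xi> = a * exp (\<i> * of_real \<xi>) + b * exp (- \<i> * of_real \<xi>)"

(* Rows and columns are numbered 0, ..., N - 1. *)
definition toeplitz_I :: "complex \<Rightarrow> complex \<Rightarrow> nat \<Rightarrow> complex mat" where
  "toeplitz_I a b N =
     mat N N (\<lambda>(j, k). if k = Suc j then a else if j = Suc k then b else 0)"

definition ellipse_E1 :: "complex \<Rightarrow> complex \<Rightarrow> complex set" where
  "ellipse_E1 a b = range (symbol_I a b)"

(* For 0 < |b| < |a| the symbol is injective modulo 2 pi, so these are exactly the non-degenerate
   closed connected arcs of the ellipse, with beta = alpha + 2 pi giving the whole curve. *)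
definition ellipse_segment :: "complex \<Rightarrow> complex \<Rightarrow> complex set \<Rightarrow> bool" where
  "ellipse_segment a b \<gamma> \<longleftrightarrow>
     (\<exists>\<alpha> \<beta>. \<alpha> < \<beta> \<and> \<beta> \<le> \<alpha> + 2 * pi \<and> \<gamma> = symbol_I a b ` {\<alpha>..\<beta>})"

definition Gamma_nbhd :: "complex \<Rightarrow> complex \<Rightarrow> real \<Rightarrow> complex set \<Rightarrow> complex set" where
  "Gamma_nbhd a b r \<gamma> =
     {z. infdist z (ellipse_E1 a b) = infdist z \<gamma> \<and> infdist z \<gamma> < r}"

(* The circle R / 2 pi Z is represented by its fundamental domain [0, 2 pi); x is the variable in
   ]0, N], on which the symbol does not depend. *)
definition vol_preimage :: "complex \<Rightarrow> complex \<Rightarrow> nat \<Rightarrow> complex set \<Rightarrow> real" where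
  "vol_preimage a b N S =
     measure (lborel :: (real \<times> real) measure)
       {(x, \<xi>). x \<in> {0<..real N} \<and> \<xi> \<in> {0..<2 * pi} \<and> symbol_I a b \<xi> \<in> S}"

definition iid_complex_gaussian ::
  "'w measure \<Rightarrow> nat \<Rightarrow> (nat \<Rightarrow> nat \<Rightarrow> 'w \<Rightarrow> complex) \<Rightarrow> bool" where
  "iid_complex_gaussian M N q \<longleftrightarrow>
     prob_space M \<and>
     prob_space.indep_vars M (\<lambda>_. borel) (\<lambda>(j, k). q j k) ({..<N} \<times> {..<N}) \<and>
     (\<forall>j<N. \<forall>k<N. distributed M lborel (q j k) (\<lambda>z. ennreal (exp (- (cmod z)\<^sup>2) / pi)))"

definition perturbed_I ::
  "complex \<Rightarrow> complex \<Rightarrow> nat \<Rightarrow> real \<Rightarrow> (nat \<Rightarrow> nat \<Rightarrow> 'w \<Rightarrow> complex) \<Rightarrow> 'w \<Rightarrow> complex mat" where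
  "perturbed_I a b N \<delta> q \<omega> =
     toeplitz_I a b N + complex_of_real \<delta> \<cdot>\<^sub>m mat N N (\<lambda>(j, k). q j k \<omega>)"

(* Algebraic multiplicity is the order of vanishing of the characteristic polynomial. The name is
   qualified because HOL-Algebra also has a constant called order. *)
definition eigenvalue_count :: "complex mat \<Rightarrow> complex set \<Rightarrow> nat" where
  "eigenvalue_count A S = (\<Sum>z \<in> spectrum A \<inter> S. Polynomial.order z (char_poly A))"

end

theory Submission
  imports "HOL-Complex_Analysis.Conformal_Mappings" Defs
begin

text \<open>Write \<open>\<tau> = b / a\<close> and parametrise the spectral parameter by \<open>z = a x + b / x\<close>; the ellipse is the image of
  the unit circle, its exterior the image of \<open>\<bar>x\<bar> > 1\<close>. With overwhelming probability all entries of the noise are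
  at most \<open>2 N powr (\<delta>\<^sub>0 / 2)\<close>. Then, since \<open>z - P\<close> has an inverse with bounded entries for \<open>\<bar>x\<bar> \<ge> 1\<close>, the
  characteristic polynomial there equals \<open>(a x)\<^sup>N\<close> times a bounded factor avoiding the negative half-axis. Hence all
  eigenvalues lie inside the ellipse, and the maximum principle bounds the determinant by a constant times \<open>\<bar>a\<bar>\<^sup>N\<close>
  there. At a fixed interior point the determinant is an affine function of the noise entry in the bottom left
  corner, with a slope that is bounded below, so it is at least \<open>\<bar>a\<bar>\<^sup>N exp (- N powr \<delta>\<^sub>0)\<close> outside an event of
  probability \<open>O(N powr (2 \<kappa>) exp (- 2 N powr \<delta>\<^sub>0))\<close>.

  Let \<open>\<zeta> i\<close> be the roots of larger modulus of \<open>a \<zeta> + b / \<zeta> = z\<close> for the eigenvalues \<open>z\<close>. Jensen's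
  inequality in half discs, in the coordinate \<open>ln x\<close>, bounds \<open>\<Sum>i. 1 - \<bar>\<zeta> i\<bar>\<close> by \<open>O(N powr \<delta>\<^sub>0)\<close>; used at dyadic distances from an end point \<open>e\<close> of the arc it
  bounds \<open>\<Sum>i. (1 - \<bar>\<zeta> i\<bar>) / \<bar>\<zeta> i - e\<bar>\<close> by \<open>O(N powr \<delta>\<^sub>0 ln N)\<close>. The first sum controls the eigenvalues far from the
  ellipse, the second one those near the normals at the end points. Finally \<open>Im (\<Sum>i. Ln (1 - \<zeta> i / e))\<close> is
  \<open>O(N powr \<delta>\<^sub>0 ln N)\<close> by the exterior formula, and for a point of the circle \<open>Im (Ln (1 - \<zeta> i / e))\<close> is a sawtooth
  function of its argument, so the difference over the two end points counts the \<open>\<zeta> i\<close> in the sector.\<close>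

section \<open>Perturbed tridiagonal determinants\<close>

text \<open>Since the sum of the depths is small, most eigenvalues crowd at the ellipse, and no
  bound on the number of zeros in an interior region could count them. The half discs therefore have
  their diameter on the unit circle itself, where the normalised determinant is still bounded; the
  weight of a zero is then linear in its depth, and only depths are ever summed. The count comes
  from the other side, from the argument of the exterior product on the circle.

  The corner entry is the one to vary because its cofactor is of order |a|^(N - 1) at every test
  point, where the unperturbed determinant can be exponentially smaller than |a|^N. Its slope
  contains delta, and the square of exp (- N^delta0) / delta is, up to a constant, the probability
  lost at a test point. The recurring smallness condition is on N^2 delta times the bound for the
  noise entries, which is what kappa > 5/2 provides.

  The factor ln N arises twice: as the number of dyadic scales between a constant and 1/N, and as
  the number of reflections that carry the circle out to modulus 2 N.\<close>

lemma det_one_plus_small: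
  fixes X :: "complex mat"
  assumes "X \<in> carrier_mat n n" and "\<And>i j. i < n \<Longrightarrow> j < n \<Longrightarrow> cmod (X $$ (i,j)) \<le> m"
    and "0 \<le> m" and "real n * m < 1"
  shows "cmod (det (1\<^sub>m n + X) - 1) \<le> 1 / (1 - real n * m) - 1"
  using assms
proof (induction n arbitrary: X m)
  case 0
  then have "1\<^sub>m 0 + X \<in> carrier_mat 0 0" by auto
  then have "det (1\<^sub>m 0 + X) = 1" by (rule det_dim_zero)
  then show ?case by simp
next
  case (Suc n)
  note X = Suc.prems(1) and Xm = Suc.prems(2)
  have m1: "m < 1" using Suc.prems(3,4) by (simp add: algebra_simps) (smt (verit) mult_nonneg_nonneg of_nat_0_le_iff)
  have nm: "1 - m - real n * m > 0" using Suc.prems(4) by (simp add: algebra_simps)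
  define p where "p = 1 + X $$ (0,0)"
  have p: "cmod (p - 1) \<le> m" using Xm[of 0 0] by (simp add: p_def)
  then have pge: "cmod p \<ge> 1 - m"
    by (metis add.commute diff_add_cancel diff_ge_0_iff_ge add_diff_cancel_left' norm_minus_commute norm_one norm_triangle_ineq2 order.trans diff_left_mono)
  then have p0: "p \<noteq> 0" using m1 by auto
  \<comment> \<open>Schur complement of the pivot \<open>p\<close>. Its entries are at most m +
    m^2/(1 - m) = m/(1 - m), and inserting this into the induction hypothesis gives (1 - m)/(1 - (n
    + 1) m), so the estimate reproduces itself. A bound in terms of n m alone keeps the later
    smallness conditions polynomial in N.\<close>
  define X' where "X' = mat n n (\<lambda>(i,j). X $$ (Suc i, Suc j) - X $$ (Suc i, 0) * X $$ (0, Suc j) / p)"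
  have X'c: "X' \<in> carrier_mat n n" by (simp add: X'_def)
  have X'm: "cmod (X' $$ (i,j)) \<le> m / (1 - m)" if "i < n" "j < n" for i j
  proof -
    have "cmod (X' $$ (i,j)) \<le> cmod (X $$ (Suc i, Suc j)) + cmod (X $$ (Suc i, 0) * X $$ (0, Suc j) / p)"
      using that by (simp add: X'_def norm_triangle_ineq4)
    also have "cmod (X $$ (Suc i, 0) * X $$ (0, Suc j) / p) \<le> m * m / (1 - m)"
      unfolding norm_divide norm_mult using that pge m1 Suc.prems(3)
      by (intro frac_le mult_mono Xm) auto
    also have "cmod (X $$ (Suc i, Suc j)) \<le> m" using that by (intro Xm) auto
    also have "m + m * m / (1 - m) = m / (1 - m)" using m1 by (simp add: field_simps)
    finally show ?thesis by simp
  qed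
  have IH: "cmod (det (1\<^sub>m n + X') - 1) \<le> 1 / (1 - real n * (m / (1 - m))) - 1"
    using m1 nm Suc.prems(3) by (intro Suc.IH X'c X'm) (auto simp: field_simps)
  have e: "1 / (1 - real n * (m / (1 - m))) = (1 - m) / (1 - m - real n * m)"
    using m1 nm by (simp add: divide_simps)
  define P where "P = mat 1 1 (\<lambda>_. p)"
  define V where "V = mat 1 n (\<lambda>(_,j). X $$ (0, Suc j))"
  define U where "U = mat n 1 (\<lambda>(i,_). X $$ (Suc i, 0) / p)"
  have c: "P \<in> carrier_mat 1 1" "V \<in> carrier_mat 1 n" "U \<in> carrier_mat n 1"
    by (auto simp: P_def V_def U_def)
  have fact: "1\<^sub>m (Suc n) + X = four_block_mat (1\<^sub>m 1) (0\<^sub>m 1 n) U (1\<^sub>m n) * four_block_mat P V (0\<^sub>m n 1) (1\<^sub>m n + X')"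
    (is "?A = ?L * ?R")
  proof -
    have *: "?L * ?R = four_block_mat P V (U * P) (U * V + (1\<^sub>m n + X'))"
      using c X'c mult_four_block_mat[of "1\<^sub>m 1" 1 1 "0\<^sub>m 1 n" n U n "1\<^sub>m n" P 1 V n "0\<^sub>m n 1" "1\<^sub>m n + X'"]
      by simp
    show ?thesis unfolding *
    proof (rule eq_matI)
      fix i j assume "i < dim_row (four_block_mat P V (U * P) (U * V + (1\<^sub>m n + X')))"
        "j < dim_col (four_block_mat P V (U * P) (U * V + (1\<^sub>m n + X')))"
      then have ij: "i < Suc n" "j < Suc n" using c X'c by auto
      show "?A $$ (i,j) = four_block_mat P V (U * P) (U * V + (1\<^sub>m n + X')) $$ (i,j)"
      proof (cases "i = 0 \<or> j = 0")
        case True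
        then show ?thesis using ij c X X'c p0
          by (auto simp: P_def V_def U_def scalar_prod_def p_def)
      next
        case False
        then obtain i' j' where [simp]: "i = Suc i'" "j = Suc j'" by (metis not0_implies_Suc)
        show ?thesis using ij c X X'c
          by (simp add: U_def V_def X'_def scalar_prod_def)
      qed
    qed (use c X X'c in auto)
  qed
  have dL: "det ?L = 1"
    using c by (subst det_four_block_mat_upper_right_zero[where n=1 and m=n]) auto
  have dR: "det ?R = p * det (1\<^sub>m n + X')"
    using c X'c by (subst det_four_block_mat_lower_left_zero_col[where n=n]) (auto simp: det_single P_def)
  have d: "det ?A = p * det (1\<^sub>m n + X')"
    unfolding fact using c X'c dL dR by (subst det_mult[where n="Suc n"]) auto
  define w where "w = det (1\<^sub>m n + X') - 1"
  have "det ?A - 1 = (p - 1) * (1 + w) + w" by (simp add: d w_def algebra_simps)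
  then have "cmod (det ?A - 1) \<le> cmod (p - 1) * (1 + cmod w) + cmod w"
    using norm_triangle_ineq[of "(p - 1) * (1 + w)" w] mult_left_mono[OF norm_triangle_ineq[of 1 w], of "cmod (p - 1)"]
    by (simp add: norm_mult)
  also have "\<dots> \<le> m * (1 + cmod w) + cmod w" using p by (intro add_right_mono mult_right_mono) auto
  also have "\<dots> = (1 + m) * (1 + cmod w) - 1" by (simp add: algebra_simps)
  also have "\<dots> \<le> (1 + m) * ((1 - m) / (1 - m - real n * m)) - 1"
    using IH Suc.prems(3) unfolding w_def[symmetric] e by (intro diff_right_mono mult_left_mono) auto
  also have "\<dots> \<le> 1 / (1 - m - real n * m) - 1"
  proof -
    have "(1 + m) * (1 - m) \<le> 1" by (simp add: algebra_simps)
    then show ?thesis using nm by (simp add: divide_right_mono)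
  qed
  finally show ?case by (simp add: algebra_simps)
qed

text \<open>Factor A + Q = A (1 + G Q). The entries of G Q are at most n g B, and
  \<open>det_one_plus_small\<close> asks for n times that, whence the two factors n.\<close>

lemma det_perturbation:
  fixes A G Q :: "complex mat"
  assumes c: "A \<in> carrier_mat n n" "G \<in> carrier_mat n n" "Q \<in> carrier_mat n n" and AG: "A * G = 1\<^sub>m n"
    and Gg: "\<And>i j. i < n \<Longrightarrow> j < n \<Longrightarrow> cmod (G $$ (i,j)) \<le> g"
    and QB: "\<And>i j. i < n \<Longrightarrow> j < n \<Longrightarrow> cmod (Q $$ (i,j)) \<le> B"
    and "0 \<le> g" "0 \<le> B" and small: "real n * real n * g * B \<le> 1/2"
  shows "cmod (det (A + Q) - det A) \<le> cmod (det A) * (2 * (real n * real n * g * B))"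
proof -
  define \<eta> where "\<eta> = real n * real n * g * B"
  have eta: "0 \<le> \<eta>" "\<eta> \<le> 1/2" using assms by (auto simp: \<eta>_def)
  have "A + Q = A * (1\<^sub>m n + G * Q)"
  proof -
    have "A * (1\<^sub>m n + G * Q) = A * 1\<^sub>m n + A * (G * Q)"
      using c by (intro mult_add_distrib_mat) auto
    also have "A * (G * Q) = Q"
      using c AG assoc_mult_mat[of A n n G n Q n] by simp
    finally show ?thesis using c by simp
  qed
  then have d: "det (A + Q) = det A * det (1\<^sub>m n + G * Q)"
    using c by (simp add: det_mult[where n=n])
  have "cmod (det (1\<^sub>m n + G * Q) - 1) \<le> 1 / (1 - real n * (real n * g * B)) - 1"
  proof (rule det_one_plus_small)
    fix i j assume "i < n" "j < n"
    then have "cmod ((G * Q) $$ (i,j)) = cmod (\<Sum>k<n. G $$ (i,k) * Q $$ (k,j))"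
      using c by (simp add: scalar_prod_def atLeast0LessThan)
    also have "\<dots> \<le> (\<Sum>k<n. g * B)"
      using \<open>i < n\<close> \<open>j < n\<close> assms
      by (intro sum_norm_le) (auto simp: norm_mult intro!: mult_mono Gg QB)
    finally show "cmod ((G * Q) $$ (i,j)) \<le> real n * g * B" by (simp add: mult.assoc)
  qed (use assms eta in \<open>auto simp: \<eta>_def mult.assoc\<close>)
  also have "\<dots> = 1 / (1 - \<eta>) - 1" by (simp add: \<eta>_def mult.assoc)
  also have "\<dots> \<le> 2 * \<eta>"
  proof -
    have "1 \<le> (1 + 2 * \<eta>) * (1 - \<eta>)" using eta mult_left_mono[of \<eta> "1/2" \<eta>] by (simp add: algebra_simps)
    then show ?thesis using eta by (simp add: field_simps)
  qed
  finally have "cmod (det A) * cmod (det (1\<^sub>m n + G * Q) - 1) \<le> cmod (det A) * (2 * \<eta>)"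
    by (intro mult_left_mono) auto
  then show ?thesis by (simp add: d \<eta>_def flip: norm_mult) (simp add: algebra_simps)
qed

section \<open>The unperturbed matrix: determinant and inverse\<close>

text \<open>The complete homogeneous polynomial (x^n - y^n)/(x - y), a two-variable Chebyshev
  polynomial. The recurrence also covers x = y, which is not excluded at interior points.\<close>

fun U_seq :: "complex \<Rightarrow> complex \<Rightarrow> nat \<Rightarrow> complex" where
  "U_seq x y 0 = 0"
| "U_seq x y (Suc 0) = 1"
| "U_seq x y (Suc (Suc n)) = (x + y) * U_seq x y (Suc n) - x * y * U_seq x y n"

lemma U_seq_Suc: "U_seq x y (Suc n) = x ^ n + y * U_seq x y n"
proof (induction n)
  case (Suc n)
  have "U_seq x y (Suc (Suc n)) = x * (U_seq x y (Suc n) - y * U_seq x y n) + y * U_seq x y (Suc n)"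
    by (simp add: algebra_simps)
  also have "U_seq x y (Suc n) - y * U_seq x y n = x ^ n" using Suc by simp
  finally show ?case by simp
qed simp

lemma U_seq_closed: "(x - y) * U_seq x y n = x ^ n - y ^ n"
proof (induction n)
  case (Suc n)
  have "(x - y) * U_seq x y (Suc n) = (x - y) * x ^ n + y * ((x - y) * U_seq x y n)"
    by (simp add: U_seq_Suc algebra_simps)
  then show ?case unfolding Suc by (simp add: algebra_simps)
qed simp

text \<open>Addition law of Chebyshev type; it evaluates the jump of the Green matrix on the
  diagonal.\<close>

lemma U_seq_add:
  "U_seq x y (Suc (m + n)) = U_seq x y (Suc m) * U_seq x y (Suc n) - x * y * U_seq x y m * U_seq x y n"
proof (induction n arbitrary: m)
  case (Suc n)
  have "U_seq x y (Suc (m + Suc n)) = U_seq x y (Suc (Suc m + n))" by simp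
  also have "\<dots> = U_seq x y (Suc (Suc m)) * U_seq x y (Suc n) - x * y * U_seq x y (Suc m) * U_seq x y n"
    by (rule Suc)
  finally show ?case by (simp add: algebra_simps)
qed simp

lemma norm_U_seq_le:
  assumes "cmod x \<le> 1" "cmod y \<le> \<rho>" "\<rho> < 1"
  shows "cmod (U_seq x y n) \<le> 1 / (1 - \<rho>)"
proof (induction n)
  case (Suc n)
  have r: "0 \<le> \<rho>" using assms(2) norm_ge_zero order.trans by blast
  have "cmod (U_seq x y (Suc n)) \<le> cmod x ^ n + cmod y * cmod (U_seq x y n)"
    unfolding U_seq_Suc by (metis norm_mult norm_power norm_triangle_ineq)
  also have "\<dots> \<le> 1 + \<rho> * (1 / (1 - \<rho>))"
    using assms r Suc by (intro add_mono mult_mono power_le_one) auto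
  also have "\<dots> = 1 / (1 - \<rho>)" using assms by (simp add: field_simps)
  finally show ?case .
qed (use assms in auto)

lemma norm_U_seq_Suc_le:
  assumes "1 \<le> cmod x" "cmod y \<le> \<rho>" "\<rho> < 1"
  shows "cmod (U_seq x y (Suc n)) \<le> cmod x ^ n / (1 - \<rho>)"
proof (induction n)
  case 0
  have r: "0 \<le> \<rho>" using assms(2) norm_ge_zero order.trans by blast
  show ?case using assms r by (simp add: field_simps)
next
  case (Suc n)
  have r: "0 \<le> \<rho>" using assms(2) norm_ge_zero order.trans by blast
  have "cmod (U_seq x y (Suc (Suc n))) \<le> cmod x ^ Suc n + cmod y * cmod (U_seq x y (Suc n))"
    unfolding U_seq_Suc[of _ _ "Suc n"] by (metis norm_mult norm_power norm_triangle_ineq)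
  also have "\<dots> \<le> cmod x ^ Suc n + \<rho> * (cmod x ^ Suc n / (1 - \<rho>))"
  proof (intro add_left_mono mult_mono)
    have "cmod x ^ n / (1 - \<rho>) \<le> cmod x ^ Suc n / (1 - \<rho>)"
      using assms by (intro divide_right_mono power_increasing) auto
    then show "cmod (U_seq x y (Suc n)) \<le> cmod x ^ Suc n / (1 - \<rho>)" using Suc by linarith
  qed (use assms r in auto)
  also have "\<dots> = cmod x ^ Suc n / (1 - \<rho>)" using assms by (simp add: field_simps)
  finally show ?case .
qed

text \<open>With the upper bound above, \<open>U_seq x y (Suc n)\<close> is comparable to x^n. The
  closed form suffices, as |x - y| is at most 2 |x|.\<close>

lemma norm_U_seq_Suc_ge:
  assumes x: "1 \<le> cmod x" and y: "cmod y \<le> \<rho>" and r: "\<rho> < 1"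
  shows "cmod x ^ n * (1 - \<rho>) / 2 \<le> cmod (U_seq x y (Suc n))"
proof -
  have r0: "0 \<le> \<rho>" using assms(2) norm_ge_zero order.trans by blast
  have "cmod y ^ Suc n \<le> \<rho> ^ Suc n" using y by (intro power_mono) auto
  also have "\<dots> \<le> \<rho>" using r r0 by (simp add: mult_left_le power_le_one)
  also have "\<rho> \<le> \<rho> * cmod x ^ Suc n"
    using x r0 one_le_power[OF x, of "Suc n"] mult_left_mono[of 1 "cmod x ^ Suc n" \<rho>] by simp
  finally have 1: "cmod y ^ Suc n \<le> \<rho> * cmod x ^ Suc n" .
  have "cmod x ^ Suc n * (1 - \<rho>) \<le> cmod x ^ Suc n - cmod y ^ Suc n"
    using 1 by (simp add: right_diff_distrib mult.commute[of \<rho>])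
  also have "\<dots> \<le> cmod (x ^ Suc n - y ^ Suc n)"
    using norm_triangle_ineq2[of "x ^ Suc n" "y ^ Suc n"] by (simp add: norm_power norm_mult)
  also have "\<dots> = cmod (x - y) * cmod (U_seq x y (Suc n))"
    by (simp only: flip: norm_mult U_seq_closed)
  also have "\<dots> \<le> (2 * cmod x) * cmod (U_seq x y (Suc n))"
    using norm_triangle_ineq4[of x y] x y r by (intro mult_right_mono) auto
  finally have "cmod x * (cmod x ^ n * (1 - \<rho>) / 2) \<le> cmod x * cmod (U_seq x y (Suc n))"
    by simp
  moreover have "0 < cmod x" using x by linarith
  ultimately show ?thesis by (simp only: mult_le_cancel_left_pos)
qed

definition tridiag :: "complex \<Rightarrow> complex \<Rightarrow> complex \<Rightarrow> nat \<Rightarrow> complex mat" where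
  "tridiag z a b N = mat N N (\<lambda>(j, k). if j = k then z else if k = Suc j then - a else if j = Suc k then - b else 0)"

text \<open>The Green matrix of the three-term recurrence: the solution that vanishes just before
  the first row times the one that vanishes just after the last row, normalised by their Casoratian.
  Below the diagonal the power of x y = b/a accounts for the asymmetry of the matrix.\<close>

definition tridiag_inv :: "complex \<Rightarrow> complex \<Rightarrow> complex \<Rightarrow> nat \<Rightarrow> complex mat" where
  "tridiag_inv a x y N = mat N N (\<lambda>(j, k). (if j \<le> k then U_seq x y (Suc j) * U_seq x y (N - k)
     else (x * y) ^ (j - k) * U_seq x y (Suc k) * U_seq x y (N - j)) / (a * U_seq x y (Suc N)))"

text \<open>The convention \<open>g N = 0\<close> makes the last row look like an interior one, so
  only the first row needs a case of its own.\<close>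

lemma tridiag_row_sum:
  fixes g :: "nat \<Rightarrow> complex"
  assumes "j < N" "g N = 0"
  shows "(\<Sum>k<N. (if j = k then z else if k = Suc j then - a else if j = Suc k then - b else 0) * g k)
     = z * g j - a * g (Suc j) - (if j = 0 then 0 else b * g (j - 1))"
proof -
  have "(\<Sum>k<N. (if j = k then z else if k = Suc j then - a else if j = Suc k then - b else 0) * g k)
    = (\<Sum>k<N. (if k = j then z * g k else 0) - (if k = Suc j then a * g k else 0)
         - (if j \<noteq> 0 \<and> k = j - 1 then b * g k else 0))"
    by (intro sum.cong) auto
  also have "\<dots> = z * g j - (if Suc j < N then a * g (Suc j) else 0) - (if j = 0 then 0 else b * g (j - 1))"
    using assms(1) by (cases "j = 0") (auto simp: sum_subtractf)
  also have "(if Suc j < N then a * g (Suc j) else 0) = a * g (Suc j)"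
    using assms by (cases "Suc j = N") auto
  finally show ?thesis .
qed

lemma tridiag_times_inv:
  assumes "a \<noteq> 0" and nz: "U_seq x y (Suc N) \<noteq> 0"
  shows "tridiag (a * (x + y)) a (a * x * y) N * tridiag_inv a x y N = 1\<^sub>m N" (is "?T * ?G = _")
proof (rule eq_matI)
  fix j l assume "j < dim_row (1\<^sub>m N :: complex mat)" "l < dim_col (1\<^sub>m N :: complex mat)"
  then have jl: "j < N" "l < N" by auto
  let ?U = "U_seq x y"
  define D where "D = a * ?U (Suc N)"
  define g where "g = (\<lambda>j. if j \<le> l then ?U (Suc j) * ?U (N - l)
     else (x * y) ^ (j - l) * ?U (Suc l) * ?U (N - j))"
  have "(?T * ?G) $$ (j,l) = (\<Sum>k<N. (if j = k then a * (x + y) else if k = Suc j then - a else if j = Suc k then - (a * x * y) else 0) * (g k / D))"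
    using jl by (simp add: tridiag_def tridiag_inv_def scalar_prod_def atLeast0LessThan g_def D_def)
  also have "\<dots> = (a * (x + y) * g j - a * g (Suc j) - (if j = 0 then 0 else a * x * y * g (j - 1))) / D"
    using jl by (subst tridiag_row_sum[where g = "\<lambda>k. g k / D"]) (auto simp: g_def diff_divide_distrib)
  also have "a * (x + y) * g j - a * g (Suc j) - (if j = 0 then 0 else a * x * y * g (j - 1)) = (if j = l then D else 0)"
  proof -
    consider "j < l" | "j = l" | "j > l" by linarith
    then show ?thesis
    proof cases
      case 1
      then show ?thesis by (cases j) (auto simp: g_def algebra_simps)
    next
      case 2
      \<comment> \<open>On the diagonal the two branches meet, and the defect of the recurrence
        there is the addition law for \<open>Suc l\<close> and \<open>m\<close>.\<close>
      obtain m where m: "N = Suc (l + m)" using jl less_imp_Suc_add by blast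
      have "?U (Suc N) = ?U (Suc (Suc l)) * ?U (Suc m) - x * y * ?U (Suc l) * ?U m"
        using U_seq_add[of x y "Suc l" m] by (simp only: m add_Suc)
      then have "D = a * (((x + y) * ?U (Suc l) - x * y * ?U l) * ?U (Suc m) - x * y * ?U (Suc l) * ?U m)"
        by (simp add: D_def)
      moreover have "g l = ?U (Suc l) * ?U (Suc m)" "g (Suc l) = x * y * ?U (Suc l) * ?U m"
        by (simp_all add: g_def m Suc_diff_le)
      moreover have "(if l = 0 then 0 else a * x * y * g (l - 1)) = a * x * y * (?U l * ?U (Suc m))"
        by (cases l) (simp_all add: g_def m Suc_diff_le)
      ultimately show ?thesis using 2 by (simp only: if_True) (simp add: algebra_simps)
    next
      case 3
      obtain m where m: "N = Suc (j + m)" using jl less_imp_Suc_add by blast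
      obtain i where i: "j = Suc (l + i)" using 3 less_imp_Suc_add by blast
      show ?thesis using 3 by (cases i) (auto simp: g_def m i Suc_diff_le algebra_simps)
    qed
  qed
  finally show "(?T * ?G) $$ (j,l) = 1\<^sub>m N $$ (j,l)"
    using jl assms by (auto simp: D_def)
qed (auto simp: tridiag_def tridiag_inv_def)

text \<open>The numerator is at most a constant times |x|^N and the denominator at least a constant
  times |x|^N. The bound is therefore uniform in N and x, including |x| = 1, that is, on the ellipse
  itself.\<close>

lemma norm_tridiag_inv_le:
  assumes a: "a \<noteq> 0" and x: "1 \<le> cmod x" and y: "cmod y \<le> \<rho>" and xy: "cmod (x * y) \<le> 1" and r: "\<rho> < 1"
    and jl: "j < N" "l < N"
  shows "cmod (tridiag_inv a x y N $$ (j,l)) \<le> 2 / (cmod a * (1 - \<rho>) ^ 3)"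
proof -
  have r1: "0 < 1 - \<rho>" using r by simp
  have x0: "0 < cmod x" using x by linarith
  have *: "cmod (U_seq x y (Suc i)) * cmod (U_seq x y (N - k)) \<le> cmod x ^ N / (1 - \<rho>)\<^sup>2" if "i \<le> k" "k < N" for i k
  proof -
    obtain m where m: "N = Suc (k + m)" using less_imp_Suc_add[OF \<open>k < N\<close>] by blast
    have "cmod (U_seq x y (Suc i)) * cmod (U_seq x y (N - k)) \<le> (cmod x ^ i / (1 - \<rho>)) * (cmod x ^ m / (1 - \<rho>))"
    proof (rule mult_mono)
      show "cmod (U_seq x y (Suc i)) \<le> cmod x ^ i / (1 - \<rho>)" by (rule norm_U_seq_Suc_le[OF x y r])
      have "N - k = Suc m" using m by simp
      then show "cmod (U_seq x y (N - k)) \<le> cmod x ^ m / (1 - \<rho>)"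
        using norm_U_seq_Suc_le[OF x y r, of m] by simp
    qed (use r1 in auto)
    also have "\<dots> = cmod x ^ (i + m) / (1 - \<rho>)\<^sup>2" by (simp add: power_add power2_eq_square)
    also have "\<dots> \<le> cmod x ^ N / (1 - \<rho>)\<^sup>2"
      using x that m by (intro divide_right_mono power_increasing) auto
    finally show ?thesis .
  qed
  have n: "cmod (if j \<le> l then U_seq x y (Suc j) * U_seq x y (N - l)
     else (x * y) ^ (j - l) * U_seq x y (Suc l) * U_seq x y (N - j)) \<le> cmod x ^ N / (1 - \<rho>)\<^sup>2"
  proof (cases "j \<le> l")
    case True
    then show ?thesis using *[of j l] jl by (simp add: norm_mult)
  next
    case False
    have "cmod ((x * y) ^ (j - l)) \<le> 1" using xy by (simp add: norm_power power_le_one)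
    then have "cmod ((x * y) ^ (j - l)) * (cmod (U_seq x y (Suc l)) * cmod (U_seq x y (N - j)))
       \<le> 1 * (cmod x ^ N / (1 - \<rho>)\<^sup>2)"
      using *[of l j] jl False by (intro mult_mono) auto
    then show ?thesis using False by (simp add: norm_mult mult.assoc)
  qed
  have ge: "cmod a * (cmod x ^ N * (1 - \<rho>) / 2) \<le> cmod (a * U_seq x y (Suc N))"
    unfolding norm_mult by (intro mult_left_mono norm_U_seq_Suc_ge x y r) auto
  have e: "tridiag_inv a x y N $$ (j,l) = (if j \<le> l then U_seq x y (Suc j) * U_seq x y (N - l)
     else (x * y) ^ (j - l) * U_seq x y (Suc l) * U_seq x y (N - j)) / (a * U_seq x y (Suc N))"
    using jl unfolding tridiag_inv_def by (subst index_mat(1)) auto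
  have "cmod (tridiag_inv a x y N $$ (j,l)) \<le> (cmod x ^ N / (1 - \<rho>)\<^sup>2) / (cmod a * (cmod x ^ N * (1 - \<rho>) / 2))"
    unfolding e norm_divide using a r1 x0 by (intro frac_le n ge) auto
  also have "\<dots> = 2 / (cmod a * (1 - \<rho>) ^ 3)"
  proof -
    have "(X / R\<^sup>2) / (c * (X * R / 2)) = 2 / (c * R ^ 3)" if "X > 0" "R > 0" "c > 0" for X R c :: real
      using that by (simp add: field_simps power2_eq_square power3_eq_cube)
    from this[of "cmod x ^ N" "1 - \<rho>" "cmod a"] show ?thesis using a r1 x0 by simp
  qed
  finally show ?thesis .
qed

text \<open>This is \<open>tridiag\<close> with its last row and first column deleted.\<close>

definition lowtri :: "complex \<Rightarrow> complex \<Rightarrow> complex \<Rightarrow> nat \<Rightarrow> complex mat" where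
  "lowtri z a b n = mat n n (\<lambda>(j, k). if k = j then - a else if j = Suc k then z else if j = Suc (Suc k) then - b else 0)"

text \<open>A lower triangular Toeplitz matrix is a truncated power series. Here the series is -a (1
  - x s) (1 - y s), and its reciprocal has the coefficients
  \<open>- U_seq x y (Suc n) / a\<close>.\<close>

definition lowtri_inv :: "complex \<Rightarrow> complex \<Rightarrow> complex \<Rightarrow> nat \<Rightarrow> complex mat" where
  "lowtri_inv a x y n = mat n n (\<lambda>(j, k). if k \<le> j then - U_seq x y (Suc (j - k)) / a else 0)"

lemma det_lowtri: "det (lowtri z a b n) = (- a) ^ n"
proof -
  have "det (lowtri z a b n) = prod_list (diag_mat (lowtri z a b n))"
    by (rule det_lower_triangular[of n]) (auto simp: lowtri_def)
  also have "diag_mat (lowtri z a b n) = replicate n (- a)"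
    by (rule nth_equalityI) (auto simp: diag_mat_def lowtri_def)
  finally show ?thesis by simp
qed

lemma lowtri_times_inv:
  assumes "a \<noteq> 0"
  shows "lowtri (a * (x + y)) a (a * x * y) n * lowtri_inv a x y n = 1\<^sub>m n" (is "?T * ?G = _")
proof (rule eq_matI)
  fix j l assume "j < dim_row (1\<^sub>m n :: complex mat)" "l < dim_col (1\<^sub>m n :: complex mat)"
  then have jl: "j < n" "l < n" by auto
  let ?U = "U_seq x y"
  define g where "g = (\<lambda>j. if l \<le> j then - ?U (Suc (j - l)) / a else 0)"
  have "(?T * ?G) $$ (j,l) = (\<Sum>k<n. (if k = j then - a else if j = Suc k then a * (x + y) else if j = Suc (Suc k) then - (a * x * y) else 0) * g k)"
    using jl by (simp add: lowtri_def lowtri_inv_def scalar_prod_def atLeast0LessThan g_def)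
  also have "\<dots> = (\<Sum>k<n. (if k = j then - a * g k else 0) + (if 1 \<le> j \<and> k = j - 1 then a * (x + y) * g k else 0)
         - (if 2 \<le> j \<and> k = j - 2 then a * x * y * g k else 0))"
  proof (intro sum.cong refl)
    fix k
    consider "j = 0" | "j = 1" | i where "j = Suc (Suc i)" by (metis One_nat_def not0_implies_Suc)
    then show "(if k = j then - a else if j = Suc k then a * (x + y) else if j = Suc (Suc k) then - (a * x * y) else 0) * g k
      = (if k = j then - a * g k else 0) + (if 1 \<le> j \<and> k = j - 1 then a * (x + y) * g k else 0)
         - (if 2 \<le> j \<and> k = j - 2 then a * x * y * g k else 0)"
      by cases auto
  qed
  also have "\<dots> = - a * g j + (if 1 \<le> j then a * (x + y) * g (j - 1) else 0) - (if 2 \<le> j then a * x * y * g (j - 2) else 0)"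
  proof -
    have 1: "(\<Sum>k<n. if P \<and> k = i then h k else 0) = (if P then h i else 0)" if "i < n" for P i and h :: "nat \<Rightarrow> complex"
      using that by (cases P) auto
    have "j - 1 < n" "j - 2 < n" using jl by auto
    then show ?thesis using jl by (simp only: sum_subtractf sum.distrib 1) simp
  qed
  also have "\<dots> = (if j = l then 1 else 0)"
  proof -
    have ag: "a * g i = (if l \<le> i then - ?U (Suc (i - l)) else 0)" for i
      using assms by (simp add: g_def)
    have "- a * g j + (if 1 \<le> j then a * (x + y) * g (j - 1) else 0) - (if 2 \<le> j then a * x * y * g (j - 2) else 0)
      = - (a * g j) + (if 1 \<le> j then (x + y) * (a * g (j - 1)) else 0) - (if 2 \<le> j then x * y * (a * g (j - 2)) else 0)"
      by (simp add: mult_ac)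
    also have "\<dots> = (if j = l then 1 else 0)"
    proof -
      consider "j < l" | "j = l" | "j = Suc l" | i where "j = Suc (Suc (l + i))"
        by (metis add_Suc less_imp_Suc_add linorder_neqE_nat not0_implies_Suc add.right_neutral add.commute)
      then show ?thesis
      proof cases
        case 1
        then show ?thesis unfolding ag by auto
      next
        case 2
        then show ?thesis unfolding ag by auto
      next
        case 3
        then show ?thesis unfolding ag by (cases l) auto
      next
        case 4
        then have "a * g j = - ?U (Suc (Suc (Suc i)))" "a * g (j - 1) = - ?U (Suc (Suc i))" "a * g (j - 2) = - ?U (Suc i)"
          unfolding ag by (simp_all add: Suc_diff_le)
        then have "- (a * g j) + (x + y) * (a * g (j - 1)) - x * y * (a * g (j - 2)) = 0"
          by (simp only:) (simp add: algebra_simps)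
        then show ?thesis using 4 by simp
      qed
    qed
    finally show ?thesis .
  qed
  finally show "(?T * ?G) $$ (j,l) = 1\<^sub>m n $$ (j,l)" using jl by auto
qed (auto simp: lowtri_def lowtri_inv_def)

text \<open>The unitriangular \<open>W\<close> replaces the first column by the matrix applied to
  the solution of the recurrence that starts at the left end. This column vanishes except in the
  last row, and the remaining cofactor is triangular.\<close>

lemma det_tridiag:
  assumes "0 < N"
  shows "det (tridiag (a * (x + y)) a (a * x * y) N) = a ^ N * U_seq x y (Suc N)"
proof -
  let ?U = "U_seq x y" and ?T = "tridiag (a * (x + y)) a (a * x * y) N"
  define W where "W = mat N N (\<lambda>(j,k). if k = 0 then ?U (Suc j) else if j = k then 1 else 0)"
  have c: "?T \<in> carrier_mat N N" "W \<in> carrier_mat N N" by (auto simp: tridiag_def W_def)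
  have "det W = prod_list (diag_mat W)"
    by (rule det_lower_triangular[of N]) (auto simp: W_def)
  also have "diag_mat W = replicate N 1"
    by (rule nth_equalityI) (auto simp: diag_mat_def W_def)
  finally have "det W = 1" by simp
  then have "det ?T = det (?T * W)" using c by (simp add: det_mult)
  also have "\<dots> = (\<Sum>i<N. (?T * W) $$ (i,0) * cofactor (?T * W) i 0)"
    using c assms by (intro laplace_expansion_column[of _ N]) auto
  also have "\<dots> = (\<Sum>i<N. if i = N - 1 then a * ?U (Suc N) * cofactor (?T * W) i 0 else 0)"
  proof (intro sum.cong refl)
    fix i assume "i \<in> {..<N}"
    then have i: "i < N" by simp
    have "(?T * W) $$ (i,0) = (\<Sum>k<N. (if i = k then a * (x + y) else if k = Suc i then - a else if i = Suc k then - (a * x * y) else 0) * (if k < N then ?U (Suc k) else 0))"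
      using i assms by (simp add: tridiag_def W_def scalar_prod_def atLeast0LessThan)
    also have "\<dots> = a * (x + y) * ?U (Suc i) - a * (if Suc i < N then ?U (Suc (Suc i)) else 0) - (if i = 0 then 0 else a * x * y * ?U i)"
      using i by (subst tridiag_row_sum) auto
    also have "\<dots> = (if i = N - 1 then a * ?U (Suc N) else 0)"
    proof (cases "i = N - 1")
      case True
      then have "N = Suc i" using assms by simp
      then show ?thesis by (cases i) (auto simp: algebra_simps)
    next
      case False
      then have "Suc i < N" using i by simp
      then show ?thesis using False by (cases i) (auto simp: algebra_simps)
    qed
    finally show "(?T * W) $$ (i,0) * cofactor (?T * W) i 0 = (if i = N - 1 then a * ?U (Suc N) * cofactor (?T * W) i 0 else 0)"
      by simp
  qed
  also have "\<dots> = a * ?U (Suc N) * cofactor (?T * W) (N - 1) 0" using assms by simp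
  also have "cofactor (?T * W) (N - 1) 0 = (-1) ^ (N - 1) * det (lowtri (a * (x + y)) a (a * x * y) (N - 1))"
  proof -
    have "mat_delete (?T * W) (N - 1) 0 = lowtri (a * (x + y)) a (a * x * y) (N - 1)"
    proof (rule eq_matI)
      fix i j assume "i < dim_row (lowtri (a * (x + y)) a (a * x * y) (N - 1))" "j < dim_col (lowtri (a * (x + y)) a (a * x * y) (N - 1))"
      then have ij: "i < N - 1" "j < N - 1" by (auto simp: lowtri_def)
      then have "mat_delete (?T * W) (N - 1) 0 $$ (i,j) = (?T * W) $$ (i, Suc j)"
        using c by (simp add: mat_delete_def)
      also have "\<dots> = (\<Sum>k<N. ?T $$ (i,k) * (if k = Suc j then 1 else 0))"
        using ij c by (simp add: W_def scalar_prod_def atLeast0LessThan)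
      also have "\<dots> = ?T $$ (i, Suc j)" using ij by (simp add: if_distrib cong: if_cong)
      also have "\<dots> = lowtri (a * (x + y)) a (a * x * y) (N - 1) $$ (i,j)"
        using ij by (auto simp: lowtri_def tridiag_def)
      finally show "mat_delete (?T * W) (N - 1) 0 $$ (i,j) = lowtri (a * (x + y)) a (a * x * y) (N - 1) $$ (i,j)" .
    qed (use c in \<open>auto simp: lowtri_def mat_delete_def\<close>)
    then show ?thesis by (simp add: cofactor_def)
  qed
  also have "a * ?U (Suc N) * ((-1) ^ (N - 1) * det (lowtri (a * (x + y)) a (a * x * y) (N - 1))) = a * ?U (Suc N) * a ^ (N - 1)"
    by (simp add: det_lowtri flip: power_mult_distrib)
  also have "\<dots> = a ^ N * ?U (Suc N)" using assms by (cases N) auto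
  finally show ?thesis .
qed

section \<open>The characteristic determinant outside the ellipse and its dependence on the corner
  entry\<close>

definition resolvent_mat :: "complex \<Rightarrow> complex \<Rightarrow> nat \<Rightarrow> real \<Rightarrow> (nat \<times> nat \<Rightarrow> complex) \<Rightarrow> complex \<Rightarrow> complex mat" where
  "resolvent_mat a b N \<delta> q z = tridiag z a b N + mat N N (\<lambda>p. - (complex_of_real \<delta> * q p))"

lemma resolvent_mat_carrier [simp]: "resolvent_mat a b N \<delta> q z \<in> carrier_mat N N"
  by (simp add: resolvent_mat_def tridiag_def)

lemma poly_char_poly_perturbed_I:
  "poly (char_poly (perturbed_I a b N \<delta> q \<omega>)) z = det (resolvent_mat a b N \<delta> (\<lambda>(j,k). q j k \<omega>) z)"
proof -
  have c: "perturbed_I a b N \<delta> q \<omega> \<in> carrier_mat N N"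
    by (simp add: perturbed_I_def toeplitz_I_def)
  have "- char_matrix (perturbed_I a b N \<delta> q \<omega>) z = resolvent_mat a b N \<delta> (\<lambda>(j,k). q j k \<omega>) z"
    by (rule eq_matI) (auto simp: char_matrix_def perturbed_I_def toeplitz_I_def resolvent_mat_def tridiag_def)
  then show ?thesis using char_poly_matrix[OF c] by simp
qed

text \<open>Here y = b/(a x) has modulus at most |b/a| < 1, so the Green matrix is bounded and the
  noise is a relative perturbation of size N^2 delta B. The complex factor 1 +
  \<open>\<epsilon>\<close> is kept because arguments are needed later as well as moduli.\<close>

lemma det_resolvent_outside:
  assumes a: "a \<noteq> 0" and x: "1 \<le> cmod x" and t: "cmod (b / a) < 1"
    and N: "0 < N" and \<delta>: "0 \<le> \<delta>" and B: "0 \<le> B"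
    and q: "\<And>i j. i < N \<Longrightarrow> j < N \<Longrightarrow> cmod (q (i,j)) \<le> B"
    and small: "(real N)\<^sup>2 * \<delta> * B * (2 / (cmod a * (1 - cmod (b / a)) ^ 3)) \<le> 1 / 2"
  shows "\<exists>\<epsilon>. cmod \<epsilon> \<le> 2 * ((real N)\<^sup>2 * \<delta> * B * (2 / (cmod a * (1 - cmod (b / a)) ^ 3))) \<and>
    det (resolvent_mat a b N \<delta> q (a * x + b / x)) = a ^ N * U_seq x (b / a / x) (Suc N) * (1 + \<epsilon>)"
proof -
  define y where "y = b / a / x"
  define g where "g = 2 / (cmod a * (1 - cmod (b / a)) ^ 3)"
  have x0: "x \<noteq> 0" using x by auto
  have z: "a * x + b / x = a * (x + y)" and bb: "b = a * x * y" and xy: "x * y = b / a"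
    using a x0 by (simp_all add: y_def field_simps)
  have "cmod y = cmod (b / a) / cmod x" unfolding y_def by (rule norm_divide)
  also have "\<dots> \<le> cmod (b / a)" using x by (simp add: divide_le_eq mult_left_le mult_left_mono[of 1 "cmod x", simplified])
  finally have y: "cmod y \<le> cmod (b / a)" .
  let ?T = "tridiag (a * (x + y)) a (a * x * y) N" and ?Q = "mat N N (\<lambda>p. - (complex_of_real \<delta> * q p))"
  have Ug: "cmod x ^ N * (1 - cmod (b / a)) / 2 \<le> cmod (U_seq x y (Suc N))"
    by (rule norm_U_seq_Suc_ge[OF x y t])
  moreover have "0 < cmod x ^ N * (1 - cmod (b / a)) / 2" using t x0 by simp
  ultimately have U0: "U_seq x y (Suc N) \<noteq> 0" by force
  have g0: "0 \<le> g" using t by (simp add: g_def)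
  have D0: "det ?T \<noteq> 0" using U0 a N by (simp add: det_tridiag)
  have "cmod (det (?T + ?Q) - det ?T) \<le> cmod (det ?T) * (2 * (real N * real N * g * (\<delta> * B)))"
  proof (rule det_perturbation)
    show "?T * tridiag_inv a x y N = 1\<^sub>m N" by (rule tridiag_times_inv[OF a U0])
    show "cmod (tridiag_inv a x y N $$ (i,j)) \<le> g" if "i < N" "j < N" for i j
      unfolding g_def using t xy that by (intro norm_tridiag_inv_le a x y) auto
    show "cmod (?Q $$ (i,j)) \<le> \<delta> * B" if "i < N" "j < N" for i j
      using q[OF that] that \<delta> by (simp add: norm_mult mult_left_mono)
    show "real N * real N * g * (\<delta> * B) \<le> 1 / 2"
      using small by (simp add: g_def[symmetric] power2_eq_square mult_ac)
  qed (use g0 \<delta> B in \<open>auto simp: tridiag_def tridiag_inv_def\<close>)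
  then have "cmod (det (?T + ?Q) / det ?T - 1) \<le> 2 * (real N * real N * g * (\<delta> * B))"
    using D0 by (simp add: norm_divide diff_divide_distrib[symmetric] divide_le_eq field_simps flip: norm_mult)
  moreover have "det (?T + ?Q) = det ?T * (1 + (det (?T + ?Q) / det ?T - 1))" using D0 by simp
  moreover have "resolvent_mat a b N \<delta> q (a * x + b / x) = ?T + ?Q"
    unfolding resolvent_mat_def z using bb by simp
  ultimately have "cmod (det (?T + ?Q) / det ?T - 1) \<le> 2 * ((real N)\<^sup>2 * \<delta> * B * g)"
    "det (resolvent_mat a b N \<delta> q (a * x + b / x)) = det ?T * (1 + (det (?T + ?Q) / det ?T - 1))"
    by (simp_all only: power2_eq_square mult_ac)
  then show ?thesis
    unfolding g_def[symmetric] y_def[symmetric] det_tridiag[OF N, symmetric] by blast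
qed

definition resolvent_minor :: "complex \<Rightarrow> complex \<Rightarrow> nat \<Rightarrow> real \<Rightarrow> (nat \<times> nat \<Rightarrow> complex) \<Rightarrow> complex \<Rightarrow> complex mat" where
  "resolvent_minor a b N \<delta> q z = lowtri z a b (N - 1) + mat (N - 1) (N - 1) (\<lambda>(j,k). - (complex_of_real \<delta> * q (j, Suc k)))"

text \<open>Without noise the minor has determinant (-a)^(N - 1) whatever the spectral parameter,
  and its inverse has bounded entries when |x| <= 1 and the second root stays below
  \<open>\<rho>\<close>. The corner entry is exempt from the bound \<open>B\<close> because the
  minor does not contain it.\<close>

lemma norm_det_resolvent_minor_ge:
  assumes a: "a \<noteq> 0" and x: "cmod x \<le> 1" "x \<noteq> 0" and t: "cmod (b / a / x) \<le> \<rho>" "\<rho> < 1"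
    and \<delta>: "0 \<le> \<delta>" and B: "0 \<le> B"
    and q: "\<And>i j. i < N \<Longrightarrow> j < N \<Longrightarrow> (i,j) \<noteq> (N - 1,0) \<Longrightarrow> cmod (q (i,j)) \<le> B"
    and small: "(real N)\<^sup>2 * \<delta> * B * (1 / (cmod a * (1 - \<rho>))) \<le> 1 / 4"
  shows "cmod a ^ (N - 1) / 2 \<le> cmod (det (resolvent_minor a b N \<delta> q (a * x + b / x)))"
proof -
  define y where "y = b / a / x"
  define g where "g = 1 / (cmod a * (1 - \<rho>))"
  define n where "n = N - 1"
  have z: "a * x + b / x = a * (x + y)" and bb: "b = a * x * y"
    using a x by (simp_all add: y_def field_simps)
  let ?T = "lowtri (a * (x + y)) a (a * x * y) n" and ?Q = "mat n n (\<lambda>(j,k). - (complex_of_real \<delta> * q (j, Suc k)))"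
  have g0: "0 \<le> g" using t by (simp add: g_def)
  have "real n * real n * g * (\<delta> * B) \<le> real N * real N * g * (\<delta> * B)"
    using g0 \<delta> B by (intro mult_right_mono mult_mono) (auto simp: n_def)
  also have "\<dots> \<le> 1 / 4"
    using small by (simp add: g_def[symmetric] power2_eq_square mult_ac)
  finally have s: "real n * real n * g * (\<delta> * B) \<le> 1 / 4" .
  have "cmod (det (?T + ?Q) - det ?T) \<le> cmod (det ?T) * (2 * (real n * real n * g * (\<delta> * B)))"
  proof (rule det_perturbation)
    show "?T * lowtri_inv a x y n = 1\<^sub>m n" by (rule lowtri_times_inv[OF a])
    show "cmod (lowtri_inv a x y n $$ (i,j)) \<le> g" if "i < n" "j < n" for i j
    proof -
      have "cmod (lowtri_inv a x y n $$ (i,j)) \<le> (1 / (1 - \<rho>)) / cmod a"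
      proof (cases "j \<le> i")
        case True
        have "cmod (U_seq x y (Suc (i - j))) \<le> 1 / (1 - \<rho>)"
          using x t by (intro norm_U_seq_le) (auto simp: y_def)
        then have "cmod (U_seq x y (Suc (i - j))) / cmod a \<le> (1 / (1 - \<rho>)) / cmod a"
          by (intro divide_right_mono) auto
        then show ?thesis using that True by (simp add: lowtri_inv_def norm_divide)
      next
        case False
        then show ?thesis using that t by (simp add: lowtri_inv_def)
      qed
      then show ?thesis by (simp add: g_def mult.commute)
    qed
    show "cmod (?Q $$ (i,j)) \<le> \<delta> * B" if "i < n" "j < n" for i j
      using q[of i "Suc j"] that \<delta> by (simp add: norm_mult mult_left_mono n_def)
    show "real n * real n * g * (\<delta> * B) \<le> 1 / 2" using s by simp
  qed (use g0 \<delta> B in \<open>auto simp: lowtri_def lowtri_inv_def\<close>)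
  also have "\<dots> \<le> cmod (det ?T) * (1 / 2)" using s by (intro mult_left_mono) auto
  finally have "cmod (det ?T) / 2 \<le> cmod (det (?T + ?Q))"
    using norm_triangle_ineq3[of "det (?T + ?Q)" "det ?T"] by (simp add: abs_le_iff)
  moreover have "resolvent_minor a b N \<delta> q (a * x + b / x) = ?T + ?Q"
    unfolding resolvent_minor_def z n_def[symmetric] using bb by simp
  ultimately show ?thesis by (simp add: det_lowtri norm_power n_def)
qed

lemma det_resolvent_corner:
  assumes N: "3 \<le> N"
  shows "\<exists>\<sigma> c. cmod \<sigma> = 1 \<and> (\<forall>v. det (resolvent_mat a b N \<delta> (q((N - 1, 0) := v)) z)
    = c + \<sigma> * complex_of_real \<delta> * v * det (resolvent_minor a b N \<delta> q z))"
proof -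
  let ?A = "\<lambda>v. resolvent_mat a b N \<delta> (q((N - 1, 0) := v)) z"
  have del: "mat_delete (?A v) (N - 1) j = mat_delete (?A 0) (N - 1) j" if "j < N" for v j
    by (rule eq_matI) (auto simp: mat_delete_def resolvent_mat_def tridiag_def)
  have cof: "cofactor (?A v) (N - 1) j = cofactor (?A 0) (N - 1) j" if "j < N" for v j
    unfolding cofactor_def using del[OF that, of v] by simp
  have min: "mat_delete (?A 0) (N - 1) 0 = resolvent_minor a b N \<delta> q z"
    by (rule eq_matI) (auto simp: mat_delete_def resolvent_mat_def resolvent_minor_def tridiag_def lowtri_def)
  define c where "c = (\<Sum>j\<in>{1..<N}. ?A 0 $$ (N - 1,j) * cofactor (?A 0) (N - 1) j)"
  have "det (?A v) = c + (- ((-1) ^ (N - 1))) * complex_of_real \<delta> * v * det (resolvent_minor a b N \<delta> q z)" for v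
  proof -
    have "det (?A v) = (\<Sum>j<N. ?A v $$ (N - 1,j) * cofactor (?A v) (N - 1) j)"
      using N by (intro laplace_expansion_row) auto
    also have "\<dots> = (\<Sum>j<N. ?A v $$ (N - 1,j) * cofactor (?A 0) (N - 1) j)"
      by (intro sum.cong refl) (metis cof lessThan_iff)
    also have "{..<N} = insert 0 {1..<N}" using N by auto
    also have "(\<Sum>j\<in>insert 0 {1..<N}. ?A v $$ (N - 1,j) * cofactor (?A 0) (N - 1) j)
      = ?A v $$ (N - 1,0) * cofactor (?A 0) (N - 1) 0 + (\<Sum>j\<in>{1..<N}. ?A v $$ (N - 1,j) * cofactor (?A 0) (N - 1) j)"
      by (subst sum.insert) auto
    also have "(\<Sum>j\<in>{1..<N}. ?A v $$ (N - 1,j) * cofactor (?A 0) (N - 1) j) = c"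
      unfolding c_def using N by (intro sum.cong) (auto simp: resolvent_mat_def tridiag_def)
    \<comment> \<open>This needs \<open>3 \<le> N\<close>: for smaller N the bottom left position
      also carries an entry of the unperturbed matrix.\<close>
    also have "?A v $$ (N - 1,0) = - (complex_of_real \<delta> * v)"
      using N by (auto simp: resolvent_mat_def tridiag_def)
    also have "cofactor (?A 0) (N - 1) 0 = (-1) ^ (N - 1) * det (resolvent_minor a b N \<delta> q z)"
      unfolding cofactor_def min by simp
    finally show ?thesis by (simp only:) (simp add: algebra_simps)
  qed
  then show ?thesis by (intro exI[of _ "- ((-1) ^ (N - 1))"] exI[of _ c]) (simp add: norm_power)
qed

section \<open>Jensen's inequality in a half disc\<close>

text \<open>This is \<open>w - l\<close> divided by the Blaschke factor of the left half of the disc of radius \<open>c\<close>, which is the quotient of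
  the Blaschke factors of the disc at \<open>l\<close> and at its mirror image \<open>- cnj l\<close>.\<close>

definition half_disc_factor :: "real \<Rightarrow> complex \<Rightarrow> complex \<Rightarrow> complex" where
  "half_disc_factor c l w = (of_real (c\<^sup>2) - cnj l * w) * (w + cnj l) / (of_real (c\<^sup>2) + l * w)"

lemma half_disc_denom_nonzero:
  assumes "cmod l < c" "cmod w \<le> c"
  shows "complex_of_real (c\<^sup>2) + l * w \<noteq> 0" "complex_of_real (c\<^sup>2) - cnj l * w \<noteq> 0"
proof -
  have c: "0 < c" using assms(1) norm_ge_zero[of l] by linarith
  have "cmod l * cmod w \<le> cmod l * c" using assms by (intro mult_left_mono) auto
  also have "\<dots> < c * c" using assms c by (intro mult_strict_right_mono) auto
  finally have *: "cmod (l * w) < c\<^sup>2" "cmod (cnj l * w) < c\<^sup>2" by (auto simp: norm_mult power2_eq_square)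
  show "complex_of_real (c\<^sup>2) + l * w \<noteq> 0"
  proof
    assume "complex_of_real (c\<^sup>2) + l * w = 0"
    then have "cmod (l * w) = cmod (complex_of_real (c\<^sup>2))"
      by (metis add_eq_0_iff norm_minus_cancel)
    then show False using * by (simp add: norm_power)
  qed
  show "complex_of_real (c\<^sup>2) - cnj l * w \<noteq> 0"
  proof
    assume "complex_of_real (c\<^sup>2) - cnj l * w = 0"
    then have "cmod (cnj l * w) = cmod (complex_of_real (c\<^sup>2))" by simp
    then show False using * by (simp add: norm_power)
  qed
qed

text \<open>On the arc both Blaschke factors have modulus 1. On the diameter
  \<open>cnj w = - w\<close>, which exchanges \<open>l\<close> with its mirror image up to
  conjugation, so the two factors have equal modulus.\<close>

lemma norm_half_disc_factor_boundary:
  assumes l: "cmod l < c" and w: "cmod w \<le> c" "cmod w = c \<or> Re w = 0"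
  shows "cmod (half_disc_factor c l w) = cmod (w - l)"
proof (cases "Re w = 0")
  case True
  then have cw: "cnj w = - w" by (simp add: complex_eq_iff)
  have "cnj (complex_of_real (c\<^sup>2) - cnj l * w) = complex_of_real (c\<^sup>2) + l * w" by (simp add: cw)
  then have 1: "cmod (complex_of_real (c\<^sup>2) - cnj l * w) = cmod (complex_of_real (c\<^sup>2) + l * w)"
    by (metis complex_mod_cnj)
  have "cnj (w + cnj l) = - (w - l)" by (simp add: cw)
  then have 2: "cmod (w + cnj l) = cmod (w - l)" by (metis complex_mod_cnj norm_minus_cancel)
  show ?thesis using half_disc_denom_nonzero(1)[OF l w(1)]
    unfolding half_disc_factor_def norm_mult norm_divide 1 2 by simp
next
  case False
  then have wc: "cmod w = c" using w by simp
  have c: "0 < c" using l norm_ge_zero[of l] by linarith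
  have c2: "complex_of_real (c\<^sup>2) = w * cnj w"
    using complex_norm_square[of w] wc by simp
  have "complex_of_real (c\<^sup>2) - cnj l * w = w * cnj (w - l)" unfolding c2 by (simp add: algebra_simps)
  then have 1: "cmod (complex_of_real (c\<^sup>2) - cnj l * w) = c * cmod (w - l)" by (simp only: norm_mult complex_mod_cnj wc)
  have "complex_of_real (c\<^sup>2) + l * w = w * cnj (w + cnj l)" unfolding c2 by (simp add: algebra_simps)
  then have 2: "cmod (complex_of_real (c\<^sup>2) + l * w) = c * cmod (w + cnj l)" by (simp only: norm_mult complex_mod_cnj wc)
  have "w + cnj l \<noteq> 0" using half_disc_denom_nonzero(1)[OF l w(1)] 2 c by force
  then show ?thesis using c unfolding half_disc_factor_def norm_mult norm_divide 1 2 by simp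
qed

text \<open>The factors w - l may be replaced by half disc factors because these have the same
  modulus on the boundary, where the hypothesis on \<open>M\<close> is used; the maximum principle
  does the rest. Products instead of logarithms avoid integration and any condition on the zeros of
  \<open>g\<close>.\<close>

lemma half_disc_jensen:
  fixes l :: "'i \<Rightarrow> complex"
  assumes fin: "finite I" and g: "g holomorphic_on UNIV"
    and l: "\<And>i. i \<in> I \<Longrightarrow> cmod (l i) < c"
    and M: "\<And>w. cmod w \<le> c \<Longrightarrow> Re w \<le> 0 \<Longrightarrow> cmod ((\<Prod>i\<in>I. w - l i) * g w) \<le> M"
    and w0: "cmod w0 \<le> c" "Re w0 \<le> 0"
  shows "cmod (g w0) * (\<Prod>i\<in>I. cmod (half_disc_factor c (l i) w0)) \<le> M"
proof -
  define S where "S = cball 0 c \<inter> {w. Re w \<le> 0}"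
  define F where "F = (\<lambda>w. g w * (\<Prod>i\<in>I. half_disc_factor c (l i) w))"
  have clS: "closed S" unfolding S_def by (intro closed_Int closed_cball closed_halfspace_Re_le)
  have hol: "F holomorphic_on S"
    unfolding F_def half_disc_factor_def
    by (intro holomorphic_intros holomorphic_on_subset[OF g] half_disc_denom_nonzero(1))
      (auto simp: S_def intro: l)
  have int: "ball 0 c \<inter> {w. Re w < 0} \<subseteq> interior S"
    by (intro interior_maximal open_Int open_ball open_halfspace_Re_lt) (auto simp: S_def)
  have "cmod (F w0) \<le> M"
  proof (rule maximum_modulus_frontier[of F S])
    show "F holomorphic_on interior S" using hol interior_subset holomorphic_on_subset by blast
    show "continuous_on (closure S) F" using hol clS by (simp add: holomorphic_on_imp_continuous_on)
    show "bounded S" unfolding S_def by (rule bounded_subset[OF bounded_cball]) auto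
    show "w0 \<in> S" using w0 by (simp add: S_def)
    fix w assume "w \<in> frontier S"
    then have "w \<in> S" "w \<notin> ball 0 c \<inter> {w. Re w < 0}"
      using clS int by (auto simp: frontier_def)
    then have w: "cmod w \<le> c" "Re w \<le> 0" "cmod w = c \<or> Re w = 0"
      by (auto simp: S_def)
    have "cmod (F w) = cmod (g w) * (\<Prod>i\<in>I. cmod (half_disc_factor c (l i) w))"
      by (simp add: F_def norm_mult prod_norm)
    also have "(\<Prod>i\<in>I. cmod (half_disc_factor c (l i) w)) = (\<Prod>i\<in>I. cmod (w - l i))"
      by (intro prod.cong refl norm_half_disc_factor_boundary l w)
    also have "cmod (g w) * \<dots> = cmod ((\<Prod>i\<in>I. w - l i) * g w)"
      by (simp add: norm_mult prod_norm mult.commute)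
    finally show "cmod (F w) \<le> M" using M w by simp
  qed
  then show ?thesis by (simp add: F_def norm_mult prod_norm)
qed

text \<open>A lower bound for the Green function of the half disc with pole at -s. The half plane
  alone produces the term u = s d / (s^2 + |l|^2) with d = - Re l; the arc contributes a term v of
  the opposite sign, and the hypotheses on \<open>s\<close> and \<open>l\<close> make v at most
  u/2.\<close>

lemma norm_half_disc_factor_ge:
  fixes l :: complex
  assumes s: "0 < s" "s \<le> c / 10" and l: "Re l < 0" "cmod l \<le> 2 * c / 3"
  shows "cmod (- of_real s - l) \<le> exp (- (s * (- Re l) / (s\<^sup>2 + (cmod l)\<^sup>2)) / 4) * cmod (half_disc_factor c l (- of_real s))"
proof -
  define d y where "d = - Re l" and "y = Im l"
  have d: "0 < d" using l by (simp add: d_def)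
  have ly: "l = Complex (- d) y" by (simp add: d_def y_def complex_eq_iff)
  have c: "0 < c" using s by linarith
  define p Z W where "p = s * d" and "Z = s\<^sup>2 + (cmod l)\<^sup>2" and "W = c ^ 4 + s\<^sup>2 * (cmod l)\<^sup>2"
  have l2: "(cmod l)\<^sup>2 = d\<^sup>2 + y\<^sup>2" by (simp add: ly cmod_power2)
  have p0: "0 < p" using s d by (simp add: p_def)
  have Z0: "0 < Z" using s by (simp add: Z_def add_pos_nonneg)
  have c4: "0 < c ^ 4" using c by simp
  have W0: "0 < W" using c4 by (simp add: W_def add_pos_nonneg)
  define u v where "u = p / Z" and "v = c\<^sup>2 * p / W"
  have "2 * p \<le> s\<^sup>2 + d\<^sup>2" using sum_squares_bound[of s d] by (simp add: p_def)
  also have "\<dots> \<le> Z" unfolding Z_def l2 by simp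
  finally have "2 * p \<le> Z" .
  then have u: "0 < u" "u \<le> 1/2" using p0 Z0 by (auto simp: u_def divide_le_eq)
  \<comment> \<open>1/100 + 4/9 < 1/2; this is what the radii c/10 and 2 c/3 are chosen for.\<close>
  have Zc: "Z \<le> c\<^sup>2 / 2"
  proof -
    have "s\<^sup>2 \<le> (c / 10)\<^sup>2" using s by (intro power_mono) auto
    then have "s\<^sup>2 \<le> c\<^sup>2 / 100" by (simp add: power_divide)
    moreover have "(cmod l)\<^sup>2 \<le> (2 * c / 3)\<^sup>2" using l by (intro power_mono) auto
    then have "(cmod l)\<^sup>2 \<le> 4 * c\<^sup>2 / 9" by (simp add: power_divide power_mult_distrib)
    moreover have "0 \<le> c\<^sup>2" by simp
    ultimately show ?thesis unfolding Z_def by linarith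
  qed
  have "c ^ 4 \<le> W" by (simp add: W_def)
  then have "v \<le> c\<^sup>2 * p / c ^ 4" unfolding v_def using p0 c W0 by (intro divide_left_mono) auto
  also have "\<dots> = p / c\<^sup>2" using c by (simp add: field_simps power2_eq_square power4_eq_xxxx)
  also have "\<dots> \<le> p / (2 * Z)" using Zc Z0 p0 c by (intro divide_left_mono) auto
  finally have v: "v \<le> u / 2" by (simp add: u_def)
  have v0: "0 < v" using p0 W0 c by (simp add: v_def)
  have n1: "(cmod (- of_real s - l))\<^sup>2 = Z * (1 - 2 * u)"
  proof -
    have "- of_real s - l = Complex (d - s) (- y)" by (simp add: ly complex_eq_iff)
    then have "(cmod (- of_real s - l))\<^sup>2 = (s - d)\<^sup>2 + y\<^sup>2" by (simp add: cmod_power2 power2_commute)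
    also have "\<dots> = Z - 2 * p" unfolding Z_def l2 p_def by (simp add: power2_eq_square algebra_simps)
    finally show ?thesis using Z0 by (simp add: u_def algebra_simps)
  qed
  have n2: "(cmod (- of_real s + cnj l))\<^sup>2 = Z * (1 + 2 * u)"
  proof -
    have e: "- of_real s + cnj l = Complex (- (s + d)) (- y)" by (simp add: ly complex_eq_iff)
    have "(cmod (- of_real s + cnj l))\<^sup>2 = (s + d)\<^sup>2 + y\<^sup>2" unfolding e cmod_power2 by (simp add: power2_eq_square algebra_simps)
    also have "\<dots> = Z + 2 * p" unfolding Z_def l2 p_def by (simp add: power2_eq_square algebra_simps)
    finally show ?thesis using Z0 by (simp add: u_def algebra_simps)
  qed
  have n3: "(cmod (of_real (c\<^sup>2) + l * (- of_real s)))\<^sup>2 = W * (1 + 2 * v)"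
  proof -
    have "of_real (c\<^sup>2) + l * (- of_real s) = Complex (c\<^sup>2 + s * d) (- s * y)" by (simp add: ly complex_eq_iff mult.commute)
    then have "(cmod (of_real (c\<^sup>2) + l * (- of_real s)))\<^sup>2 = (c\<^sup>2 + s * d)\<^sup>2 + (s * y)\<^sup>2" by (simp add: cmod_power2 power_mult_distrib)
    also have "\<dots> = W + 2 * (c\<^sup>2 * p)" unfolding W_def l2 p_def by (simp add: power2_eq_square power4_eq_xxxx algebra_simps)
    finally show ?thesis using W0 by (simp add: v_def algebra_simps)
  qed
  have n4: "(cmod (of_real (c\<^sup>2) - cnj l * (- of_real s)))\<^sup>2 = W * (1 - 2 * v)"
  proof -
    have "of_real (c\<^sup>2) - cnj l * (- of_real s) = Complex (c\<^sup>2 - s * d) (- s * y)" by (simp add: ly complex_eq_iff mult.commute)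
    then have "(cmod (of_real (c\<^sup>2) - cnj l * (- of_real s)))\<^sup>2 = (c\<^sup>2 - s * d)\<^sup>2 + (s * y)\<^sup>2" by (simp add: cmod_power2 power_mult_distrib)
    also have "\<dots> = W - 2 * (c\<^sup>2 * p)" unfolding W_def l2 p_def by (simp add: power2_eq_square power4_eq_xxxx algebra_simps)
    finally show ?thesis using W0 by (simp add: v_def algebra_simps)
  qed
  have v14: "1 - 2 * v > 0" using v u by linarith
  \<comment> \<open>Replacing v by its upper bound u/2 leaves a polynomial inequality in u alone,
    valid for 0 < u <= 1/2.\<close>
  have poly: "(1 - 2 * u) * (1 + 2 * v) \<le> (1 - u / 2) * ((1 - 2 * v) * (1 + 2 * u))"
  proof -
    have "(1 - 2 * u) * (1 + 2 * v) \<le> (1 - 2 * u) * (1 + u)"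
      using v u by (intro mult_left_mono) auto
    also have "\<dots> \<le> (1 - u / 2) * ((1 - u) * (1 + 2 * u))"
    proof -
      have "(1 - u / 2) * ((1 - u) * (1 + 2 * u)) - (1 - 2 * u) * (1 + u) = u * (3 / 2 - u / 2 + u\<^sup>2)"
        by (simp add: field_simps power2_eq_square)
      also have "\<dots> \<ge> 0" using u by (intro mult_nonneg_nonneg) (auto intro: add_nonneg_nonneg)
      finally show ?thesis by linarith
    qed
    also have "\<dots> \<le> (1 - u / 2) * ((1 - 2 * v) * (1 + 2 * u))"
      using v u by (intro mult_left_mono mult_right_mono) auto
    finally show ?thesis .
  qed
  have hd: "(cmod (half_disc_factor c l (- of_real s)))\<^sup>2 = W * (1 - 2 * v) * (Z * (1 + 2 * u)) / (W * (1 + 2 * v))"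
    unfolding half_disc_factor_def norm_divide norm_mult power_divide power_mult_distrib n2 n3 n4 ..
  have "(cmod (- of_real s - l))\<^sup>2 = Z * (((1 - 2 * u) * (1 + 2 * v)) / (1 + 2 * v))"
    using v0 by (simp add: n1)
  also have "\<dots> \<le> Z * (((1 - u / 2) * ((1 - 2 * v) * (1 + 2 * u))) / (1 + 2 * v))"
    using Z0 v0 by (intro mult_left_mono divide_right_mono poly) auto
  also have "\<dots> = (1 - u / 2) * (cmod (half_disc_factor c l (- of_real s)))\<^sup>2"
    unfolding hd using W0 by simp
  also have "\<dots> \<le> exp (- u / 2) * (cmod (half_disc_factor c l (- of_real s)))\<^sup>2"
    using exp_ge_add_one_self[of "- u / 2"] by (intro mult_right_mono) auto
  also have "exp (- u / 2) = (exp (- u / 4))\<^sup>2" by (simp flip: exp_double)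
  finally have "(cmod (- of_real s - l))\<^sup>2 \<le> (exp (- u / 4) * cmod (half_disc_factor c l (- of_real s)))\<^sup>2"
    by (simp add: power_mult_distrib)
  then have "cmod (- of_real s - l) \<le> exp (- u / 4) * cmod (half_disc_factor c l (- of_real s))"
    by (rule power2_le_imp_le) auto
  then show ?thesis by (simp add: u_def p_def Z_def d_def)
qed

text \<open>Jensen's inequality at the point -s. Zeros that are not listed may stay inside
  \<open>g\<close>. The weight of a zero vanishes linearly at the diameter, so nothing is claimed
  about the number of zeros.\<close>

lemma half_disc_zero_sum:
  fixes l :: "'i \<Rightarrow> complex"
  assumes fin: "finite I" and g: "g holomorphic_on UNIV"
    and l: "\<And>i. i \<in> I \<Longrightarrow> Re (l i) < 0" "\<And>i. i \<in> I \<Longrightarrow> cmod (l i) \<le> 2 * c / 3"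
    and M: "\<And>w. cmod w \<le> c \<Longrightarrow> Re w \<le> 0 \<Longrightarrow> cmod ((\<Prod>i\<in>I. w - l i) * g w) \<le> M"
    and s: "0 < s" "s \<le> c / 10"
    and m: "0 < m" "m \<le> cmod ((\<Prod>i\<in>I. - of_real s - l i) * g (- of_real s))"
  shows "(\<Sum>i\<in>I. s * (- Re (l i)) / (s\<^sup>2 + (cmod (l i))\<^sup>2)) \<le> 4 * ln (M / m)"
proof -
  let ?S = "\<Sum>i\<in>I. s * (- Re (l i)) / (s\<^sup>2 + (cmod (l i))\<^sup>2)"
  let ?w = "- complex_of_real s"
  have c: "0 < c" using s by linarith
  have "m \<le> (\<Prod>i\<in>I. cmod (?w - l i)) * cmod (g ?w)"
    using m by (simp add: norm_mult prod_norm)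
  also have "(\<Prod>i\<in>I. cmod (?w - l i)) \<le> (\<Prod>i\<in>I. exp (- (s * (- Re (l i)) / (s\<^sup>2 + (cmod (l i))\<^sup>2)) / 4) * cmod (half_disc_factor c (l i) ?w))"
    by (intro prod_mono conjI norm_ge_zero norm_half_disc_factor_ge s l)
  also have "\<dots> = exp (\<Sum>i\<in>I. - (s * (- Re (l i)) / (s\<^sup>2 + (cmod (l i))\<^sup>2)) / 4) * (\<Prod>i\<in>I. cmod (half_disc_factor c (l i) ?w))"
    by (simp add: prod.distrib exp_sum fin)
  also have "(\<Sum>i\<in>I. - (s * (- Re (l i)) / (s\<^sup>2 + (cmod (l i))\<^sup>2)) / 4) = - ?S / 4"
    by (simp add: sum_divide_distrib sum_negf)
  finally have "m \<le> exp (- ?S / 4) * (\<Prod>i\<in>I. cmod (half_disc_factor c (l i) ?w)) * cmod (g ?w)"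
    by (simp add: mult_right_mono)
  also have "\<dots> = exp (- ?S / 4) * (cmod (g ?w) * (\<Prod>i\<in>I. cmod (half_disc_factor c (l i) ?w)))" by simp
  also have "\<dots> \<le> exp (- ?S / 4) * M"
  proof (intro mult_left_mono half_disc_jensen[OF fin g _ M])
    show "cmod (l i) < c" if "i \<in> I" for i using l(2)[OF that] c by linarith
  qed (use s in auto)
  finally have mM: "m \<le> exp (- ?S / 4) * M" .
  then have M0: "0 < M" using m by (smt (verit) exp_gt_zero zero_less_mult_pos)
  have "ln m \<le> ln (exp (- ?S / 4) * M)" using mM m by (intro ln_mono) auto
  also have "\<dots> = - ?S / 4 + ln M" using M0 by (subst ln_mult) auto
  finally show ?thesis using m M0 by (simp add: ln_div)
qed

section \<open>Zeros of the normalised determinant in the logarithmic coordinate\<close>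

text \<open>Splits off the zero of exp u - 1 at 0 as a linear factor with entire quotient, the form
  in which zeros enter \<open>half_disc_zero_sum\<close>.\<close>

lemma exp_minus_one_factor: "\<exists>E. E holomorphic_on UNIV \<and> (\<forall>u::complex. exp u - 1 = u * E u)"
proof -
  define E where "E = (\<lambda>u::complex. if u = 0 then 1 else (exp u - 1) / u)"
  have "((\<lambda>u. exp u - 1) has_field_derivative exp 0) (at (0::complex))"
    by (auto intro!: derivative_eq_intros)
  then have d: "deriv (\<lambda>u::complex. exp u - 1) 0 = 1" by (simp add: DERIV_imp_deriv)
  have "E holomorphic_on UNIV"
  proof (rule pole_theorem_0)
    show "(\<lambda>u::complex. exp u - 1) holomorphic_on UNIV" by (intro holomorphic_intros)
    show "exp z - 1 = (z - 0) * E z" if "z \<in> UNIV - {0}" for z using that by (simp add: E_def)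
    show "E 0 = deriv (\<lambda>u::complex. exp u - 1) 0" by (simp add: E_def d)
  qed auto
  moreover have "exp u - 1 = u * E u" for u by (simp add: E_def)
  ultimately show ?thesis by blast
qed

text \<open>The roots of smaller modulus are \<open>\<tau> / \<zeta> i\<close>, and the product is the characteristic polynomial divided by \<open>(a x)\<^sup>N\<close>.\<close>

locale circle_zeros =
  fixes \<tau> :: complex and N :: nat and \<zeta> :: "nat \<Rightarrow> complex" and K :: real
  assumes tau0: "\<tau> \<noteq> 0" and tau1: "cmod \<tau> < 1" and K1: "1 \<le> K"
    and zeta_ge: "\<And>i. i < N \<Longrightarrow> cmod \<tau> \<le> (cmod (\<zeta> i))\<^sup>2"
    and outside: "\<And>x. 1 \<le> cmod x \<Longrightarrow>
      (\<Prod>i<N. (1 - \<zeta> i / x) * (1 - \<tau> / (\<zeta> i * x))) \<notin> \<real>\<^sub>\<le>\<^sub>0 \<and>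
      cmod (\<Prod>i<N. (1 - \<zeta> i / x) * (1 - \<tau> / (\<zeta> i * x))) \<in> {1 / K..K}"
begin

text \<open>The determinant divided by a^N, not by (a x)^N: this version is invariant under x ->
  tau/x and bounded on the annulus.\<close>

definition G :: "complex \<Rightarrow> complex" where
  "G x = (\<Prod>i<N. (x - \<zeta> i) * (1 - \<tau> / (\<zeta> i * x)))"

definition depth :: "nat \<Rightarrow> real" where "depth i = - ln (cmod (\<zeta> i))"

text \<open>Width of the annulus |tau| < |x| < 1 in the coordinate ln x. The larger root lies in its
  outer half, so depths are at most \<open>ell / 2\<close>.\<close>

definition ell :: real where "ell = - ln (cmod \<tau>)"

text \<open>Slightly less than \<open>ell\<close>, so that a half disc of this radius with its
  diameter on the circle stays in the annulus, while 2/3 of it, which is 0.6 \<open>ell\<close>,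
  still exceeds the largest possible depth.\<close>

definition rad :: real where "rad = 9 / 10 * ell"

text \<open>Position of a zero relative to the point of angle \<open>\<alpha>\<close> in the
  coordinate ln x. Its real part is minus the depth, whatever the angle.\<close>

definition dev :: "real \<Rightarrow> nat \<Rightarrow> complex" where "dev \<alpha> i = Ln (\<zeta> i * exp (- \<i> * of_real \<alpha>))"

lemma ell_pos: "0 < ell" using tau0 tau1 by (simp add: ell_def)

lemma zeta_nonzero: "i < N \<Longrightarrow> \<zeta> i \<noteq> 0" using zeta_ge[of i] tau0 by auto

lemma zeta_lt: assumes "i < N" shows "cmod (\<zeta> i) < 1"
proof (rule ccontr)
  assume "\<not> ?thesis"
  then have "1 \<le> cmod (\<zeta> i)" by simp
  from outside[OF this] have "(\<Prod>j<N. (1 - \<zeta> j / \<zeta> i) * (1 - \<tau> / (\<zeta> j * \<zeta> i))) \<noteq> 0" by force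
  moreover have "(\<Prod>j<N. (1 - \<zeta> j / \<zeta> i) * (1 - \<tau> / (\<zeta> j * \<zeta> i))) = 0"
    using assms zeta_nonzero[OF assms] by (intro prod_zero) auto
  ultimately show False by contradiction
qed

lemma G_eq: assumes "x \<noteq> 0" shows "G x = x ^ N * (\<Prod>i<N. (1 - \<zeta> i / x) * (1 - \<tau> / (\<zeta> i * x)))"
proof -
  have "G x = (\<Prod>i<N. x * ((1 - \<zeta> i / x) * (1 - \<tau> / (\<zeta> i * x))))"
    unfolding G_def using assms by (intro prod.cong) (auto simp: field_simps)
  then show ?thesis by (simp only: prod.distrib prod_constant) simp
qed

lemma G_reflect: assumes "x \<noteq> 0" shows "G (\<tau> / x) = G x"
  unfolding G_def using assms tau0 zeta_nonzero by (intro prod.cong refl) (auto simp: field_simps)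

text \<open>The map x -> tau/x exchanges the two boundary circles, so the bound on the unit circle
  suffices for the maximum principle on the annulus, which covers the interior of the ellipse
  twice.\<close>

lemma norm_G_le: assumes "cmod \<tau> \<le> cmod x" "cmod x \<le> 1" shows "cmod (G x) \<le> K"
proof -
  define S where "S = cball (0::complex) 1 - ball 0 (cmod \<tau>)"
  have clS: "closed S" unfolding S_def by (intro closed_Diff) auto
  have S0: "x \<noteq> 0" if "x \<in> S" for x using that tau0 by (auto simp: S_def)
  have hol: "G holomorphic_on S"
    unfolding G_def using S0 zeta_nonzero by (intro holomorphic_intros) auto
  have circ: "cmod (G x) \<le> K" if "cmod x = 1" for x
    using outside[of x] that by (subst G_eq) (auto simp: norm_mult norm_power)
  show ?thesis
  proof (rule maximum_modulus_frontier[of G S])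
    show "G holomorphic_on interior S" using hol interior_subset holomorphic_on_subset by blast
    show "continuous_on (closure S) G" using hol clS by (simp add: holomorphic_on_imp_continuous_on)
    show "bounded S" unfolding S_def by (rule bounded_subset[OF bounded_cball]) auto
    show "x \<in> S" using assms by (simp add: S_def)
    fix w assume w: "w \<in> frontier S"
    have "ball 0 1 - cball 0 (cmod \<tau>) \<subseteq> interior S"
      by (intro interior_maximal open_Diff) (auto simp: S_def)
    then have "w \<notin> ball 0 1 - cball 0 (cmod \<tau>)" "w \<in> S" using w clS by (auto simp: frontier_def)
    then have "cmod w = 1 \<or> cmod w = cmod \<tau>" by (auto simp: S_def)
    then show "cmod (G w) \<le> K"
    proof
      assume "cmod w = 1" then show ?thesis by (rule circ)
    next
      assume *: "cmod w = cmod \<tau>"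
      then have "w \<noteq> 0" using tau0 by auto
      moreover have "cmod (\<tau> / w) = 1" using * tau0 by (simp add: norm_divide)
      ultimately show ?thesis using circ[of "\<tau> / w"] G_reflect[of w] by simp
    qed
  qed
qed

lemma exp_dev: "i < N \<Longrightarrow> exp (dev \<alpha> i) = \<zeta> i * exp (- \<i> * of_real \<alpha>)"
  using zeta_nonzero by (simp add: dev_def)

lemma Re_dev: assumes "i < N" shows "Re (dev \<alpha> i) = - depth i"
proof -
  have "cmod (exp (- \<i> * of_real \<alpha>)) = 1" by (simp add: norm_exp_eq_Re)
  then show ?thesis
    using zeta_nonzero[OF assms] by (simp add: dev_def depth_def norm_mult)
qed

lemma depth_pos: assumes "i < N" shows "0 < depth i"
  using zeta_lt[OF assms] zeta_nonzero[OF assms] by (simp add: depth_def)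

lemma depth_le: assumes "i < N" shows "depth i \<le> ell / 2"
proof -
  have "ln (cmod \<tau>) \<le> ln ((cmod (\<zeta> i))\<^sup>2)" using zeta_ge[OF assms] tau0 zeta_nonzero[OF assms] by (subst ln_le_cancel_iff) auto
  also have "\<dots> = 2 * ln (cmod (\<zeta> i))" using zeta_nonzero[OF assms] by (simp add: ln_realpow)
  finally show ?thesis by (simp add: depth_def ell_def)
qed

text \<open>\<open>half_disc_zero_sum\<close> in the variable w = ln x - i alpha. Zeros beyond 2/3
  of the radius, and the translates of the listed ones by multiples of 2 pi i, remain in the entire
  factor.\<close>

lemma green_sum:
  assumes s: "0 < s" "s \<le> rad / 10" and m: "0 < m" "m \<le> cmod (G (exp (\<i> * of_real \<alpha> - of_real s)))"
  shows "(\<Sum>i | i < N \<and> cmod (dev \<alpha> i) \<le> 2 * rad / 3. s * depth i / (s\<^sup>2 + (cmod (dev \<alpha> i))\<^sup>2)) \<le> 4 * ln (K / m)"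
proof -
  define I where "I = {i. i < N \<and> cmod (dev \<alpha> i) \<le> 2 * rad / 3}"
  have fin: "finite I" and IN: "I \<subseteq> {..<N}" by (auto simp: I_def)
  obtain E where E: "E holomorphic_on UNIV" and expE: "\<And>u::complex. exp u - 1 = u * E u"
    using exp_minus_one_factor by blast
  let ?a = "\<i> * complex_of_real \<alpha>"
  define g where "g = (\<lambda>w. (\<Prod>i\<in>I. \<zeta> i * E (w - dev \<alpha> i)) * (\<Prod>i\<in>{..<N} - I. exp (w + ?a) - \<zeta> i) *
     (\<Prod>i<N. 1 - \<tau> / \<zeta> i * exp (- (w + ?a))))"
  have "(E \<circ> (\<lambda>w. w - dev \<alpha> i)) holomorphic_on UNIV" for i
    by (rule holomorphic_on_compose_gen[of _ _ _ UNIV]) (auto intro!: holomorphic_intros E)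
  then have "(\<lambda>w. E (w - dev \<alpha> i)) holomorphic_on UNIV" for i by (simp add: o_def)
  then have ghol: "g holomorphic_on UNIV" unfolding g_def by (intro holomorphic_intros)
  have fac: "(\<Prod>i\<in>I. w - dev \<alpha> i) * g w = G (exp (w + ?a))" for w
  proof -
    have 1: "(w - dev \<alpha> i) * (\<zeta> i * E (w - dev \<alpha> i)) = exp (w + ?a) - \<zeta> i" if "i \<in> I" for i
    proof -
      have i: "i < N" using that IN by auto
      have "\<zeta> i = exp (dev \<alpha> i) * exp ?a" using exp_dev[OF i, of \<alpha>] by (simp add: exp_minus)
      then have "exp (w + ?a) - \<zeta> i = \<zeta> i * (exp (w - dev \<alpha> i) - 1)"
        by (simp add: exp_add exp_diff algebra_simps)
      then show ?thesis by (simp add: expE)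
    qed
    have "(\<Prod>i\<in>I. w - dev \<alpha> i) * g w = (\<Prod>i\<in>I. (w - dev \<alpha> i) * (\<zeta> i * E (w - dev \<alpha> i))) *
       (\<Prod>i\<in>{..<N} - I. exp (w + ?a) - \<zeta> i) * (\<Prod>i<N. 1 - \<tau> / \<zeta> i * exp (- (w + ?a)))"
      by (simp add: g_def prod.distrib)
    also have "(\<Prod>i\<in>I. (w - dev \<alpha> i) * (\<zeta> i * E (w - dev \<alpha> i))) = (\<Prod>i\<in>I. exp (w + ?a) - \<zeta> i)"
      by (intro prod.cong refl 1)
    also have "(\<Prod>i\<in>I. exp (w + ?a) - \<zeta> i) * (\<Prod>i\<in>{..<N} - I. exp (w + ?a) - \<zeta> i) = (\<Prod>i<N. exp (w + ?a) - \<zeta> i)"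
      by (subst prod.subset_diff[OF IN finite_lessThan]) (rule mult.commute)
    finally have 2: "(\<Prod>i\<in>I. w - dev \<alpha> i) * g w = (\<Prod>i<N. exp (w + ?a) - \<zeta> i) * (\<Prod>i<N. 1 - \<tau> / \<zeta> i * exp (- (w + ?a)))" .
    have "\<tau> / (\<zeta> i * exp (w + ?a)) = \<tau> / \<zeta> i * exp (- (w + ?a))" for i
      by (subst exp_minus) (simp add: divide_inverse)
    then show ?thesis unfolding 2 G_def prod.distrib by simp
  qed
  have "(\<Sum>i\<in>I. s * (- Re (dev \<alpha> i)) / (s\<^sup>2 + (cmod (dev \<alpha> i))\<^sup>2)) \<le> 4 * ln (K / m)"
  proof (rule half_disc_zero_sum[OF fin ghol])
    show "Re (dev \<alpha> i) < 0" if "i \<in> I" for i using that depth_pos[of i] by (simp add: I_def Re_dev)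
    show "cmod (dev \<alpha> i) \<le> 2 * rad / 3" if "i \<in> I" for i using that by (simp add: I_def)
    show "m \<le> cmod ((\<Prod>i\<in>I. - of_real s - dev \<alpha> i) * g (- of_real s))"
      using m unfolding fac by simp
    fix w assume w: "cmod w \<le> rad" "Re w \<le> 0"
    have "- ell \<le> - rad" using ell_pos by (simp add: rad_def)
    also have "\<dots> \<le> Re w" using w abs_Re_le_cmod[of w] by linarith
    finally have "exp (- ell) \<le> exp (Re w)" by simp
    then have "cmod \<tau> \<le> cmod (exp (w + ?a))" using tau0 by (simp add: ell_def)
    moreover have "cmod (exp (w + ?a)) \<le> 1" using w by simp
    ultimately show "cmod ((\<Prod>i\<in>I. w - dev \<alpha> i) * g w) \<le> K" unfolding fac by (rule norm_G_le)
  qed (use s m in auto)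
  also have "(\<Sum>i\<in>I. s * (- Re (dev \<alpha> i)) / (s\<^sup>2 + (cmod (dev \<alpha> i))\<^sup>2)) = (\<Sum>i\<in>I. s * depth i / (s\<^sup>2 + (cmod (dev \<alpha> i))\<^sup>2))"
    using IN by (intro sum.cong refl) (auto simp: Re_dev)
  finally show ?thesis by (simp add: I_def)
qed

end

section \<open>The argument of one factor and the sum of its errors\<close>

lemma norm_one_minus_ray_mono:
  assumes "cmod w \<le> 1" "1 \<le> r" "r \<le> r'" "cmod e = 1"
  shows "cmod (of_real r * e - w) \<le> cmod (of_real r' * e - w)"
proof -
  have e: "e * cnj e = 1" using complex_norm_square[of e] assms by simp
  have 1: "cmod (of_real t * e - w) = cmod (of_real t - w * cnj e)" for t
  proof -
    have "of_real t * e - w = e * (of_real t - w * cnj e)" using e by (simp add: algebra_simps)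
    then show ?thesis using assms by (simp add: norm_mult)
  qed
  have we: "cmod (w * cnj e) \<le> 1" using assms by (simp add: norm_mult)
  then have "Re (w * cnj e) \<le> 1" using complex_Re_le_cmod order.trans by blast
  then have "(r - Re (w * cnj e))\<^sup>2 \<le> (r' - Re (w * cnj e))\<^sup>2" using assms by (intro power_mono) auto
  then have "(cmod (of_real r - w * cnj e))\<^sup>2 \<le> (cmod (of_real r' - w * cnj e))\<^sup>2" by (simp add: cmod_power2)
  then show ?thesis unfolding 1 by (rule power2_le_imp_le) simp
qed

lemma Ln_one_minus_lipschitz:
  assumes "cmod u \<le> \<rho>" "cmod v \<le> \<rho>" "\<rho> < 1"
  shows "cmod (Ln (1 - u) - Ln (1 - v)) \<le> cmod (u - v) / (1 - \<rho>)"
proof -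
  have "cmod (Ln (1 - u) - Ln (1 - v)) \<le> (1 / (1 - \<rho>)) * cmod (u - v)"
  proof (rule field_differentiable_bound[where S = "cball 0 \<rho>" and f' = "\<lambda>z. - 1 / (1 - z)"])
    fix z :: complex assume z: "z \<in> cball 0 \<rho>"
    then have "Re z < 1" using complex_Re_le_cmod[of z] assms by auto
    then have "1 - z \<notin> \<real>\<^sub>\<le>\<^sub>0" by (auto simp: complex_nonpos_Reals_iff)
    then show "((\<lambda>z. Ln (1 - z)) has_field_derivative - 1 / (1 - z)) (at z within cball 0 \<rho>)"
      by (auto intro!: derivative_eq_intros simp: divide_inverse)
    have "1 - \<rho> \<le> cmod (1 - z)" using z norm_triangle_ineq2[of 1 z] by auto
    then show "cmod (- 1 / (1 - z)) \<le> 1 / (1 - \<rho>)"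
      using assms by (simp add: norm_divide frac_le)
  qed (use assms in auto)
  then show ?thesis by simp
qed

text \<open>For r = 1 the identity 1 - exp(i phi) = 2 sin(phi/2) exp(i (phi - pi)/2) gives the
  sawtooth exactly. For r < 1 the relative change is \<open>\<eta>\<close>. If it is below 1/2, its
  logarithm is at most twice as large; otherwise the right side is at least 10/3 > pi and the bound
  is trivial, which explains the constant 10. At the jump phi = 0 the error is pi/2 and the quotient
  is 1.\<close>

lemma Im_Ln_one_minus_approx:
  assumes r: "0 < r" "r < 1" and \<phi>: "0 \<le> \<phi>" "\<phi> < 2 * pi"
  shows "\<bar>Im (Ln (1 - of_real r * exp (\<i> * of_real \<phi>))) - (\<phi> - pi) / 2\<bar>
    \<le> 10 * ((1 - r) / cmod (of_real r * exp (\<i> * of_real \<phi>) - 1))"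
proof (cases "\<phi> = 0")
  case True
  have "Ln (1 - of_real r) = of_real (ln (1 - r))" using r Ln_of_real[of "1 - r"] by simp
  moreover have "cmod (complex_of_real r - 1) = 1 - r" using r
    by (metis abs_minus_commute abs_of_pos diff_gt_0_iff_gt norm_of_real of_real_1 of_real_diff)
  ultimately show ?thesis using True r pi_less_4 by simp
next
  case False
  let ?e = "exp (\<i> * complex_of_real \<phi>)"
  have ne: "cmod ?e = 1" by simp
  define E where "E = 1 - ?e"
  define c where "c = 2 * sin (\<phi> / 2)"
  have c: "0 < c" using False \<phi> unfolding c_def by (intro mult_pos_pos sin_gt_zero) auto
  have "of_real c * exp (\<i> * of_real ((\<phi> - pi) / 2)) = E"
  proof -
    have "Re (of_real c * exp (\<i> * of_real ((\<phi> - pi) / 2))) = c * cos (\<phi> / 2 - pi / 2)"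
      by (simp add: Re_exp diff_divide_distrib)
    also have "\<dots> = 2 * sin (\<phi> / 2) * sin (\<phi> / 2)" by (simp add: c_def cos_diff)
    also have "\<dots> = Re E" using cos_double_sin[of "\<phi> / 2"] by (simp add: E_def Re_exp power2_eq_square)
    finally have 1: "Re (of_real c * exp (\<i> * of_real ((\<phi> - pi) / 2))) = Re E" .
    have "Im (of_real c * exp (\<i> * of_real ((\<phi> - pi) / 2))) = c * sin (\<phi> / 2 - pi / 2)"
      by (simp add: Im_exp diff_divide_distrib)
    also have "\<dots> = - (2 * sin (\<phi> / 2) * cos (\<phi> / 2))" by (simp add: c_def sin_diff)
    also have "\<dots> = Im E" using sin_double[of "\<phi> / 2"] by (simp add: E_def Im_exp)
    finally show ?thesis using 1 by (simp add: complex_eq_iff)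
  qed
  then have "E = exp (of_real (ln c) + \<i> * of_real ((\<phi> - pi) / 2))"
    using c by (simp add: exp_add exp_of_real)
  then have LnE: "Ln E = of_real (ln c) + \<i> * of_real ((\<phi> - pi) / 2)" and E0: "E \<noteq> 0"
    using \<phi> by (simp_all add: Ln_exp)
  define \<eta> where "\<eta> = (1 - of_real r) * ?e / E"
  have n\<eta>: "cmod \<eta> = (1 - r) / cmod E"
  proof -
    have "cmod (1 - complex_of_real r) = 1 - r" using r
      by (metis abs_of_pos diff_gt_0_iff_gt norm_of_real of_real_1 of_real_diff)
    then show ?thesis by (simp add: \<eta>_def norm_divide norm_mult)
  qed
  have fac: "1 - of_real r * ?e = E * (1 + \<eta>)" using E0 by (simp add: \<eta>_def field_simps) (simp add: E_def algebra_simps)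
  have nE: "cmod (of_real r * ?e - 1) \<le> (1 - r) + cmod E"
  proof -
    have "of_real r * ?e - 1 = - ((1 - of_real r) * ?e) - E" by (simp add: E_def algebra_simps)
    then have "cmod (of_real r * ?e - 1) \<le> cmod ((1 - of_real r) * ?e) + cmod E"
      by (metis norm_minus_cancel norm_triangle_ineq4)
    also have "cmod ((1 - of_real r) * ?e) = 1 - r"
      using n\<eta> r by (metis abs_of_pos diff_gt_0_iff_gt mult.right_neutral ne norm_mult norm_of_real of_real_1 of_real_diff)
    finally show ?thesis .
  qed
  define A where "A = cmod (of_real r * ?e - 1)"
  have pos: "0 < cmod (of_real r * ?e - 1)"
  proof -
    have "1 - r \<le> cmod (of_real r * ?e - 1)"
      using norm_triangle_ineq2[of 1 "of_real r * ?e"] r by (simp add: norm_mult norm_minus_commute)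
    then show ?thesis using r by linarith
  qed
  show ?thesis
  proof (cases "cmod \<eta> < 1 / 2")
    case True
    then have L: "cmod (Ln (1 + \<eta>)) \<le> 2 * cmod \<eta>" by (rule norm_Ln_le)
    have i: "\<bar>Im (Ln (1 + \<eta>))\<bar> \<le> 2 * cmod \<eta>" using L abs_Im_le_cmod order.trans by blast
    have e0: "1 + \<eta> \<noteq> 0"
    proof
      assume "1 + \<eta> = 0"
      then have "\<eta> = - 1" by (simp add: add_eq_0_iff)
      then show False using True by simp
    qed
    have b: "\<bar>Im (Ln (1 + \<eta>))\<bar> < 1" using i True by linarith
    have "- pi < (\<phi> - pi) / 2 + Im (Ln (1 + \<eta>))" "(\<phi> - pi) / 2 + Im (Ln (1 + \<eta>)) \<le> pi"
      using b \<phi> pi_gt3 by (argo, argo)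
    then    have "Ln (E * (1 + \<eta>)) = Ln E + Ln (1 + \<eta>)"
      by (intro Ln_times_simple E0 e0) (simp_all add: LnE)
    then have "\<bar>Im (Ln (1 - of_real r * ?e)) - (\<phi> - pi) / 2\<bar> = \<bar>Im (Ln (1 + \<eta>))\<bar>"
      by (simp add: fac LnE)
    also have "\<dots> \<le> 2 * ((1 - r) / cmod E)" using i n\<eta> by simp
    also have "\<dots> \<le> 10 * ((1 - r) / cmod (of_real r * ?e - 1))"
    proof -
      have "1 - r \<le> cmod E / 2" using True E0 unfolding n\<eta> by (simp add: field_simps)
      moreover have "0 < cmod E" using E0 by simp
      ultimately have "A \<le> 5 * cmod E" using nE unfolding A_def by argo
      then have "(1 - r) / (5 * cmod E) \<le> (1 - r) / A"
        using pos r E0 unfolding A_def by (intro divide_left_mono mult_pos_pos) auto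
      moreover have "2 * ((1 - r) / cmod E) = 10 * ((1 - r) / (5 * cmod E))" using E0 by (simp add: field_simps)
      ultimately show ?thesis unfolding A_def by (simp only:)
    qed
    finally show ?thesis .
  next
    case False
    then have "cmod E / 2 \<le> 1 - r" using E0 unfolding n\<eta> by (simp add: field_simps)
    then have "A \<le> 3 * (1 - r)" using nE unfolding A_def[symmetric] by argo
    then have "cmod (of_real r * ?e - 1) \<le> 3 * (1 - r)" by (simp add: A_def)
    then have 3: "1 / 3 \<le> (1 - r) / cmod (of_real r * ?e - 1)" using pos by (simp add: field_simps)
    have "Re (of_real r * ?e) \<le> cmod (of_real r * ?e)" by (rule complex_Re_le_cmod)
    also have "\<dots> < 1" using r by (simp add: norm_mult)
    finally have "0 < Re (1 - of_real r * ?e)" by simp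
    then have "\<bar>Im (Ln (1 - of_real r * ?e))\<bar> < pi / 2" by (rule Re_Ln_pos_lt_imp)
    then have "\<bar>t - (\<phi> - pi) / 2\<bar> \<le> pi" if "t = Im (Ln (1 - of_real r * ?e))" for t
      using \<phi> unfolding that[symmetric] by argo
    from this[OF refl] have "\<bar>Im (Ln (1 - of_real r * ?e)) - (\<phi> - pi) / 2\<bar> \<le> pi" .
    also have "\<dots> \<le> 10 * (1 / 3)" using pi_approx by simp
    finally show ?thesis using 3 by linarith
  qed
qed

context circle_zeros
begin

text \<open>The error of the sawtooth formula up to a constant: distance to the circle over distance
  to the end point. It equals 1 on the radius through the end point and is never larger.\<close>

definition tilt :: "real \<Rightarrow> nat \<Rightarrow> real" where
  "tilt \<alpha> i = (1 - cmod (\<zeta> i)) / cmod (\<zeta> i - exp (\<i> * of_real \<alpha>))"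

definition log_sum :: "complex \<Rightarrow> complex" where
  "log_sum x = (\<Sum>i<N. Ln (1 - \<zeta> i / x))"

lemma one_minus_le_norm_diff: "1 - cmod (\<zeta> i) \<le> cmod (\<zeta> i - exp (\<i> * of_real \<alpha>))"
  using norm_triangle_ineq2[of "exp (\<i> * of_real \<alpha>)" "\<zeta> i"] by (simp add: norm_minus_commute)

lemma norm_diff_pos: "i < N \<Longrightarrow> 0 < cmod (\<zeta> i - exp (\<i> * of_real \<alpha>))"
  using one_minus_le_norm_diff[of i \<alpha>] zeta_lt[of i] by linarith

lemma tilt_nonneg: "i < N \<Longrightarrow> 0 \<le> tilt \<alpha> i"
  using zeta_lt[of i] by (simp add: tilt_def)

lemma tilt_le_1: "i < N \<Longrightarrow> tilt \<alpha> i \<le> 1"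
  using norm_diff_pos[of i \<alpha>] one_minus_le_norm_diff[of i \<alpha>] by (simp add: tilt_def)

lemma one_minus_le_depth: "i < N \<Longrightarrow> 1 - cmod (\<zeta> i) \<le> depth i"
  using ln_le_minus_one[of "cmod (\<zeta> i)"] zeta_nonzero by (simp add: depth_def)

text \<open>Near the end point the logarithm is Lipschitz with constant 2. Elsewhere the distance is
  at least 1/2, while the deviation is at most ell/2 + pi.\<close>

lemma norm_dev_le:
  assumes "i < N"
  shows "cmod (dev \<alpha> i) \<le> (ell + 2 * pi) * cmod (\<zeta> i - exp (\<i> * of_real \<alpha>))"
proof -
  define v where "v = \<zeta> i * exp (- \<i> * of_real \<alpha>)"
  have v0: "v \<noteq> 0" using zeta_nonzero[OF assms] by (simp add: v_def)
  have "\<zeta> i - exp (\<i> * of_real \<alpha>) = exp (\<i> * of_real \<alpha>) * (v - 1)"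
    by (simp add: v_def exp_minus field_simps)
  then have n: "cmod (\<zeta> i - exp (\<i> * of_real \<alpha>)) = cmod (v - 1)" by (simp add: norm_mult)
  have d: "dev \<alpha> i = Ln v" by (simp add: dev_def v_def)
  show ?thesis
  proof (cases "cmod (v - 1) < 1 / 2")
    case True
    then have "cmod (Ln (1 + (v - 1))) \<le> 2 * cmod (v - 1)" by (rule norm_Ln_le)
    also have "\<dots> \<le> (ell + 2 * pi) * cmod (v - 1)"
      using ell_pos pi_gt3 by (intro mult_right_mono) auto
    finally show ?thesis by (simp add: n d)
  next
    case False
    have "cmod (dev \<alpha> i) \<le> \<bar>Re (dev \<alpha> i)\<bar> + \<bar>Im (dev \<alpha> i)\<bar>" by (rule cmod_le)
    also have "\<bar>Re (dev \<alpha> i)\<bar> \<le> ell / 2" using Re_dev[OF assms] depth_pos[OF assms] depth_le[OF assms] by simp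
    also have "\<bar>Im (dev \<alpha> i)\<bar> \<le> pi" using mpi_less_Im_Ln[OF v0] Im_Ln_le_pi[OF v0] by (simp add: d)
    also have "ell / 2 + pi = (ell + 2 * pi) * (1 / 2)" by simp
    also have "\<dots> \<le> (ell + 2 * pi) * cmod (v - 1)" using False ell_pos by (intro mult_left_mono) auto
    finally show ?thesis by (simp add: n)
  qed
qed

lemma tilt_le_depth:
  assumes i: "i < N" and t: "0 < t" "t \<le> cmod (dev \<alpha> i)"
  shows "tilt \<alpha> i \<le> (ell + 2 * pi) * depth i / t"
proof -
  let ?n = "cmod (\<zeta> i - exp (\<i> * of_real \<alpha>))"
  have k: "0 < ell + 2 * pi" using ell_pos by (simp add: add_pos_pos)
  have n0: "0 < ?n" by (rule norm_diff_pos[OF i])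
  have "t \<le> (ell + 2 * pi) * ?n" using norm_dev_le[OF i, of \<alpha>] t by linarith
  then have "t * (1 - cmod (\<zeta> i)) \<le> ((ell + 2 * pi) * ?n) * depth i"
    using one_minus_le_depth[OF i] zeta_lt[OF i] t by (intro mult_mono) auto
  then show ?thesis using n0 t k by (simp add: tilt_def field_simps)
qed

text \<open>A net of M centres brings every zero within the range of \<open>green_sum\<close>: the
  depth is at most 0.5 \<open>ell\<close>, the angle from the nearest centre at most 0.3
  \<open>ell\<close>, and 0.25 + 0.09 < 0.36 = 0.6^2. There the weight at s = rad/10 is at least
  depth/(5 rad), and 20 = 5 * 4.\<close>

lemma depth_sum:
  assumes M: "2 \<le> M" "pi / real M \<le> 3 / 10 * ell" and m: "0 < m"
    and low: "\<And>k. k < M \<Longrightarrow> m \<le> cmod (G (exp (\<i> * of_real (2 * pi * real k / real M) - of_real (rad / 10))))"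
  shows "(\<Sum>i<N. depth i) \<le> 20 * real M * rad * ln (K / m)"
proof -
  define a where "a = (\<lambda>k. 2 * pi * real k / real M)"
  define s where "s = rad / 10"
  define T where "T = (\<lambda>k i. if cmod (dev (a k) i) \<le> 2 * rad / 3 then s * depth i / (s\<^sup>2 + (cmod (dev (a k) i))\<^sup>2) else 0)"
  have rad: "0 < rad" using ell_pos by (simp add: rad_def)
  have s: "0 < s" using rad by (simp add: s_def)
  have T0: "0 \<le> T k i" if "i < N" for k i
    using depth_pos[OF that] s by (auto simp: T_def intro!: divide_nonneg_nonneg)
  have "\<exists>k<M. cmod (dev (a k) i) \<le> 2 * rad / 3" if i: "i < N" for i
  proof -
    define \<theta> where "\<theta> = Arg2pi (\<zeta> i)"
    have \<theta>: "0 \<le> \<theta>" "\<theta> < 2 * pi" "\<zeta> i = of_real (cmod (\<zeta> i)) * exp (\<i> * of_real \<theta>)"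
      using Arg2pi[of "\<zeta> i"] by (auto simp: \<theta>_def is_Arg_def)
    \<comment> \<open>Rounding to the nearest net angle. The result may be M, which is the same
      point of the circle as 0; hence the index \<open>k\<close> below.\<close>
    define j where "j = nat \<lfloor>\<theta> * real M / (2 * pi) + 1 / 2\<rfloor>"
    have nn: "0 \<le> \<theta> * real M / (2 * pi)" using \<theta> by simp
    have M0: "0 < real M" using M by simp
    have jr: "real j = of_int \<lfloor>\<theta> * real M / (2 * pi) + 1 / 2\<rfloor>"
      unfolding j_def using nn by (intro of_nat_nat) linarith
    have j1: "\<bar>\<theta> * real M / (2 * pi) - real j\<bar> \<le> 1 / 2" unfolding jr by linarith
    have "\<theta> * real M / (2 * pi) < real M" using \<theta> M0 by (simp add: field_simps)
    then have jM: "j \<le> M" using j1 by linarith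
    have "\<theta> - a j = (\<theta> * real M / (2 * pi) - real j) * (2 * pi / real M)" using M0 by (simp add: a_def field_simps)
    then have "\<bar>\<theta> - a j\<bar> = \<bar>\<theta> * real M / (2 * pi) - real j\<bar> * (2 * pi / real M)" by (simp add: abs_mult)
    also have "\<dots> \<le> 1 / 2 * (2 * pi / real M)" using j1 by (intro mult_right_mono) auto
    finally have ph: "\<bar>\<theta> - a j\<bar> \<le> pi / real M" by simp
    have pM: "pi / real M \<le> pi / 2" using M by (intro divide_left_mono) auto
    define k where "k = (if j = M then 0 else j)"
    have k: "k < M" using jM M by (auto simp: k_def)
    have ek: "exp (- \<i> * of_real (a k)) = exp (- \<i> * of_real (a j))"
    proof (cases "j = M")
      case True
      have "exp (- \<i> * complex_of_real (2 * pi)) = 1"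
        by (simp add: complex_eq_iff Re_exp Im_exp)
      then show ?thesis using True M0 by (simp add: k_def a_def)
    qed (simp add: k_def)
    have "\<zeta> i * exp (- \<i> * of_real (a k)) = exp (of_real (ln (cmod (\<zeta> i))) + \<i> * of_real (\<theta> - a j))"
    proof -
      have "\<zeta> i * exp (- \<i> * of_real (a k)) = of_real (cmod (\<zeta> i)) * exp (\<i> * of_real \<theta>) * exp (- \<i> * of_real (a j))"
        using \<theta>(3) ek by simp
      moreover have "of_real (cmod (\<zeta> i)) = exp (complex_of_real (ln (cmod (\<zeta> i))))"
        using zeta_nonzero[OF i] by (simp add: exp_of_real)
      ultimately show ?thesis by (simp add: exp_add[symmetric] algebra_simps)
    qed
    moreover have "- pi < \<theta> - a j" "\<theta> - a j \<le> pi" using ph pM pi_gt_zero by linarith+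
    ultimately have "dev (a k) i = of_real (ln (cmod (\<zeta> i))) + \<i> * of_real (\<theta> - a j)"
      unfolding dev_def by (simp only:) (rule Ln_exp, auto)
    then have "(cmod (dev (a k) i))\<^sup>2 = (depth i)\<^sup>2 + (\<theta> - a j)\<^sup>2"
      by (simp add: cmod_power2 depth_def)
    also have "(depth i)\<^sup>2 \<le> (ell / 2)\<^sup>2" using depth_le[OF i] depth_pos[OF i] by (intro power_mono) auto
    also have "(\<theta> - a j)\<^sup>2 \<le> (3 / 10 * ell)\<^sup>2"
    proof -
      have "\<bar>\<theta> - a j\<bar>\<^sup>2 \<le> (3 / 10 * ell)\<^sup>2" using ph M(2) by (intro power_mono) linarith+
      then show ?thesis by simp
    qed
    also have "(ell / 2)\<^sup>2 + (3 / 10 * ell)\<^sup>2 \<le> (2 * rad / 3)\<^sup>2" by (simp add: rad_def power2_eq_square)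
    finally have "cmod (dev (a k) i) \<le> 2 * rad / 3" by (rule power2_le_imp_le) (use rad in auto)
    then show ?thesis using k by blast
  qed
  then have *: "depth i \<le> (\<Sum>k<M. 5 * rad * T k i)" if "i < N" for i
  proof -
    obtain k where k: "k < M" "cmod (dev (a k) i) \<le> 2 * rad / 3"
      using \<open>\<And>i. i < N \<Longrightarrow> \<exists>k<M. cmod (dev (a k) i) \<le> 2 * rad / 3\<close> \<open>i < N\<close> by blast
    have "(cmod (dev (a k) i))\<^sup>2 \<le> (2 * rad / 3)\<^sup>2" using k by (intro power_mono) auto
    then have "(cmod (dev (a k) i))\<^sup>2 \<le> 4 * rad\<^sup>2 / 9" by (simp add: power_divide power_mult_distrib)
    moreover have "s\<^sup>2 = rad\<^sup>2 / 100" by (simp add: s_def power_divide)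
    moreover have "0 \<le> rad\<^sup>2" by simp
    ultimately have "s\<^sup>2 + (cmod (dev (a k) i))\<^sup>2 \<le> rad\<^sup>2 / 2" by linarith
    moreover have "0 < s\<^sup>2 + (cmod (dev (a k) i))\<^sup>2" using s by (simp add: add_pos_nonneg)
    ultimately have "s * depth i / (rad\<^sup>2 / 2) \<le> s * depth i / (s\<^sup>2 + (cmod (dev (a k) i))\<^sup>2)"
      using s rad depth_pos[OF \<open>i < N\<close>] by (intro divide_left_mono mult_pos_pos) auto
    then have "5 * rad * (s * depth i / (rad\<^sup>2 / 2)) \<le> 5 * rad * T k i"
      using k rad by (intro mult_left_mono) (auto simp: T_def)
    also have "5 * rad * (s * depth i / (rad\<^sup>2 / 2)) = depth i" using rad by (simp add: s_def power2_eq_square)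
    also have "5 * rad * T k i \<le> (\<Sum>k<M. 5 * rad * T k i)"
      using k T0[OF \<open>i < N\<close>] rad by (intro member_le_sum) auto
    finally show ?thesis .
  qed
  have "(\<Sum>i<N. depth i) \<le> (\<Sum>i<N. \<Sum>k<M. 5 * rad * T k i)" by (intro sum_mono *) auto
  also have "\<dots> = (\<Sum>k<M. 5 * rad * (\<Sum>i<N. T k i))" by (subst sum.swap) (simp add: sum_distrib_left)
  also have "\<dots> \<le> (\<Sum>k<M. 5 * rad * (4 * ln (K / m)))"
  proof (intro sum_mono mult_left_mono)
    fix k assume "k \<in> {..<M}"
    then have "m \<le> cmod (G (exp (\<i> * of_real (a k) - of_real s)))" using low[of k] by (simp add: a_def s_def)
    then have "(\<Sum>i | i < N \<and> cmod (dev (a k) i) \<le> 2 * rad / 3. s * depth i / (s\<^sup>2 + (cmod (dev (a k) i))\<^sup>2)) \<le> 4 * ln (K / m)"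
      using s m by (intro green_sum) (auto simp: s_def)
    moreover have "(\<Sum>i<N. T k i) = (\<Sum>i | i < N \<and> cmod (dev (a k) i) \<le> 2 * rad / 3. s * depth i / (s\<^sup>2 + (cmod (dev (a k) i))\<^sup>2))"
      unfolding T_def by (subst sum.inter_filter[symmetric]) (auto intro!: sum.cong)
    ultimately show "(\<Sum>i<N. T k i) \<le> 4 * ln (K / m)" by simp
  qed (use rad in auto)
  finally show ?thesis by simp
qed

text \<open>Serves at the scale 1/N, below the smallest dyadic one. From |x| = 1 + 1/N to 1 + 5/N
  the product \<open>P\<close> grows at most by exp 10 * K^2, while no factor decreases and the
  factor of each near zero doubles, as 2 (1/N + 1/N) <= 5/N - 1/N.\<close>

lemma card_near:
  assumes N: "1 \<le> N"
  shows "real (card {i. i < N \<and> cmod (\<zeta> i - exp (\<i> * of_real \<alpha>)) < 1 / real N}) * ln 2 \<le> 10 + 2 * ln K"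
proof -
  let ?e = "exp (\<i> * complex_of_real \<alpha>)"
  define x where "x = (\<lambda>t. of_real (1 + t / real N) * ?e)"
  define P where "P = (\<lambda>y. \<Prod>i<N. cmod (y - \<zeta> i) * cmod (y - \<tau> / \<zeta> i))"
  define S where "S = {i. i < N \<and> cmod (\<zeta> i - ?e) < 1 / real N}"
  have N0: "0 < real N" using N by simp
  have nx: "cmod (x t) = 1 + t / real N" if "0 \<le> t" for t
    using that N0 by (simp only: x_def norm_mult norm_of_real) simp
  have xge: "1 \<le> cmod (x t)" if "0 \<le> t" for t using that N0 by (simp add: nx)
  have P: "P y = cmod y ^ (2 * N) * cmod (\<Prod>i<N. (1 - \<zeta> i / y) * (1 - \<tau> / (\<zeta> i * y)))" if "y \<noteq> 0" for y
  proof -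
    have "P y = (\<Prod>i<N. (cmod y)\<^sup>2 * cmod ((1 - \<zeta> i / y) * (1 - \<tau> / (\<zeta> i * y))))"
      unfolding P_def
    proof (intro prod.cong refl)
      fix i assume "i \<in> {..<N}"
      have "(y - \<zeta> i) * (y - \<tau> / \<zeta> i) = y\<^sup>2 * ((1 - \<zeta> i / y) * (1 - \<tau> / (\<zeta> i * y)))"
        using that zeta_nonzero[of i] \<open>i \<in> {..<N}\<close> by (simp add: field_simps power2_eq_square)
      then show "cmod (y - \<zeta> i) * cmod (y - \<tau> / \<zeta> i) = (cmod y)\<^sup>2 * cmod ((1 - \<zeta> i / y) * (1 - \<tau> / (\<zeta> i * y)))"
        by (metis norm_mult norm_power)
    qed
    then show ?thesis by (simp only: prod.distrib prod_constant prod_norm power_mult) simp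
  qed
  have x5: "P (x 5) \<le> exp 10 * K"
  proof -
    have "P (x 5) = cmod (x 5) ^ (2 * N) * cmod (\<Prod>i<N. (1 - \<zeta> i / x 5) * (1 - \<tau> / (\<zeta> i * x 5)))"
      using xge[of 5] by (intro P) auto
    also have "\<dots> \<le> exp 10 * K"
    proof (intro mult_mono)
      have "cmod (x 5) ^ (2 * N) \<le> exp (5 / real N) ^ (2 * N)"
        unfolding nx[of 5, simplified] using exp_ge_add_one_self[of "5 / real N"] N0 by (intro power_mono) auto
      also have "\<dots> = exp 10" using N0 by (simp flip: exp_of_nat_mult)
      finally show "cmod (x 5) ^ (2 * N) \<le> exp 10" .
    qed (use outside[OF xge[of 5]] in auto)
    finally show ?thesis .
  qed
  have x1: "1 / K \<le> P (x 1)"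
  proof -
    have "1 * (1 / K) \<le> cmod (x 1) ^ (2 * N) * cmod (\<Prod>i<N. (1 - \<zeta> i / x 1) * (1 - \<tau> / (\<zeta> i * x 1)))"
      using outside[OF xge[of 1]] xge[of 1] K1 by (intro mult_mono one_le_power) auto
    also have "\<dots> = P (x 1)" using xge[of 1] by (intro P[symmetric]) auto
    finally show ?thesis by simp
  qed
  have le: "(if i \<in> S then 2 else 1) * (cmod (x 1 - \<zeta> i) * cmod (x 1 - \<tau> / \<zeta> i)) \<le> cmod (x 5 - \<zeta> i) * cmod (x 5 - \<tau> / \<zeta> i)" if i: "i < N" for i
  proof -
    have "cmod \<tau> \<le> cmod (\<zeta> i) * cmod (\<zeta> i)" using zeta_ge[OF i] by (simp add: power2_eq_square)
    also have "\<dots> \<le> cmod (\<zeta> i)" using zeta_lt[OF i] by (simp add: mult_left_le)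
    finally have w: "cmod (\<tau> / \<zeta> i) \<le> 1" using zeta_nonzero[OF i] by (simp add: norm_divide)
    have A: "cmod (x 1 - \<tau> / \<zeta> i) \<le> cmod (x 5 - \<tau> / \<zeta> i)"
      unfolding x_def using N0 w by (intro norm_one_minus_ray_mono) (auto intro: divide_right_mono)
    have B: "cmod (x 1 - \<zeta> i) \<le> cmod (x 5 - \<zeta> i)"
      unfolding x_def using N0 zeta_lt[OF i] by (intro norm_one_minus_ray_mono) (auto intro: divide_right_mono)
    have C: "2 * cmod (x 1 - \<zeta> i) \<le> cmod (x 5 - \<zeta> i)" if "i \<in> S"
    proof -
      have n: "cmod (?e - \<zeta> i) < 1 / real N" using that by (simp add: S_def norm_minus_commute)
      have x: "x t = ?e + of_real (t / real N) * ?e" for t by (simp add: x_def algebra_simps)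
      have nt: "cmod (of_real (t / real N) * ?e) = t / real N" if "0 \<le> t" for t
        using that N0 by (simp only: norm_mult norm_of_real) simp
      have "cmod (x 1 - \<zeta> i) \<le> cmod (?e - \<zeta> i) + cmod (of_real (1 / real N) * ?e)"
        using norm_triangle_ineq[of "?e - \<zeta> i" "of_real (1 / real N) * ?e"] unfolding x by (simp add: algebra_simps)
      moreover have "cmod (of_real (5 / real N) * ?e) - cmod (?e - \<zeta> i) \<le> cmod (x 5 - \<zeta> i)"
        using norm_diff_ineq[of "of_real (5 / real N) * ?e" "?e - \<zeta> i"] unfolding x by (simp add: algebra_simps)
      ultimately show ?thesis using n nt[of 1] nt[of 5] by (simp add: field_simps)
    qed
    show ?thesis using mult_mono[OF B A] mult_mono[OF C A] by auto
  qed
  have p2: "(2::real) ^ card S = (\<Prod>i<N. if i \<in> S then 2 else 1)"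
  proof -
    have "(\<Prod>i<N. if i \<in> S then 2 else (1::real)) = (\<Prod>i\<in>{..<N} \<inter> S. 2)" by (subst prod.inter_restrict) auto
    also have "{..<N} \<inter> S = S" by (auto simp: S_def)
    finally show ?thesis by simp
  qed
  have "2 ^ card S * (1 / K) \<le> (\<Prod>i<N. if i \<in> S then 2 else 1) * P (x 1)"
    unfolding p2[symmetric] using x1 by (intro mult_left_mono) auto
  also have "\<dots> \<le> P (x 5)"
    unfolding P_def prod.distrib[symmetric] by (intro prod_mono conjI le mult_nonneg_nonneg) auto
  also note x5
  finally have "2 ^ card S \<le> exp 10 * K\<^sup>2" using K1 by (simp add: field_simps power2_eq_square)
  then have "ln (2 ^ card S) \<le> ln (exp 10 * K\<^sup>2)" using K1 by (intro ln_mono) auto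
  also have "\<dots> = 10 + 2 * ln K" using K1 by (simp add: ln_mult ln_realpow)
  finally show ?thesis by (simp add: ln_realpow S_def)
qed

text \<open>A zero with |dev| = t is charged to a dyadic scale s with s <= t <= 7 s, where its
  weight in \<open>green_sum\<close> is at least depth/(14 t), and depth/t controls the tilt. Zeros
  beyond 2 rad/3 are charged to the sum of the depths, those below the last scale to
  \<open>card_near\<close>.\<close>

lemma tilt_sum:
  assumes N: "1 \<le> N" and m: "0 < m"
    and n: "rad / 10 / 2 ^ n \<le> 1 / (2 * real N)"
    and low: "\<And>k. k \<le> n \<Longrightarrow> m \<le> cmod (G (exp (\<i> * of_real \<alpha> - of_real (rad / 10 / 2 ^ k))))"
  shows "(\<Sum>i<N. tilt \<alpha> i) \<le> (ell + 2 * pi) * (3 / (2 * rad)) * (\<Sum>i<N. depth i)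
    + 56 * (ell + 2 * pi) * real (Suc n) * ln (K / m) + (10 + 2 * ln K) / ln 2"
proof -
  define s where "s = (\<lambda>k::nat. rad / 10 / 2 ^ k)"
  define T where "T = (\<lambda>k i. if cmod (dev \<alpha> i) \<le> 2 * rad / 3 then s k * depth i / ((s k)\<^sup>2 + (cmod (dev \<alpha> i))\<^sup>2) else 0)"
  define \<kappa> where "\<kappa> = ell + 2 * pi"
  define near where "near = {i. i < N \<and> cmod (\<zeta> i - exp (\<i> * of_real \<alpha>)) < 1 / real N}"
  have N0: "0 < real N" using N by simp
  have rad: "0 < rad" using ell_pos by (simp add: rad_def)
  have s: "0 < s k" for k using rad by (simp add: s_def)
  have kap: "0 < \<kappa>" using ell_pos by (simp add: \<kappa>_def add_pos_pos)
  have T0: "0 \<le> T k i" if "i < N" for k i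
    using depth_pos[OF that] s[of k] by (auto simp: T_def intro!: divide_nonneg_nonneg)
  have pt: "tilt \<alpha> i \<le> \<kappa> * (3 / (2 * rad)) * depth i + (\<Sum>k\<le>n. 14 * \<kappa> * T k i) + (if i \<in> near then 1 else 0)" if i: "i < N" for i
  proof -
    define t where "t = cmod (dev \<alpha> i)"
    have nn: "0 \<le> \<kappa> * (3 / (2 * rad)) * depth i" "0 \<le> (\<Sum>k\<le>n. 14 * \<kappa> * T k i)"
      using rad kap depth_pos[OF i] T0[OF i] by (auto intro!: sum_nonneg)
    consider "t > 2 * rad / 3" | "t \<le> 2 * rad / 3" "s n \<le> t" | "t < s n" by linarith
    then show ?thesis
    proof cases
      case 1
      then have "tilt \<alpha> i \<le> \<kappa> * depth i / (2 * rad / 3)"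
        unfolding \<kappa>_def using rad by (intro tilt_le_depth i) (auto simp: t_def)
      also have "\<dots> = \<kappa> * (3 / (2 * rad)) * depth i" by simp
      finally show ?thesis using nn by simp
    next
      case 2
      have "\<exists>k\<le>n. s k \<le> t \<and> t \<le> 7 * s k"
      proof -
        define k where "k = (LEAST k. s k \<le> t)"
        have k: "s k \<le> t" unfolding k_def using 2 by (intro LeastI)
        have kn: "k \<le> n" unfolding k_def using 2 by (intro Least_le)
        \<comment> \<open>At the first scale 2 rad/3 = (20/3) s; at a later one the preceding scale
          2 s already exceeds t.\<close>
        have "t \<le> 7 * s k"
        proof (cases k)
          case 0
          then show ?thesis using 2 rad by (simp add: s_def)
        next
          case (Suc j)
          then have "\<not> s j \<le> t" using not_less_Least[of j "\<lambda>k. s k \<le> t"] by (simp add: k_def)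
          moreover have "s j = 2 * s k" by (simp add: s_def Suc)
          ultimately show ?thesis using s[of k] by linarith
        qed
        then show ?thesis using k kn by blast
      qed
      then obtain k where k: "k \<le> n" "s k \<le> t" "t \<le> 7 * s k" by blast
      have t0: "0 < t" using k s[of k] by linarith
      have d: "0 < depth i" by (rule depth_pos[OF i])
      have "depth i / t \<le> 14 * (s k * depth i / ((s k)\<^sup>2 + t\<^sup>2))"
      proof -
        have "(s k)\<^sup>2 \<le> t\<^sup>2" using k s[of k] by (intro power_mono) auto
        then have "(s k)\<^sup>2 + t\<^sup>2 \<le> 2 * t\<^sup>2" by simp
        also have "\<dots> \<le> 14 * s k * t" using k t0 by (simp add: power2_eq_square)
        finally have "depth i * ((s k)\<^sup>2 + t\<^sup>2) \<le> depth i * (14 * s k * t)" using d by (intro mult_left_mono) auto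
        moreover have "0 < (s k)\<^sup>2 + t\<^sup>2" using t0 by (simp add: add_nonneg_pos)
        ultimately show ?thesis using t0 by (simp add: divide_le_eq pos_le_divide_eq mult_ac)
      qed
      then have "\<kappa> * (depth i / t) \<le> \<kappa> * (14 * T k i)"
        using 2 kap by (intro mult_left_mono) (auto simp: T_def t_def)
      moreover have "tilt \<alpha> i \<le> \<kappa> * depth i / t"
        unfolding \<kappa>_def using t0 by (intro tilt_le_depth i) (auto simp: t_def)
      moreover have "14 * \<kappa> * T k i \<le> (\<Sum>k\<le>n. 14 * \<kappa> * T k i)"
        using k T0[OF i] kap by (intro member_le_sum) auto
      ultimately show ?thesis using nn by (simp add: mult_ac)
    next
      case 3
      \<comment> \<open>Passing from ln x back to x costs at most a factor exp t <= 2, which is why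
        the last scale is 1/(2 N) and not 1/N.\<close>
      then have "t < 1 / (2 * real N)" using n by (simp add: s_def)
      moreover have "1 / (2 * real N) \<le> 1 / 2" using N by (simp add: field_simps)
      ultimately have t1: "t < 1 / 2" "2 * t < 1 / real N" by auto
      have "\<zeta> i - exp (\<i> * of_real \<alpha>) = exp (\<i> * of_real \<alpha>) * (exp (dev \<alpha> i) - 1)"
        using exp_dev[OF i, of \<alpha>] by (simp add: exp_minus field_simps)
      then have "cmod (\<zeta> i - exp (\<i> * of_real \<alpha>)) = cmod (exp (dev \<alpha> i) - 1)" by (simp add: norm_mult)
      also have "\<dots> \<le> 2 * t"
      proof -
        have "cmod (exp (dev \<alpha> i) - 1) \<le> exp t * t"
        proof -
          have "cmod (exp (dev \<alpha> i) - exp 0) \<le> exp t * cmod (dev \<alpha> i - 0)"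
          proof (rule field_differentiable_bound[where S = "cball 0 t" and f' = exp])
            fix z :: complex assume "z \<in> cball 0 t"
            then have "cmod z \<le> t" by simp
            moreover have "cmod (exp z) \<le> exp (cmod z)" by (rule norm_exp)
            ultimately show "cmod (exp z) \<le> exp t" using order.trans exp_le_cancel_iff by blast
            show "(exp has_field_derivative exp z) (at z within cball 0 t)" by (auto intro!: derivative_eq_intros)
          qed (auto simp: t_def)
          then show ?thesis by (simp add: t_def)
        qed
        also have "exp t \<le> 2"
        proof -
          have "exp t \<le> 1 + t + t\<^sup>2" using t1 by (intro exp_bound) (auto simp: t_def)
          also have "t\<^sup>2 \<le> (1 / 2)\<^sup>2" using t1 by (intro power_mono) (auto simp: t_def)
          finally show ?thesis using t1 by (simp add: power2_eq_square)
        qed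
        finally show ?thesis by (simp add: t_def mult_right_mono)
      qed
      finally have "i \<in> near" using i t1 by (simp add: near_def)
      then show ?thesis using nn tilt_le_1[OF i, of \<alpha>] by simp
    qed
  qed
  have "(\<Sum>i<N. tilt \<alpha> i) \<le> (\<Sum>i<N. \<kappa> * (3 / (2 * rad)) * depth i + (\<Sum>k\<le>n. 14 * \<kappa> * T k i) + (if i \<in> near then 1 else 0))"
    by (intro sum_mono pt) auto
  also have "\<dots> = \<kappa> * (3 / (2 * rad)) * (\<Sum>i<N. depth i) + (\<Sum>k\<le>n. 14 * \<kappa> * (\<Sum>i<N. T k i)) + real (card near)"
  proof -
    have "(\<Sum>i<N. \<Sum>k\<le>n. 14 * \<kappa> * T k i) = (\<Sum>k\<le>n. 14 * \<kappa> * (\<Sum>i<N. T k i))"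
      by (subst sum.swap) (simp add: sum_distrib_left)
    moreover have "(\<Sum>i<N. if i \<in> near then 1 else 0) = real (card near)"
    proof -
      have "(\<Sum>i<N. if i \<in> near then 1 else (0::real)) = (\<Sum>i\<in>{..<N} \<inter> near. 1)" by (subst sum.inter_restrict) auto
      also have "{..<N} \<inter> near = near" by (auto simp: near_def)
      finally show ?thesis by simp
    qed
    ultimately show ?thesis by (simp only: sum.distrib sum_distrib_left[symmetric])
  qed
  also have "(\<Sum>k\<le>n. 14 * \<kappa> * (\<Sum>i<N. T k i)) \<le> (\<Sum>k\<le>n. 14 * \<kappa> * (4 * ln (K / m)))"
  proof (intro sum_mono mult_left_mono)
    fix k assume "k \<in> {..n}"
    then have "m \<le> cmod (G (exp (\<i> * of_real \<alpha> - of_real (s k))))" using low[of k] by (simp add: s_def)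
    moreover have "s k \<le> rad / 10" using rad one_le_power[of "2::real" k] by (simp add: s_def field_simps)
    ultimately have "(\<Sum>i | i < N \<and> cmod (dev \<alpha> i) \<le> 2 * rad / 3. s k * depth i / ((s k)\<^sup>2 + (cmod (dev \<alpha> i))\<^sup>2)) \<le> 4 * ln (K / m)"
      using s m by (intro green_sum) auto
    moreover have "(\<Sum>i<N. T k i) = (\<Sum>i | i < N \<and> cmod (dev \<alpha> i) \<le> 2 * rad / 3. s k * depth i / ((s k)\<^sup>2 + (cmod (dev \<alpha> i))\<^sup>2))"
      unfolding T_def by (subst sum.inter_filter[symmetric]) (auto intro!: sum.cong)
    ultimately show "(\<Sum>i<N. T k i) \<le> 4 * ln (K / m)" by simp
  qed (use kap in auto)
  also have "(\<Sum>k\<le>n. 14 * \<kappa> * (4 * ln (K / m))) = 56 * \<kappa> * real (Suc n) * ln (K / m)" by simp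
  also have "real (card near) \<le> (10 + 2 * ln K) / ln 2"
    using card_near[OF N, of \<alpha>] by (simp add: near_def pos_le_divide_eq)
  finally show ?thesis by (simp add: \<kappa>_def)
qed

section \<open>The sum of the logarithms on the circle\<close>

lemma norm_tau_div_zeta_le: assumes "i < N" shows "cmod (\<tau> / \<zeta> i) \<le> sqrt (cmod \<tau>)"
proof -
  have "sqrt (cmod \<tau>) \<le> cmod (\<zeta> i)" using zeta_ge[OF assms] by (rule real_le_lsqrt[rotated -1]) auto
  then have "sqrt (cmod \<tau>) * sqrt (cmod \<tau>) \<le> sqrt (cmod \<tau>) * cmod (\<zeta> i)" by (intro mult_left_mono) auto
  then show ?thesis using zeta_nonzero[OF assms] by (simp add: norm_divide divide_le_eq)
qed

lemma sqrt_tau_lt: "sqrt (cmod \<tau>) < 1" using tau1 by simp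

text \<open>A sum of principal logarithms is a logarithm of the product, but perhaps not the
  principal one. When the point comes in from infinity along its ray (t from 0 to 1), the sum starts
  at 0 and is continuous, and the product never meets the negative half-axis, so the imaginary part
  cannot reach pi or - pi.\<close>

lemma norm_log_sum_h_le:
  assumes x: "1 \<le> cmod x"
  shows "cmod (\<Sum>i<N. Ln (1 - \<zeta> i / x) + Ln (1 - \<tau> / (\<zeta> i * x))) \<le> ln K + pi"
proof -
  define h where "h = (\<lambda>t::real. \<Sum>i<N. Ln (1 - of_real t * (\<zeta> i / x)) + Ln (1 - of_real t * (\<tau> / (\<zeta> i * x))))"
  have x0: "x \<noteq> 0" using x by auto
  have small: "cmod (\<zeta> i / x) < 1" "cmod (\<tau> / (\<zeta> i * x)) < 1" if i: "i < N" for i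
  proof -
    have "cmod (\<zeta> i) / cmod x \<le> cmod (\<zeta> i)" using x by (simp add: divide_le_eq mult_left_le mult_left_mono[of 1 "cmod x" "cmod (\<zeta> i)", simplified])
    then show "cmod (\<zeta> i / x) < 1" using zeta_lt[OF i] by (simp add: norm_divide)
    have "cmod (\<tau> / \<zeta> i) / cmod x \<le> cmod (\<tau> / \<zeta> i)"
      using x mult_left_mono[of 1 "cmod x" "cmod (\<tau> / \<zeta> i)"] x0 by (simp add: divide_le_eq)
    moreover have "\<tau> / (\<zeta> i * x) = \<tau> / \<zeta> i / x" by simp
    ultimately show "cmod (\<tau> / (\<zeta> i * x)) < 1"
      using norm_tau_div_zeta_le[OF i] sqrt_tau_lt by (simp only: norm_divide)
  qed
  have slit: "1 - of_real t * u \<notin> \<real>\<^sub>\<le>\<^sub>0" if "0 \<le> t" "t \<le> 1" "cmod u < 1" for t u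
  proof -
    have "Re (of_real t * u) \<le> cmod (of_real t * u)" by (rule complex_Re_le_cmod)
    also have "\<dots> \<le> 1 * cmod u" unfolding norm_mult using that by (intro mult_right_mono) auto
    finally have "0 < Re (1 - of_real t * u)" using that by simp
    then show ?thesis by (auto simp: complex_nonpos_Reals_iff)
  qed
  have "continuous_on {0..1} (\<lambda>t. Ln (1 - of_real t * u))" if "cmod u < 1" for u
    using slit that by (intro continuous_on_Ln continuous_intros) auto
  from this[OF small(1)] this[OF small(2)] have cont: "continuous_on {0..1} h"
    unfolding h_def by (intro continuous_on_sum continuous_on_add) (simp_all only: lessThan_iff)
  have exph: "exp (h t) = (\<Prod>i<N. (1 - \<zeta> i / (x / of_real t)) * (1 - \<tau> / (\<zeta> i * (x / of_real t))))" if "0 < t" "t \<le> 1" for t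
  proof -
    have "exp (h t) = (\<Prod>i<N. exp (Ln (1 - of_real t * (\<zeta> i / x)) + Ln (1 - of_real t * (\<tau> / (\<zeta> i * x)))))"
      unfolding h_def by (rule exp_sum) auto
    also have "\<dots> = (\<Prod>i<N. (1 - of_real t * (\<zeta> i / x)) * (1 - of_real t * (\<tau> / (\<zeta> i * x))))"
    proof (intro prod.cong refl)
      fix i assume "i \<in> {..<N}"
      then have "1 - of_real t * (\<zeta> i / x) \<noteq> 0" "1 - of_real t * (\<tau> / (\<zeta> i * x)) \<noteq> 0"
        using slit[of t "\<zeta> i / x"] slit[of t "\<tau> / (\<zeta> i * x)"] small[of i] that by force+
      then show "exp (Ln (1 - of_real t * (\<zeta> i / x)) + Ln (1 - of_real t * (\<tau> / (\<zeta> i * x))))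
        = (1 - of_real t * (\<zeta> i / x)) * (1 - of_real t * (\<tau> / (\<zeta> i * x)))" by (simp add: exp_add)
    qed
    finally show ?thesis by (simp add: mult_ac)
  qed
  have nonneg: "exp (h t) \<notin> \<real>\<^sub>\<le>\<^sub>0" if t: "0 \<le> t" "t \<le> 1" for t
  proof (cases "t = 0")
    case True
    then show ?thesis by (simp add: h_def)
  next
    case False
    then have "1 \<le> cmod (x / of_real t)" using x t by (simp add: norm_divide pos_le_divide_eq)
    then show ?thesis using outside[of "x / of_real t"] exph[of t] False t by auto
  qed
  have "\<bar>Im (h 1)\<bar> < pi"
  proof (rule ccontr)
    assume "\<not> ?thesis"
    then have ge: "pi \<le> \<bar>Im (h 1)\<bar>" by simp
    have "\<exists>t. 0 \<le> t \<and> t \<le> 1 \<and> \<bar>Im (h t)\<bar> = pi"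
    proof -
      have "continuous_on {0..1} (\<lambda>t. \<bar>Im (h t)\<bar>)" by (intro continuous_intros cont)
      moreover have "\<bar>Im (h 0)\<bar> \<le> pi" by (simp add: h_def)
      ultimately show ?thesis using IVT'[of "\<lambda>t. \<bar>Im (h t)\<bar>" 0 pi 1] ge by auto
    qed
    then obtain t where t: "0 \<le> t" "t \<le> 1" "\<bar>Im (h t)\<bar> = pi" by blast
    then have "Im (h t) = pi \<or> Im (h t) = - pi" by linarith
    then have "exp (h t) = - of_real (exp (Re (h t)))" by (auto simp: complex_eq_iff Re_exp Im_exp)
    then show False using nonneg[OF t(1,2)] by (simp add: complex_nonpos_Reals_iff)
  qed
  moreover have "\<bar>Re (h 1)\<bar> \<le> ln K"
  proof -
    have "cmod (exp (h 1)) \<in> {1 / K..K}" using outside[OF x] exph[of 1] by simp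
    then have e: "1 / K \<le> exp (Re (h 1))" "exp (Re (h 1)) \<le> K" by auto
    have "ln (exp (Re (h 1))) \<le> ln K" "ln (1 / K) \<le> ln (exp (Re (h 1)))"
      using e K1 by (auto intro!: ln_mono simp del: ln_exp)
    then show ?thesis using K1 by (simp add: ln_div)
  qed
  moreover have "cmod (h 1) \<le> \<bar>Re (h 1)\<bar> + \<bar>Im (h 1)\<bar>" by (rule cmod_le)
  ultimately have "cmod (h 1) \<le> ln K + pi" by linarith
  then show ?thesis by (simp add: h_def)
qed

text \<open>The reflected roots \<open>\<tau> / \<zeta> i\<close> are replaced by \<open>\<tau> * cnj (\<zeta> i)\<close>, at the cost of the sum of the depths. This turns their
  contribution into the conjugate of \<open>log_sum\<close> at a point farther out.\<close>

lemma norm_log_sum_reflect: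
  assumes x: "1 \<le> cmod x"
  shows "cmod (log_sum x) \<le> (ln K + pi + 2 * (\<Sum>i<N. depth i) / (1 - sqrt (cmod \<tau>))) + cmod (log_sum (cnj x / cnj \<tau>))"
proof -
  define \<rho> where "\<rho> = sqrt (cmod \<tau>)"
  have x0: "x \<noteq> 0" using x by auto
  have r: "\<rho> < 1" "0 \<le> \<rho>" "\<rho> * \<rho> = cmod \<tau>" using sqrt_tau_lt by (auto simp: \<rho>_def)
  have tr: "cmod \<tau> \<le> \<rho>" using r mult_left_le[of \<rho> \<rho>] by simp
  let ?A = "\<Sum>i<N. Ln (1 - \<zeta> i / x) + Ln (1 - \<tau> / (\<zeta> i * x))"
  let ?B = "\<Sum>i<N. Ln (1 - \<tau> / (\<zeta> i * x)) - Ln (1 - \<tau> * cnj (\<zeta> i) / x)"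
  let ?C = "\<Sum>i<N. Ln (1 - \<tau> * cnj (\<zeta> i) / x)"
  have u: "cmod (\<tau> / (\<zeta> i * x)) \<le> \<rho>" if "i < N" for i
  proof -
    have "cmod (\<tau> / (\<zeta> i * x)) = cmod (\<tau> / \<zeta> i) / cmod x" by (simp add: norm_divide norm_mult)
    also have "\<dots> \<le> cmod (\<tau> / \<zeta> i)"
      using x mult_left_mono[of 1 "cmod x" "cmod (\<tau> / \<zeta> i)"] x0 by (simp add: divide_le_eq)
    finally show ?thesis using norm_tau_div_zeta_le[OF that] by (simp add: \<rho>_def)
  qed
  have v: "cmod (\<tau> * cnj (\<zeta> i) / x) \<le> \<rho>" if "i < N" for i
  proof -
    have "cmod (\<tau> * cnj (\<zeta> i) / x) = cmod \<tau> * (cmod (\<zeta> i) / cmod x)" by (simp add: norm_divide norm_mult)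
    also have "\<dots> \<le> cmod \<tau> * 1" using x zeta_lt[OF that] x0 by (intro mult_left_mono) (auto simp: divide_le_eq)
    finally show ?thesis using tr by simp
  qed
  have "cmod ?B \<le> (\<Sum>i<N. 2 * depth i / (1 - \<rho>))"
  proof (rule sum_norm_le)
    fix i assume "i \<in> {..<N}"
    then have i: "i < N" by simp
    \<comment> \<open>1/zeta and cnj zeta differ by the factor |zeta|^2, so the replacement costs at
      most twice the depth.\<close>
    have "\<tau> / (\<zeta> i * x) - \<tau> * cnj (\<zeta> i) / x = (\<tau> / (\<zeta> i * x)) * (1 - \<zeta> i * cnj (\<zeta> i))"
      using x0 zeta_nonzero[OF i] by (simp add: field_simps)
    also have "1 - \<zeta> i * cnj (\<zeta> i) = of_real (1 - (cmod (\<zeta> i))\<^sup>2)" by (simp add: complex_norm_square[symmetric])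
    finally have "cmod (\<tau> / (\<zeta> i * x) - \<tau> * cnj (\<zeta> i) / x) = cmod (\<tau> / (\<zeta> i * x)) * \<bar>1 - (cmod (\<zeta> i))\<^sup>2\<bar>"
      by (simp only: norm_mult norm_of_real)
    also have "\<dots> \<le> 1 * (2 * depth i)"
    proof (intro mult_mono)
      have "(cmod (\<zeta> i))\<^sup>2 \<le> 1" using zeta_lt[OF i] by (simp add: power_le_one)
      moreover have "1 - (cmod (\<zeta> i))\<^sup>2 = (1 + cmod (\<zeta> i)) * (1 - cmod (\<zeta> i))" by (simp add: power2_eq_square algebra_simps)
      moreover have "(1 + cmod (\<zeta> i)) * (1 - cmod (\<zeta> i)) \<le> 2 * depth i"
        using zeta_lt[OF i] one_minus_le_depth[OF i] depth_pos[OF i] by (intro mult_mono) auto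
      ultimately show "\<bar>1 - (cmod (\<zeta> i))\<^sup>2\<bar> \<le> 2 * depth i" by simp
      show "cmod (\<tau> / (\<zeta> i * x)) \<le> 1" using u[OF i] r by linarith
    qed auto
    finally have d: "cmod (\<tau> / (\<zeta> i * x) - \<tau> * cnj (\<zeta> i) / x) \<le> 2 * depth i" by simp
    have "cmod (Ln (1 - \<tau> / (\<zeta> i * x)) - Ln (1 - \<tau> * cnj (\<zeta> i) / x)) \<le> cmod (\<tau> / (\<zeta> i * x) - \<tau> * cnj (\<zeta> i) / x) / (1 - \<rho>)"
      by (rule Ln_one_minus_lipschitz[OF u[OF i] v[OF i] r(1)])
    also have "\<dots> \<le> 2 * depth i / (1 - \<rho>)" using d r by (intro divide_right_mono) auto
    finally show "cmod (Ln (1 - \<tau> / (\<zeta> i * x)) - Ln (1 - \<tau> * cnj (\<zeta> i) / x)) \<le> 2 * depth i / (1 - \<rho>)" .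
  qed
  also have "\<dots> = 2 * (\<Sum>i<N. depth i) / (1 - \<rho>)" by (simp add: sum_distrib_left sum_divide_distrib)
  finally have B: "cmod ?B \<le> 2 * (\<Sum>i<N. depth i) / (1 - \<rho>)" .
  have C: "?C = cnj (log_sum (cnj x / cnj \<tau>))"
    unfolding log_sum_def cnj_sum
  proof (intro sum.cong refl)
    fix i assume "i \<in> {..<N}"
    then have i: "i < N" by simp
    have "Re (\<tau> * cnj (\<zeta> i) / x) \<le> cmod (\<tau> * cnj (\<zeta> i) / x)" by (rule complex_Re_le_cmod)
    then have "0 < Re (1 - \<tau> * cnj (\<zeta> i) / x)" using v[OF i] r by simp
    moreover have cn: "cnj (1 - \<zeta> i / (cnj x / cnj \<tau>)) = 1 - \<tau> * cnj (\<zeta> i) / x" by (simp add: mult.commute)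
    then have "Re (1 - \<zeta> i / (cnj x / cnj \<tau>)) = Re (1 - \<tau> * cnj (\<zeta> i) / x)" by (metis complex_cnj(1) complex.sel(1) complex_surj cnj.simps(1))
    ultimately have "1 - \<zeta> i / (cnj x / cnj \<tau>) \<notin> \<real>\<^sub>\<le>\<^sub>0" by (simp add: complex_nonpos_Reals_iff)
    then show "Ln (1 - \<tau> * cnj (\<zeta> i) / x) = cnj (Ln (1 - \<zeta> i / (cnj x / cnj \<tau>)))"
      using cnj_Ln unfolding cn[symmetric] by metis
  qed
  have "log_sum x = ?A - ?B - ?C" by (simp add: log_sum_def sum.distrib sum_subtractf)
  then have "cmod (log_sum x) = cmod (?A - ?B - ?C)" by simp
  then have "cmod (log_sum x) \<le> cmod ?A + cmod ?B + cmod ?C"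
    using norm_triangle_ineq4[of "?A - ?B" ?C] norm_triangle_ineq4[of ?A ?B] by linarith
  also have "cmod ?C = cmod (log_sum (cnj x / cnj \<tau>))" unfolding C by simp
  finally show ?thesis using norm_log_sum_h_le[OF x] B by (simp add: \<rho>_def)
qed

text \<open>Each reflection moves the point out by the factor 1/|tau| and adds a cost independent of
  the point, so the total is governed by the number of steps.\<close>

lemma norm_log_sum_iterate:
  assumes x: "1 \<le> cmod x"
  shows "\<exists>y. cmod y = cmod x / cmod \<tau> ^ k \<and>
    cmod (log_sum x) \<le> real k * (ln K + pi + 2 * (\<Sum>i<N. depth i) / (1 - sqrt (cmod \<tau>))) + cmod (log_sum y)"
proof (induction k)
  case 0
  show ?case by (intro exI[of _ x]) simp
next
  case (Suc k)
  then obtain y where y: "cmod y = cmod x / cmod \<tau> ^ k"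
    "cmod (log_sum x) \<le> real k * (ln K + pi + 2 * (\<Sum>i<N. depth i) / (1 - sqrt (cmod \<tau>))) + cmod (log_sum y)" by blast
  have "cmod \<tau> ^ k \<le> 1" using tau1 by (intro power_le_one) auto
  moreover have "0 < cmod \<tau> ^ k" using tau0 by simp
  ultimately have y1: "1 \<le> cmod y" using x y(1) by (simp add: pos_le_divide_eq)
  show ?case
  proof (intro exI[of _ "cnj y / cnj \<tau>"] conjI)
    show "cmod (cnj y / cnj \<tau>) = cmod x / cmod \<tau> ^ Suc k" using y(1) by (simp add: norm_divide)
    define c where "c = ln K + pi + 2 * (\<Sum>i<N. depth i) / (1 - sqrt (cmod \<tau>))"
    have "cmod (log_sum y) \<le> c + cmod (log_sum (cnj y / cnj \<tau>))"
      unfolding c_def by (rule norm_log_sum_reflect[OF y1])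
    then have "cmod (log_sum x) \<le> real (Suc k) * c + cmod (log_sum (cnj y / cnj \<tau>))"
      using y(2) unfolding c_def[symmetric] by (simp add: algebra_simps)
    then show "cmod (log_sum x) \<le> real (Suc k) * (ln K + pi + 2 * (\<Sum>i<N. depth i) / (1 - sqrt (cmod \<tau>))) + cmod (log_sum (cnj y / cnj \<tau>))"
      unfolding c_def .
  qed
qed

text \<open>The hypothesis on \<open>k\<close> says that k reflections reach modulus 2 N; there each
  of the N logarithms is at most 1/N, whence the final 1.\<close>

lemma norm_log_sum_le:
  assumes x: "1 \<le> cmod x" and N: "1 \<le> N" and k: "2 * real N * cmod \<tau> ^ k \<le> 1"
  shows "cmod (log_sum x) \<le> real k * (ln K + pi + 2 * (\<Sum>i<N. depth i) / (1 - sqrt (cmod \<tau>))) + 1"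
proof -
  obtain y where y: "cmod y = cmod x / cmod \<tau> ^ k"
    "cmod (log_sum x) \<le> real k * (ln K + pi + 2 * (\<Sum>i<N. depth i) / (1 - sqrt (cmod \<tau>))) + cmod (log_sum y)"
    using norm_log_sum_iterate[OF x] by blast
  have t0: "0 < cmod \<tau> ^ k" using tau0 by simp
  have "2 * real N \<le> 1 / cmod \<tau> ^ k" using k t0 by (simp add: pos_le_divide_eq)
  also have "\<dots> \<le> cmod y" unfolding y(1) using x t0 by (intro divide_right_mono) auto
  finally have yN: "2 * real N \<le> cmod y" .
  then have y0: "0 < cmod y" using N by linarith
  have "cmod (log_sum y) \<le> (\<Sum>i<N. 1 / real N)"
    unfolding log_sum_def
  proof (rule sum_norm_le)
    fix i assume "i \<in> {..<N}"
    then have i: "i < N" by simp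
    have "cmod (\<zeta> i) / cmod y \<le> 1 / (2 * real N)" using zeta_lt[OF i] yN N by (intro frac_le) auto
    then have s: "cmod (- (\<zeta> i / y)) \<le> 1 / (2 * real N)" by (simp add: norm_divide)
    have z: "cmod (\<zeta> i) / cmod y < 1 / 2"
    proof -
      have "cmod (\<zeta> i) < 1" "2 \<le> cmod y" using zeta_lt[OF i] yN N by auto
      then show ?thesis using y0 by (simp add: divide_less_eq)
    qed
    have "cmod (Ln (1 + - (\<zeta> i / y))) \<le> 2 * cmod (- (\<zeta> i / y))"
      using z by (intro norm_Ln_le) (simp add: norm_divide)
    also have "\<dots> \<le> 1 / real N" using s N by (simp add: field_simps)
    finally show "cmod (Ln (1 - \<zeta> i / y)) \<le> 1 / real N" by simp
  qed
  also have "\<dots> = 1" using N by simp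
  finally show ?thesis using y(2) by simp
qed

text \<open>The sawtooth functions based at alpha and at beta have the same slope. For theta in
  [alpha, alpha + 2 pi) their difference is (beta - alpha)/2, less pi exactly when theta < beta, so
  summing arguments counts the zeros in the sector. The whole circle is included.\<close>

lemma sector_count:
  assumes ab: "\<alpha> < \<beta>" "\<beta> \<le> \<alpha> + 2 * pi"
    and \<theta>: "\<And>i. i < N \<Longrightarrow> \<alpha> \<le> \<theta> i \<and> \<theta> i < \<alpha> + 2 * pi"
    and arg: "\<And>i. i < N \<Longrightarrow> \<zeta> i = of_real (cmod (\<zeta> i)) * exp (\<i> * of_real (\<theta> i))"
  shows "\<bar>pi * real (card {i. i < N \<and> \<theta> i < \<beta>}) - real N * (\<beta> - \<alpha>) / 2\<bar>
    \<le> cmod (log_sum (exp (\<i> * of_real \<alpha>))) + cmod (log_sum (exp (\<i> * of_real \<beta>)))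
      + 10 * ((\<Sum>i<N. tilt \<alpha> i) + (\<Sum>i<N. tilt \<beta> i))"
proof -
  define B where "B = (\<lambda>\<alpha> i. Im (Ln (1 - \<zeta> i / exp (\<i> * of_real \<alpha>))))"
  have approx: "\<bar>B a i - (\<phi> - pi) / 2\<bar> \<le> 10 * tilt a i"
    if i: "i < N" and \<phi>: "0 \<le> \<phi>" "\<phi> < 2 * pi" and e: "exp (\<i> * of_real (\<theta> i)) = exp (\<i> * of_real (a + \<phi>))" for a \<phi> i
  proof -
    have 1: "\<zeta> i = of_real (cmod (\<zeta> i)) * exp (\<i> * of_real \<phi>) * exp (\<i> * of_real a)"
      using arg[OF i] by (simp add: e exp_add[symmetric] algebra_simps)
    then have 2: "\<zeta> i / exp (\<i> * of_real a) = of_real (cmod (\<zeta> i)) * exp (\<i> * of_real \<phi>)" by (simp add: field_simps)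
    have "\<zeta> i - exp (\<i> * of_real a) = exp (\<i> * of_real a) * (of_real (cmod (\<zeta> i)) * exp (\<i> * of_real \<phi>) - 1)"
      unfolding 2[symmetric] by (simp add: field_simps)
    then have "cmod (\<zeta> i - exp (\<i> * of_real a)) = cmod (of_real (cmod (\<zeta> i)) * exp (\<i> * of_real \<phi>) - 1)"
      by (simp add: norm_mult)
    then show ?thesis
      using Im_Ln_one_minus_approx[of "cmod (\<zeta> i)" \<phi>] zeta_lt[OF i] zeta_nonzero[OF i] \<phi>
      by (simp add: B_def 2 tilt_def)
  qed
  have pt: "\<bar>B \<alpha> i - B \<beta> i - ((\<beta> - \<alpha>) / 2 - (if \<theta> i < \<beta> then pi else 0))\<bar> \<le> 10 * (tilt \<alpha> i + tilt \<beta> i)" if i: "i < N" for i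
  proof -
    have A: "\<bar>B \<alpha> i - (\<theta> i - \<alpha> - pi) / 2\<bar> \<le> 10 * tilt \<alpha> i"
      using \<theta>[OF i] by (intro approx i) auto
    show ?thesis
    proof (cases "\<theta> i < \<beta>")
      case True
      have e: "exp (\<i> * of_real (\<theta> i)) = exp (\<i> * of_real (\<beta> + (\<theta> i - \<beta> + 2 * pi)))"
        by (simp add: complex_eq_iff Re_exp Im_exp)
      have "\<bar>B \<beta> i - (\<theta> i - \<beta> + 2 * pi - pi) / 2\<bar> \<le> 10 * tilt \<beta> i"
        using \<theta>[OF i] ab True by (intro approx i e) auto
      then show ?thesis using A True by (simp add: abs_le_iff field_simps)
    next
      case False
      have "\<bar>B \<beta> i - (\<theta> i - \<beta> - pi) / 2\<bar> \<le> 10 * tilt \<beta> i"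
        using \<theta>[OF i] ab False by (intro approx i) auto
      then show ?thesis using A False by (simp add: abs_le_iff field_simps)
    qed
  qed
  have S: "Im (log_sum (exp (\<i> * of_real a))) = (\<Sum>i<N. B a i)" for a
    by (simp add: log_sum_def B_def Im_sum)
  have "\<bar>\<Sum>i<N. B \<alpha> i - B \<beta> i - ((\<beta> - \<alpha>) / 2 - (if \<theta> i < \<beta> then pi else 0))\<bar> \<le> (\<Sum>i<N. 10 * (tilt \<alpha> i + tilt \<beta> i))"
    by (rule order.trans[OF sum_abs]) (intro sum_mono pt, auto)
  also have "\<dots> = 10 * ((\<Sum>i<N. tilt \<alpha> i) + (\<Sum>i<N. tilt \<beta> i))"
    by (simp add: sum_distrib_left[symmetric] sum.distrib)
  also have "(\<Sum>i<N. B \<alpha> i - B \<beta> i - ((\<beta> - \<alpha>) / 2 - (if \<theta> i < \<beta> then pi else 0)))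
    = Im (log_sum (exp (\<i> * of_real \<alpha>))) - Im (log_sum (exp (\<i> * of_real \<beta>))) - real N * (\<beta> - \<alpha>) / 2 + (\<Sum>i<N. if \<theta> i < \<beta> then pi else 0)"
    unfolding S by (simp add: sum_subtractf)
  also have "(\<Sum>i<N. if \<theta> i < \<beta> then pi else 0) = pi * real (card {i. i < N \<and> \<theta> i < \<beta>})"
  proof -
    have "(\<Sum>i<N. if \<theta> i < \<beta> then pi else 0) = (\<Sum>i\<in>{i\<in>{..<N}. \<theta> i < \<beta>}. pi)" by (subst sum.inter_filter) auto
    also have "{i\<in>{..<N}. \<theta> i < \<beta>} = {i. i < N \<and> \<theta> i < \<beta>}" by auto
    finally show ?thesis by simp
  qed
  finally show ?thesis
    using abs_Im_le_cmod[of "log_sum (exp (\<i> * of_real \<alpha>))"] abs_Im_le_cmod[of "log_sum (exp (\<i> * of_real \<beta>))"]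
    by linarith
qed

end

section \<open>Geometry of the ellipse\<close>

lemma symbol_I_eq: "symbol_I a b \<xi> = a * exp (\<i> * of_real \<xi>) + b / exp (\<i> * of_real \<xi>)"
  by (simp add: symbol_I_def exp_minus divide_inverse)

lemma symbol_I_periodic: "symbol_I a b (\<xi> + 2 * pi * of_int k) = symbol_I a b \<xi>"
proof -
  have "exp (\<i> * of_real (\<xi> + 2 * pi * of_int k)) = exp (\<i> * of_real \<xi>)"
    by (subst exp_eq) (auto simp: algebra_simps intro!: exI[of _ k])
  then show ?thesis by (simp only: symbol_I_eq)
qed

lemma continuous_on_symbol_I: "continuous_on S (symbol_I a b)"
  unfolding symbol_I_def by (intro continuous_intros)

text \<open>On the circle 1/u - 1/v and u - v have equal modulus, so the term with b cannot cancel
  the one with a. This gives injectivity of the symbol and converts distances on the ellipse into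
  distances on the circle.\<close>

lemma norm_symbol_I_diff_ge:
  "(cmod a - cmod b) * cmod (exp (\<i> * of_real \<phi>) - exp (\<i> * of_real \<theta>)) \<le> cmod (symbol_I a b \<phi> - symbol_I a b \<theta>)"
proof -
  let ?u = "exp (\<i> * complex_of_real \<phi>)" and ?v = "exp (\<i> * complex_of_real \<theta>)"
  have n: "cmod (1 / ?u - 1 / ?v) = cmod (?u - ?v)"
  proof -
    have "1 / ?u - 1 / ?v = (?v - ?u) / (?u * ?v)" by (simp add: field_simps)
    then show ?thesis by (simp add: norm_divide norm_mult norm_minus_commute)
  qed
  have "symbol_I a b \<phi> - symbol_I a b \<theta> = a * (?u - ?v) + b * (1 / ?u - 1 / ?v)"
    by (simp add: symbol_I_eq field_simps)
  then have "cmod (a * (?u - ?v)) - cmod (b * (1 / ?u - 1 / ?v)) \<le> cmod (symbol_I a b \<phi> - symbol_I a b \<theta>)"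
    using norm_diff_ineq[of "a * (?u - ?v)" "b * (1 / ?u - 1 / ?v)"] by simp
  then show ?thesis unfolding norm_mult n by (simp add: algebra_simps)
qed

lemma norm_exp_i_diff: "cmod (exp (\<i> * of_real u) - exp (\<i> * of_real v)) = 2 * \<bar>sin ((v - u) / 2)\<bar>"
proof -
  have "exp (\<i> * of_real u) - exp (\<i> * of_real v) = - exp (\<i> * of_real u) * (exp (\<i> * of_real (v - u)) - 1)"
    by (simp add: algebra_simps exp_add[symmetric])
  then have "cmod (exp (\<i> * of_real u) - exp (\<i> * of_real v)) = cmod (exp (\<i> * of_real (v - u)) - 1)"
    by (simp only: norm_mult norm_minus_cancel) simp
  then show ?thesis by (simp only: dist_exp_i_1)
qed

lemma sin_ge_min:
  assumes "0 \<le> p" "p \<le> x" "0 \<le> q" "q \<le> pi - x"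
  shows "sin p \<le> sin x \<or> sin q \<le> sin x"
proof (cases "x \<le> pi / 2")
  case True
  then have "sin p \<le> sin x" using assms by (intro sin_monotone_2pi_le) auto
  then show ?thesis ..
next
  case False
  then have "sin q \<le> sin (pi - x)" using assms by (intro sin_monotone_2pi_le) auto
  then show ?thesis by simp
qed

text \<open>A point of the arc and a point of the complementary arc are separated by an end point
  either way round the circle. On the shorter way, the end point met is at least as close to each of
  them as they are to each other.\<close>

lemma arc_endpoint_close:
  assumes uv: "\<alpha> \<le> u" "u \<le> \<beta>" "\<beta> \<le> v" "v \<le> \<alpha> + 2 * pi" and w: "w = u \<or> w = v"
  shows "cmod (exp (\<i> * of_real w) - exp (\<i> * of_real \<alpha>)) \<le> cmod (exp (\<i> * of_real u) - exp (\<i> * of_real v)) \<or>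
    cmod (exp (\<i> * of_real w) - exp (\<i> * of_real \<beta>)) \<le> cmod (exp (\<i> * of_real u) - exp (\<i> * of_real v))"
proof -
  have s: "\<bar>sin (x / 2)\<bar> = sin (x / 2)" if "0 \<le> x" "x \<le> 2 * pi" for x
    using that by (intro abs_of_nonneg sin_ge_zero) auto
  have uv2: "cmod (exp (\<i> * of_real u) - exp (\<i> * of_real v)) = 2 * sin ((v - u) / 2)"
    unfolding norm_exp_i_diff using uv by (subst s) auto
  from w show ?thesis
  proof
    assume w: "w = u"
    have 1: "cmod (exp (\<i> * of_real w) - exp (\<i> * of_real \<beta>)) = 2 * sin ((\<beta> - u) / 2)"
      unfolding norm_exp_i_diff w using uv by (subst s) auto
    have "cmod (exp (\<i> * of_real w) - exp (\<i> * of_real \<alpha>)) = cmod (exp (\<i> * of_real \<alpha>) - exp (\<i> * of_real w))"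
      by (rule norm_minus_commute)
    also have "\<dots> = 2 * sin ((u - \<alpha>) / 2)"
      unfolding norm_exp_i_diff w using uv by (subst s) auto
    finally have 2: "cmod (exp (\<i> * of_real w) - exp (\<i> * of_real \<alpha>)) = 2 * sin ((u - \<alpha>) / 2)" .
    have "(u - \<alpha>) / 2 \<le> pi - (v - u) / 2" using uv by argo
    then have "sin ((\<beta> - u) / 2) \<le> sin ((v - u) / 2) \<or> sin ((u - \<alpha>) / 2) \<le> sin ((v - u) / 2)"
      using uv by (intro sin_ge_min) auto
    then show ?thesis unfolding 1 2 uv2 by auto
  next
    assume w: "w = v"
    have "cmod (exp (\<i> * of_real w) - exp (\<i> * of_real \<beta>)) = cmod (exp (\<i> * of_real \<beta>) - exp (\<i> * of_real w))"
      by (rule norm_minus_commute)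
    also have "\<dots> = 2 * sin ((v - \<beta>) / 2)"
      unfolding norm_exp_i_diff w using uv by (subst s) auto
    finally have 1: "cmod (exp (\<i> * of_real w) - exp (\<i> * of_real \<beta>)) = 2 * sin ((v - \<beta>) / 2)" .
    have "exp (\<i> * complex_of_real \<alpha>) = exp (\<i> * of_real (\<alpha> + 2 * pi))"
      by (simp add: complex_eq_iff Re_exp Im_exp)
    then have "cmod (exp (\<i> * of_real w) - exp (\<i> * of_real \<alpha>)) = cmod (exp (\<i> * of_real w) - exp (\<i> * of_real (\<alpha> + 2 * pi)))"
      by simp
    also have "\<dots> = 2 * sin ((\<alpha> + 2 * pi - v) / 2)"
      unfolding norm_exp_i_diff w using uv by (subst s) auto
    finally have 2: "cmod (exp (\<i> * of_real w) - exp (\<i> * of_real \<alpha>)) = 2 * sin ((\<alpha> + 2 * pi - v) / 2)" .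
    have "(\<alpha> + 2 * pi - v) / 2 \<le> pi - (v - u) / 2" using uv by argo
    then have "sin ((v - \<beta>) / 2) \<le> sin ((v - u) / 2) \<or> sin ((\<alpha> + 2 * pi - v) / 2) \<le> sin ((v - u) / 2)"
      using uv by (intro sin_ge_min) auto
    then show ?thesis unfolding 1 2 uv2 by auto
  qed
qed

lemma angle_in_window: "\<exists>k::int. \<alpha> \<le> \<xi> + 2 * pi * of_int k \<and> \<xi> + 2 * pi * of_int k < \<alpha> + 2 * pi"
proof -
  define k where "k = \<lceil>(\<alpha> - \<xi>) / (2 * pi)\<rceil>"
  have "(\<alpha> - \<xi>) / (2 * pi) \<le> of_int k" "of_int k < (\<alpha> - \<xi>) / (2 * pi) + 1" unfolding k_def by linarith+
  then have "\<alpha> - \<xi> \<le> of_int k * (2 * pi)" "of_int k * (2 * pi) < \<alpha> - \<xi> + 2 * pi"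
    by (simp_all add: field_simps)
  then show ?thesis by (intro exI[of _ k]) (auto simp: algebra_simps)
qed

text \<open>The eigenvalue lies within 2 |a| (1 - |zeta|) of the point of angle theta, because
  |b|/|zeta| <= |a|. If the radius r does not explain the disagreement, a nearest point of the
  ellipse or of the segment lies on the other side of an end point. Both points are close to the
  eigenvalue, so their parameters are close on the circle, with an end point between them. The + 1
  in \<open>c\<close> pays for the radial distance from zeta to the circle.\<close>

lemma sector_disagreement:
  assumes ab: "0 < cmod b" "cmod b < cmod a" and \<gamma>: "\<alpha> < \<beta>" "\<beta> \<le> \<alpha> + 2 * pi" "\<gamma> = symbol_I a b ` {\<alpha>..\<beta>}"
    and \<zeta>: "cmod (b / a) \<le> (cmod \<zeta>)\<^sup>2" "cmod \<zeta> < 1" "\<zeta> = of_real (cmod \<zeta>) * exp (\<i> * of_real \<theta>)"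
    and \<theta>: "\<alpha> \<le> \<theta>" "\<theta> < \<alpha> + 2 * pi"
    and dis: "(a * \<zeta> + b / \<zeta> \<in> Gamma_nbhd a b r \<gamma>) \<noteq> (\<theta> < \<beta>)"
  defines "c \<equiv> 4 * cmod a / (cmod a - cmod b) + 1"
  shows "r \<le> 2 * cmod a * (1 - cmod \<zeta>) \<or> cmod (\<zeta> - exp (\<i> * of_real \<alpha>)) \<le> c * (1 - cmod \<zeta>) \<or>
    cmod (\<zeta> - exp (\<i> * of_real \<beta>)) \<le> c * (1 - cmod \<zeta>)"
proof -
  define z where "z = a * \<zeta> + b / \<zeta>"
  define \<rho> where "\<rho> = cmod \<zeta>"
  let ?e = "\<lambda>t. exp (\<i> * complex_of_real t)"
  let ?E = "ellipse_E1 a b"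
  have a0: "0 < cmod a" using ab by linarith
  then have a00: "a \<noteq> 0" "b \<noteq> 0" using ab by auto
  have "0 < (cmod \<zeta>)\<^sup>2" using \<zeta>(1) a00 by (smt (verit) zero_less_norm_iff divide_eq_0_iff)
  then have r0: "0 < \<rho>" "\<rho> < 1" using \<zeta>(2) by (auto simp: \<rho>_def)
  have zp: "dist z (symbol_I a b \<theta>) \<le> 2 * cmod a * (1 - \<rho>)"
  proof -
    have "z - symbol_I a b \<theta> = (a * (of_real \<rho> - 1)) * ?e \<theta> + (b / of_real \<rho> * (1 - of_real \<rho>)) / ?e \<theta>"
    proof -
      have "a * X + b / X - (a * e + b / e) = (a * (of_real \<rho> - 1)) * e + (b / of_real \<rho> * (1 - of_real \<rho>)) / e"
        if "X = of_real \<rho> * e" "e \<noteq> 0" for X e :: complex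
        using that r0 by (simp add: field_simps)
      then show ?thesis unfolding z_def symbol_I_eq by (metis \<zeta>(3) \<rho>_def exp_not_eq_zero)
    qed
    then have "cmod (z - symbol_I a b \<theta>) \<le> cmod ((a * (of_real \<rho> - 1)) * ?e \<theta>) + cmod ((b / of_real \<rho> * (1 - of_real \<rho>)) / ?e \<theta>)"
      using norm_triangle_ineq by simp
    also have "cmod ((a * (of_real \<rho> - 1)) * ?e \<theta>) = cmod a * (1 - \<rho>)"
    proof -
      have "cmod (complex_of_real \<rho> - 1) = \<bar>\<rho> - 1\<bar>" by (metis norm_of_real of_real_1 of_real_diff)
      then show ?thesis using r0 by (simp add: norm_mult)
    qed
    also have "cmod ((b / of_real \<rho> * (1 - of_real \<rho>)) / ?e \<theta>) = cmod b / \<rho> * (1 - \<rho>)"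
    proof -
      have "cmod (1 - complex_of_real \<rho>) = \<bar>1 - \<rho>\<bar>" by (metis norm_of_real of_real_1 of_real_diff)
      then show ?thesis using r0 by (simp add: norm_mult norm_divide)
    qed
    also have "cmod b / \<rho> * (1 - \<rho>) \<le> cmod a * (1 - \<rho>)"
    proof -
      have "cmod b \<le> cmod a * \<rho>\<^sup>2" using \<zeta>(1) a0 by (simp add: norm_divide divide_le_eq \<rho>_def mult.commute)
      also have "\<dots> \<le> cmod a * \<rho>" using r0 a0 by (simp add: power2_eq_square mult_left_le)
      finally have "cmod b / \<rho> \<le> cmod a" using r0 by (simp add: divide_le_eq)
      then show ?thesis using r0 by (intro mult_right_mono) auto
    qed
    finally show ?thesis by (simp add: dist_norm)
  qed
  have comp: "compact \<gamma>" unfolding \<gamma>(3) by (intro compact_continuous_image continuous_on_symbol_I compact_Icc)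
  have g0: "\<gamma> \<noteq> {}" using \<gamma> by auto
  have gE: "\<gamma> \<subseteq> ?E" by (auto simp: \<gamma>(3) ellipse_E1_def)
  have E_eq: "?E = symbol_I a b ` {\<alpha>..\<alpha> + 2 * pi}"
  proof
    show "?E \<subseteq> symbol_I a b ` {\<alpha>..\<alpha> + 2 * pi}"
    proof
      fix w assume "w \<in> ?E"
      then obtain \<xi> where "w = symbol_I a b \<xi>" by (auto simp: ellipse_E1_def)
      moreover obtain k where "\<alpha> \<le> \<xi> + 2 * pi * of_int k" "\<xi> + 2 * pi * of_int k < \<alpha> + 2 * pi"
        using angle_in_window by blast
      ultimately show "w \<in> symbol_I a b ` {\<alpha>..\<alpha> + 2 * pi}"
        by (intro image_eqI[of _ _ "\<xi> + 2 * pi * of_int k"]) (auto simp: symbol_I_periodic)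
    qed
  qed (auto simp: ellipse_E1_def)
  have compE: "compact ?E" unfolding E_eq by (intro compact_continuous_image continuous_on_symbol_I compact_Icc)
  have E0: "?E \<noteq> {}" by (auto simp: ellipse_E1_def)
  have dE: "infdist z ?E \<le> 2 * cmod a * (1 - \<rho>)"
    using infdist_le[of "symbol_I a b \<theta>" ?E z] zp by (auto simp: ellipse_E1_def)
  have mono: "infdist z ?E \<le> infdist z \<gamma>" by (rule infdist_mono[OF gE g0])
  have finish: ?thesis
    if uv: "\<alpha> \<le> u" "u \<le> \<beta>" "\<beta> \<le> v" "v \<le> \<alpha> + 2 * pi" and w: "\<theta> = u \<and> \<phi> = v \<or> \<theta> = v \<and> \<phi> = u"
      and d: "dist z (symbol_I a b \<phi>) \<le> 2 * cmod a * (1 - \<rho>)" for u v \<phi>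
  proof -
    have "cmod (symbol_I a b u - symbol_I a b v) \<le> 4 * cmod a * (1 - \<rho>)"
      using d zp w dist_triangle2[of "symbol_I a b u" "symbol_I a b v" z]
      by (auto simp: dist_norm norm_minus_commute algebra_simps)
    then have "(cmod a - cmod b) * cmod (?e u - ?e v) \<le> 4 * cmod a * (1 - \<rho>)"
      using norm_symbol_I_diff_ge[of a b u v] by linarith
    then have uvd: "cmod (?e u - ?e v) \<le> 4 * cmod a / (cmod a - cmod b) * (1 - \<rho>)"
      using ab by (simp add: pos_le_divide_eq mult.commute)
    have zt: "cmod (\<zeta> - ?e \<theta>) = 1 - \<rho>"
    proof -
      have "\<zeta> - ?e \<theta> = of_real (\<rho> - 1) * ?e \<theta>" using \<zeta>(3) by (simp add: \<rho>_def algebra_simps)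
      then show ?thesis using r0 by (simp only: norm_mult norm_of_real) simp
    qed
    have c: "4 * cmod a / (cmod a - cmod b) * (1 - \<rho>) + (1 - \<rho>) = c * (1 - \<rho>)" by (simp add: c_def algebra_simps)
    have tri: "cmod (\<zeta> - ?e t) \<le> c * (1 - \<rho>)" if "cmod (?e \<theta> - ?e t) \<le> cmod (?e u - ?e v)" for t
      using that uvd zt norm_triangle_ineq[of "\<zeta> - ?e \<theta>" "?e \<theta> - ?e t"] c by simp
    show ?thesis using arc_endpoint_close[OF uv, of \<theta>] w tri by (auto simp: \<rho>_def)
  qed
  show ?thesis
  proof (cases "\<theta> < \<beta>")
    case True
    then have tg: "symbol_I a b \<theta> \<in> \<gamma>" using \<theta> by (auto simp: \<gamma>(3))
    have notin: "z \<notin> Gamma_nbhd a b r \<gamma>" using dis True by (simp add: z_def)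
    show ?thesis
    proof (cases "infdist z ?E = infdist z \<gamma>")
      case True
      then have "r \<le> infdist z \<gamma>" using notin by (simp add: Gamma_nbhd_def)
      also have "\<dots> \<le> dist z (symbol_I a b \<theta>)" by (rule infdist_le[OF tg])
      finally show ?thesis using zp by (simp add: \<rho>_def)
    next
      case False
      obtain p where p: "p \<in> ?E" "infdist z ?E = dist z p"
        using infdist_attains_inf[OF compact_imp_closed[OF compE] E0] by blast
      have "p \<notin> \<gamma>" using infdist_le[of p \<gamma> z] p mono False by auto
      moreover obtain \<phi> where \<phi>: "\<phi> \<in> {\<alpha>..\<alpha> + 2 * pi}" "p = symbol_I a b \<phi>" using p(1) unfolding E_eq by blast
      ultimately have "\<beta> \<le> \<phi>" by (auto simp: \<gamma>(3))
      then show ?thesis using \<phi> True \<theta> p dE by (intro finish[of \<theta> \<phi> \<phi>]) auto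
    qed
  next
    case False
    then have "z \<in> Gamma_nbhd a b r \<gamma>" using dis by (simp add: z_def)
    then have eq: "infdist z ?E = infdist z \<gamma>" by (simp add: Gamma_nbhd_def)
    obtain p where p: "p \<in> \<gamma>" "infdist z \<gamma> = dist z p"
      using infdist_attains_inf[OF compact_imp_closed[OF comp] g0] by blast
    obtain \<phi> where \<phi>: "\<phi> \<in> {\<alpha>..\<beta>}" "p = symbol_I a b \<phi>" using p(1) unfolding \<gamma>(3) by blast
    show ?thesis using \<phi> False \<theta> p dE eq by (intro finish[of \<phi> \<theta> \<phi>]) auto
  qed
qed

lemma symbol_I_in_arc_iff:
  assumes ab: "cmod b < cmod a" and \<gamma>: "\<gamma> = symbol_I a b ` {\<alpha>..\<beta>}"
  shows "symbol_I a b \<xi> \<in> \<gamma> \<longleftrightarrow> (\<exists>k::int. \<xi> + 2 * pi * of_int k \<in> {\<alpha>..\<beta>})"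
proof
  assume "symbol_I a b \<xi> \<in> \<gamma>"
  then obtain \<phi> where \<phi>: "\<phi> \<in> {\<alpha>..\<beta>}" "symbol_I a b \<xi> = symbol_I a b \<phi>" by (auto simp: \<gamma>)
  have "(cmod a - cmod b) * cmod (exp (\<i> * of_real \<phi>) - exp (\<i> * of_real \<xi>)) \<le> 0"
    using norm_symbol_I_diff_ge[of a b \<phi> \<xi>] \<phi>(2) by simp
  then have "exp (\<i> * of_real \<phi>) = exp (\<i> * complex_of_real \<xi>)"
    using ab by (simp add: mult_le_0_iff)
  then obtain n :: int where "\<i> * of_real \<phi> = \<i> * complex_of_real \<xi> + of_int (2 * n) * (of_real pi * \<i>)"
    unfolding exp_eq by (auto simp: mult_ac)
  then have "\<i> * complex_of_real \<phi> = \<i> * complex_of_real (\<xi> + 2 * pi * of_int n)" by (simp add: algebra_simps)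
  then have "\<phi> = \<xi> + 2 * pi * of_int n" by (metis complex_i_not_zero mult_left_cancel of_real_eq_iff)
  then show "\<exists>k::int. \<xi> + 2 * pi * of_int k \<in> {\<alpha>..\<beta>}" using \<phi>(1) by blast
next
  assume "\<exists>k::int. \<xi> + 2 * pi * of_int k \<in> {\<alpha>..\<beta>}"
  then obtain k :: int where "\<xi> + 2 * pi * of_int k \<in> {\<alpha>..\<beta>}" by blast
  then show "symbol_I a b \<xi> \<in> \<gamma>" unfolding \<gamma> by (metis imageI symbol_I_periodic)
qed

text \<open>The neighbourhood meets the ellipse exactly in the segment, so only its parameter length
  matters. With alpha shifted into [0, 2 pi), the parameters form one interval, or two if the
  segment crosses 2 pi; for the whole curve the two would overlap in a point, hence the third
  case.\<close>

lemma vol_preimage_Gamma: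
  assumes ab: "cmod b < cmod a" and \<gamma>: "\<alpha> < \<beta>" "\<beta> \<le> \<alpha> + 2 * pi" "\<gamma> = symbol_I a b ` {\<alpha>..\<beta>}" and r: "0 < r"
  shows "vol_preimage a b N (Gamma_nbhd a b r \<gamma>) = real N * (\<beta> - \<alpha>)"
proof -
  have comp: "closed \<gamma>" unfolding \<gamma>(3) by (intro compact_imp_closed compact_continuous_image continuous_on_symbol_I compact_Icc)
  have g0: "\<gamma> \<noteq> {}" using \<gamma> by auto
  have in_iff: "symbol_I a b \<xi> \<in> Gamma_nbhd a b r \<gamma> \<longleftrightarrow> symbol_I a b \<xi> \<in> \<gamma>" for \<xi>
  proof -
    have "infdist (symbol_I a b \<xi>) (ellipse_E1 a b) = 0" by (intro infdist_zero) (auto simp: ellipse_E1_def)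
    then show ?thesis using in_closed_iff_infdist_zero[OF comp g0, of "symbol_I a b \<xi>"] r by (auto simp: Gamma_nbhd_def)
  qed
  define T where "T = {\<xi>. \<xi> \<in> {0..<2 * pi} \<and> symbol_I a b \<xi> \<in> \<gamma>}"
  obtain k :: int where k: "0 \<le> \<alpha> + 2 * pi * of_int k" "\<alpha> + 2 * pi * of_int k < 2 * pi"
    using angle_in_window[of 0 \<alpha>] by auto
  define \<alpha>' \<beta>' where "\<alpha>' = \<alpha> + 2 * pi * of_int k" and "\<beta>' = \<beta> + 2 * pi * of_int k"
  have T: "\<xi> \<in> T \<longleftrightarrow> \<xi> \<in> {0..<2 * pi} \<and> (\<xi> \<in> {\<alpha>'..\<beta>'} \<or> \<xi> + 2 * pi \<in> {\<alpha>'..\<beta>'})" for \<xi>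
  proof -
    have "(\<exists>j::int. \<xi> + 2 * pi * of_int j \<in> {\<alpha>..\<beta>}) \<longleftrightarrow> \<xi> \<in> {\<alpha>'..\<beta>'} \<or> \<xi> + 2 * pi \<in> {\<alpha>'..\<beta>'}" if \<xi>: "0 \<le> \<xi>" "\<xi> < 2 * pi"
    proof
      assume "\<exists>j::int. \<xi> + 2 * pi * of_int j \<in> {\<alpha>..\<beta>}"
      then obtain j :: int where "\<xi> + 2 * pi * of_int j \<in> {\<alpha>..\<beta>}" by blast
      moreover define m where "m = j + k"
      ultimately have j: "\<xi> + 2 * pi * of_int m \<in> {\<alpha>'..\<beta>'}" by (auto simp: \<alpha>'_def \<beta>'_def algebra_simps)
      have "\<beta>' < 4 * pi" using \<gamma>(2) k by (simp add: \<beta>'_def)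
      then have "2 * pi * of_int m < 2 * pi * 2" "2 * pi * (- 1) < 2 * pi * of_int m"
        using j \<xi> k unfolding atLeastAtMost_iff \<alpha>'_def by linarith+
      then have "of_int m < (2::real)" "(-1::real) < of_int m"
        by (simp_all only: mult_less_cancel_left_pos[of "2 * pi"] pi_gt_zero zero_less_mult_iff zero_less_numeral simp_thms)
      then have "m = 0 \<or> m = 1" by linarith
      then show "\<xi> \<in> {\<alpha>'..\<beta>'} \<or> \<xi> + 2 * pi \<in> {\<alpha>'..\<beta>'}" using j by auto
    next
      assume "\<xi> \<in> {\<alpha>'..\<beta>'} \<or> \<xi> + 2 * pi \<in> {\<alpha>'..\<beta>'}"
      then have "\<xi> + 2 * pi * of_int (- k) \<in> {\<alpha>..\<beta>} \<or> \<xi> + 2 * pi * of_int (1 - k) \<in> {\<alpha>..\<beta>}"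
        by (auto simp: \<alpha>'_def \<beta>'_def algebra_simps)
      then show "\<exists>j::int. \<xi> + 2 * pi * of_int j \<in> {\<alpha>..\<beta>}" by blast
    qed
    then show ?thesis unfolding T_def using symbol_I_in_arc_iff[OF ab \<gamma>(3), of \<xi>] by auto
  qed
  have ab': "0 \<le> \<alpha>'" "\<alpha>' < 2 * pi" "\<alpha>' < \<beta>'" "\<beta>' \<le> \<alpha>' + 2 * pi" "\<beta>' - \<alpha>' = \<beta> - \<alpha>"
    using k \<gamma> by (auto simp: \<alpha>'_def \<beta>'_def)
  have Tm: "T \<in> sets lborel \<and> emeasure lborel T = ennreal (\<beta> - \<alpha>)"
  proof -
    consider "\<beta>' < 2 * pi" | "2 * pi \<le> \<beta>'" "\<beta>' < \<alpha>' + 2 * pi" | "\<beta>' = \<alpha>' + 2 * pi" using ab' by linarith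
    then show ?thesis
    proof cases
      case 1
      then have "T = {\<alpha>'..\<beta>'}" using ab' by (auto simp: T)
      then show ?thesis using ab' by simp
    next
      case 2
      then have TT: "T = {0..\<beta>' - 2 * pi} \<union> {\<alpha>'..<2 * pi}" using ab' by (auto simp: T)
      have "emeasure lborel T = emeasure lborel {0..\<beta>' - 2 * pi} + emeasure lborel {\<alpha>'..<2 * pi}"
        unfolding TT using 2 by (intro plus_emeasure[symmetric]) auto
      also have "\<dots> = ennreal (\<beta>' - 2 * pi) + ennreal (2 * pi - \<alpha>')" using 2 ab' by simp
      also have "\<dots> = ennreal (\<beta> - \<alpha>)" using 2 ab' by (subst ennreal_plus[symmetric]) auto
      finally show ?thesis by (simp add: TT)
    next
      case 3
      then have TT: "T = {0..<2 * pi}" using ab' by (auto simp: T)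
      have "\<beta> - \<alpha> = 2 * pi" using 3 ab' by simp
      then show ?thesis unfolding TT by simp
    qed
  qed
  have "{(x, \<xi>). x \<in> {0<..real N} \<and> \<xi> \<in> {0..<2 * pi} \<and> symbol_I a b \<xi> \<in> Gamma_nbhd a b r \<gamma>} = {0<..real N} \<times> T"
    by (auto simp: T_def in_iff)
  then have "vol_preimage a b N (Gamma_nbhd a b r \<gamma>) = measure (lborel \<Otimes>\<^sub>M lborel) ({0<..real N} \<times> T)"
    by (simp add: vol_preimage_def lborel_prod)
  also have "\<dots> = real N * (\<beta> - \<alpha>)"
  proof -
    have "emeasure (lborel \<Otimes>\<^sub>M lborel) ({0<..real N} \<times> T) = emeasure lborel {0<..real N} * emeasure lborel T"
      using Tm by (intro lborel.emeasure_pair_measure_Times) auto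
    also have "\<dots> = ennreal (real N * (\<beta> - \<alpha>))" using Tm \<gamma> by (simp add: ennreal_mult)
    finally show ?thesis using \<gamma> by (simp add: measure_def)
  qed
  finally show ?thesis .
qed

section \<open>Eigenvalues as points near the unit circle\<close>

text \<open>The two roots of a x^2 - z x + b have product b/a, and the one of larger modulus is
  taken.\<close>

lemma joukowski_root:
  fixes a b :: complex
  assumes "a \<noteq> 0" "b \<noteq> 0"
  shows "\<exists>\<zeta>. cmod (b / a) \<le> (cmod \<zeta>)\<^sup>2 \<and> a * \<zeta> + b / \<zeta> = z"
proof -
  define t s D where "t = b / a" and "s = z / a" and "D = csqrt (s\<^sup>2 - 4 * t)"
  have t0: "t \<noteq> 0" using assms by (simp add: t_def)
  have good: "a * x + b / x = z" if "x * x' = t" "x + x' = s" for x x'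
  proof -
    have x0: "x \<noteq> 0" using that t0 by auto
    have "a * x + b / x = a * (x + t / x)" using assms by (simp add: t_def algebra_simps)
    also have "t / x = x'" using that(1) x0 by (simp add: divide_eq_eq mult.commute)
    finally show ?thesis using that assms by (simp add: s_def)
  qed
  have D2: "D * D = s\<^sup>2 - 4 * t" using power2_csqrt[of "s\<^sup>2 - 4 * t"] by (simp add: D_def power2_eq_square)
  define x x' where "x = (s + D) / 2" and "x' = (s - D) / 2"
  have "x * x' = (s\<^sup>2 - D * D) / 4" by (simp add: x_def x'_def power2_eq_square algebra_simps)
  then have xx: "x * x' = t" unfolding D2 by simp
  have sx: "x + x' = s" by (simp add: x_def x'_def field_simps)
  show ?thesis
  proof (cases "cmod t \<le> (cmod x)\<^sup>2")
    case True
    then show ?thesis using good[OF xx sx] unfolding t_def by blast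
  next
    case False
    have n: "cmod x * cmod x' = cmod t" using xx by (metis norm_mult)
    have "cmod x < cmod x'"
    proof (rule ccontr)
      assume "\<not> ?thesis"
      then have "cmod x * cmod x' \<le> cmod x * cmod x" by (intro mult_left_mono) auto
      then show False using n False by (simp add: power2_eq_square)
    qed
    then have "cmod x * cmod x' \<le> cmod x' * cmod x'" by (intro mult_right_mono) auto
    then have "cmod t \<le> (cmod x')\<^sup>2" using n by (simp add: power2_eq_square)
    then show ?thesis using good[of x' x] xx sx unfolding t_def by (auto simp: mult.commute add.commute)
  qed
qed

lemma char_poly_enumeration:
  fixes A :: "complex mat"
  assumes "A \<in> carrier_mat n n"
  shows "\<exists>l. char_poly A = (\<Prod>i<n. [:- l i, 1:])"
proof -
  obtain as where as: "char_poly A = (\<Prod>a\<leftarrow>as. [:- a, 1:])" "length as = n"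
    using char_poly_factorized[OF assms] by blast
  have "(\<Prod>a\<leftarrow>as. [:- a, 1:]) = (\<Prod>i<n. [:- (as ! i), 1:])"
    using as(2) by (simp add: prod.list_conv_set_nth atLeast0LessThan)
  then show ?thesis using as(1) by auto
qed

lemma order_linear_factor: "Polynomial.order z [:- l, 1:] = (if l = z then 1 else 0)" for l z :: complex
proof (cases "l = z")
  case True
  then show ?thesis using order_power_n_n[of z 1] by simp
next
  case False
  then show ?thesis by (simp add: order_0I)
qed

lemma order_prod_linear_factors:
  "finite I \<Longrightarrow> Polynomial.order z (\<Prod>i\<in>I. [:- l i, 1:]) = (\<Sum>i\<in>I. if l i = z then 1 else 0)" for l :: "'i \<Rightarrow> complex"
proof (induction I rule: finite_induct)
  case (insert i I)
  have "(\<Prod>i\<in>insert i I. [:- l i, 1:]) \<noteq> 0" by (subst prod_zero_iff) (use insert in auto)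
  then have nz: "[:- l i, 1:] * (\<Prod>i\<in>I. [:- l i, 1:]) \<noteq> 0" unfolding prod.insert[OF insert.hyps] .
  show ?case
    unfolding prod.insert[OF insert.hyps] sum.insert[OF insert.hyps] order_mult[OF nz] insert.IH order_linear_factor ..
qed (simp add: order_0I)

text \<open>Enumerating the roots by indices absorbs the multiplicities: the weighted sum over the
  spectrum becomes a cardinality.\<close>

lemma eigenvalue_count_eq_card:
  fixes A :: "complex mat"
  assumes A: "A \<in> carrier_mat n n" and cp: "char_poly A = (\<Prod>i<n. [:- l i, 1:])"
  shows "eigenvalue_count A S = card {i. i < n \<and> l i \<in> S}"
proof -
  have spec: "spectrum A = l ` {..<n}"
    unfolding spectrum_root_char_poly[OF A] cp by (auto simp: poly_prod prod_zero_iff)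
  have fin: "finite (spectrum A \<inter> S)" unfolding spec by auto
  have "eigenvalue_count A S = (\<Sum>z\<in>spectrum A \<inter> S. \<Sum>i<n. if l i = z then 1 else 0)"
    unfolding eigenvalue_count_def cp by (simp add: order_prod_linear_factors)
  also have "\<dots> = (\<Sum>i<n. \<Sum>z\<in>spectrum A \<inter> S. if l i = z then 1 else 0)"
    by (rule sum.swap)
  also have "\<dots> = (\<Sum>i<n. if l i \<in> S then 1 else 0)"
  proof (intro sum.cong refl)
    fix i assume "i \<in> {..<n}"
    then have "l i \<in> spectrum A" by (auto simp: spec)
    then show "(\<Sum>z\<in>spectrum A \<inter> S. if l i = z then 1 else 0) = (if l i \<in> S then 1 else (0::nat))"
      unfolding sum.delta'[OF fin] by simp
  qed
  also have "\<dots> = card {i. i < n \<and> l i \<in> S}"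
  proof -
    have "(\<Sum>i<n. if l i \<in> S then 1 else (0::nat)) = (\<Sum>i\<in>{i\<in>{..<n}. l i \<in> S}. 1)" by (subst sum.inter_filter) auto
    also have "{i\<in>{..<n}. l i \<in> S} = {i. i < n \<and> l i \<in> S}" by auto
    finally show ?thesis by simp
  qed
  finally show ?thesis .
qed

text \<open>Numerator and denominator lie in the open right half plane, so their arguments differ by
  less than pi.\<close>

lemma slit_plane_ratio:
  fixes t w :: complex
  assumes t: "cmod t \<le> \<rho>" "\<rho> < 1" and w: "cmod (w - 1) \<le> 1 / 2"
  shows "w / (1 - t) \<notin> \<real>\<^sub>\<le>\<^sub>0" "cmod (w / (1 - t)) \<in> {(1 - \<rho>) / 4..4 / (1 - \<rho>)}"
proof -
  have Rt: "0 < Re (1 - t)" using complex_Re_le_cmod[of t] t by simp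
  then have t0: "1 - t \<noteq> 0" by force
  have r0: "0 \<le> \<rho>" using t norm_ge_zero order.trans by blast
  have Rw: "0 < Re w" using abs_Re_le_cmod[of "w - 1"] w by simp
  show "w / (1 - t) \<notin> \<real>\<^sub>\<le>\<^sub>0"
  proof
    assume "w / (1 - t) \<in> \<real>\<^sub>\<le>\<^sub>0"
    then obtain c where c: "w / (1 - t) = of_real c" "c \<le> 0" by (auto simp: nonpos_Reals_def)
    then have "w = of_real c * (1 - t)" using t0 by (simp add: divide_eq_eq)
    then have "Re w = c * Re (1 - t)" by simp
    also have "\<dots> \<le> 0" using c Rt by (simp add: mult_nonpos_nonneg)
    finally show False using Rw by simp
  qed
  have n1: "1 - \<rho> \<le> cmod (1 - t)" "cmod (1 - t) \<le> 2"
    using norm_triangle_ineq2[of 1 t] norm_triangle_ineq4[of 1 t] t by auto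
  have n2: "1 / 2 \<le> cmod w" "cmod w \<le> 3 / 2"
    using norm_triangle_ineq2[of 1 "1 - w"] norm_triangle_ineq2[of w 1] w by (auto simp: norm_minus_commute)
  have "(1 - \<rho>) / 4 \<le> (1 / 2) / 2" using r0 by simp
  also have "\<dots> \<le> cmod w / cmod (1 - t)" using n1 n2 t by (intro frac_le) auto
  finally have l: "(1 - \<rho>) / 4 \<le> cmod (w / (1 - t))" by (simp add: norm_divide)
  have "cmod w / cmod (1 - t) \<le> 4 / (1 - \<rho>)" using n1 n2 t by (intro frac_le) auto
  then show "cmod (w / (1 - t)) \<in> {(1 - \<rho>) / 4..4 / (1 - \<rho>)}" using l by (simp add: norm_divide)
qed

text \<open>For |x| >= 1 the product is w/(1 - t), where t = tau/x^2 and w = (1 - t^(N+1)) (1 +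
  epsilon). The thresholds 1/10 and 1/5 give |w - 1| <= 1/5 + 1/5 + 1/25 < 1/2, as
  \<open>slit_plane_ratio\<close> asks.\<close>

lemma circle_zeros_of_matrix:
  assumes ab: "0 < cmod b" "cmod b < cmod a" and N: "0 < N" and \<delta>: "0 \<le> \<delta>" and B: "0 \<le> B"
    and q: "\<And>i j. i < N \<Longrightarrow> j < N \<Longrightarrow> cmod (q (i,j)) \<le> B"
    and small: "(real N)\<^sup>2 * \<delta> * B * (2 / (cmod a * (1 - cmod (b / a)) ^ 3)) \<le> 1 / 10"
    and tN: "cmod (b / a) ^ Suc N \<le> 1 / 5"
    and \<zeta>: "\<And>i. i < N \<Longrightarrow> cmod (b / a) \<le> (cmod (\<zeta> i))\<^sup>2"
    and det: "\<And>x. x \<noteq> 0 \<Longrightarrow> det (resolvent_mat a b N \<delta> q (a * x + b / x)) = (\<Prod>i<N. (a * x + b / x) - (a * \<zeta> i + b / \<zeta> i))"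
  shows "circle_zeros (b / a) N \<zeta> (4 / (1 - cmod (b / a)))"
    and "x \<noteq> 0 \<Longrightarrow> det (resolvent_mat a b N \<delta> q (a * x + b / x)) = a ^ N * (\<Prod>i<N. (x - \<zeta> i) * (1 - (b / a) / (\<zeta> i * x)))"
proof -
  have a0: "a \<noteq> 0" "b \<noteq> 0" using ab by auto
  define \<tau> where "\<tau> = b / a"
  have t0: "\<tau> \<noteq> 0" using a0 by (simp add: \<tau>_def)
  have t1: "cmod \<tau> < 1" using ab a0 by (simp add: \<tau>_def norm_divide)
  have z0: "\<zeta> i \<noteq> 0" if "i < N" for i using \<zeta>[OF that] t0 by (auto simp: \<tau>_def)
  have ident: "(a * x + b / x) - (a * \<zeta> i + b / \<zeta> i) = a * ((x - \<zeta> i) * (1 - (b / a) / (\<zeta> i * x)))" if "x \<noteq> 0" "i < N" for x i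
    using that z0[of i] a0 by (simp add: field_simps)
  have dG: "det (resolvent_mat a b N \<delta> q (a * x + b / x)) = a ^ N * (\<Prod>i<N. (x - \<zeta> i) * (1 - (b / a) / (\<zeta> i * x)))" if "x \<noteq> 0" for x
    unfolding det[OF that] using that ident by (simp add: prod.distrib)
  then show "x \<noteq> 0 \<Longrightarrow> det (resolvent_mat a b N \<delta> q (a * x + b / x)) = a ^ N * (\<Prod>i<N. (x - \<zeta> i) * (1 - (b / a) / (\<zeta> i * x)))" .
  show "circle_zeros (b / a) N \<zeta> (4 / (1 - cmod (b / a)))"
  proof (unfold_locales)
    show "b / a \<noteq> 0" "cmod (b / a) < 1" using t0 t1 by (simp_all add: \<tau>_def)
    show "1 \<le> 4 / (1 - cmod (b / a))"
    proof -
      have "1 - cmod (b / a) \<le> 4" by (smt (verit) norm_ge_zero)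
      then show ?thesis using t1 by (simp only: \<tau>_def[symmetric]) (simp add: pos_le_divide_eq)
    qed
    show "cmod (b / a) \<le> (cmod (\<zeta> i))\<^sup>2" if "i < N" for i by (rule \<zeta>[OF that])
    fix x :: complex assume x: "1 \<le> cmod x"
    then have x0: "x \<noteq> 0" by auto
    define y t where "y = b / a / x" and "t = y / x"
    have small2: "(real N)\<^sup>2 * \<delta> * B * (2 / (cmod a * (1 - cmod (b / a)) ^ 3)) \<le> 1 / 2" using small by linarith
    from det_resolvent_outside[where q = q, OF a0(1) x t1[unfolded \<tau>_def] N \<delta> B q small2]
    obtain \<epsilon> where \<epsilon>: "cmod \<epsilon> \<le> 2 * ((real N)\<^sup>2 * \<delta> * B * (2 / (cmod a * (1 - cmod (b / a)) ^ 3)))"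
      "det (resolvent_mat a b N \<delta> q (a * x + b / x)) = a ^ N * U_seq x y (Suc N) * (1 + \<epsilon>)"
      unfolding y_def by blast
    have eps: "cmod \<epsilon> \<le> 1 / 5" using \<epsilon>(1) small by linarith
    have tt: "cmod t \<le> cmod \<tau>"
    proof -
      have "cmod t = cmod \<tau> / (cmod x * cmod x)" by (simp add: t_def y_def \<tau>_def norm_divide norm_mult)
      moreover have "1 \<le> cmod x * cmod x" using x mult_mono[of 1 "cmod x" 1 "cmod x"] by simp
      ultimately show ?thesis by (simp add: divide_le_eq mult_left_mono[of 1 _ "cmod \<tau>", simplified])
    qed
    have tN': "cmod (t ^ Suc N) \<le> 1 / 5"
      using power_mono[OF tt, of "Suc N"] tN unfolding \<tau>_def by (simp only: norm_power) simp
    define w where "w = (1 - t ^ Suc N) * (1 + \<epsilon>)"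
    have "w - 1 = \<epsilon> - t ^ Suc N - t ^ Suc N * \<epsilon>" by (simp add: w_def algebra_simps)
    then have "cmod (w - 1) \<le> cmod \<epsilon> + cmod (t ^ Suc N) + cmod (t ^ Suc N) * cmod \<epsilon>"
      using norm_triangle_ineq4[of "\<epsilon> - t ^ Suc N" "t ^ Suc N * \<epsilon>"] norm_triangle_ineq4[of \<epsilon> "t ^ Suc N"]
      by (simp only: norm_mult)
    also have "cmod (t ^ Suc N) * cmod \<epsilon> \<le> (1 / 5) * (1 / 5)" using tN' eps by (intro mult_mono) auto
    finally have w: "cmod (w - 1) \<le> 1 / 2" using tN' eps by simp
    have Uy: "U_seq x y (Suc N) = x ^ N * ((1 - t ^ Suc N) / (1 - t))"
    proof -
      have "Re t \<le> cmod t" by (rule complex_Re_le_cmod)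
      then have "1 - t \<noteq> 0" using tt t1 by (metis eq_iff_diff_eq_0 linorder_not_less norm_one)
      moreover have "y = t * x" using x0 by (simp add: t_def)
      moreover have "(x - y) * U_seq x y (Suc N) = x ^ Suc N - y ^ Suc N" by (rule U_seq_closed)
      ultimately have "x * (1 - t) * U_seq x y (Suc N) = x * (x ^ N * (1 - t ^ Suc N))"
        by (simp add: algebra_simps power_mult_distrib)
      then have "(1 - t) * U_seq x y (Suc N) = x ^ N * (1 - t ^ Suc N)" using x0 by (simp add: mult.assoc)
      then show ?thesis using \<open>1 - t \<noteq> 0\<close> by (simp add: field_simps)
    qed
    have "(\<Prod>i<N. (x - \<zeta> i) * (1 - (b / a) / (\<zeta> i * x))) = x ^ N * (w / (1 - t))"
    proof -
      have "a ^ N * (\<Prod>i<N. (x - \<zeta> i) * (1 - (b / a) / (\<zeta> i * x))) = a ^ N * (U_seq x y (Suc N) * (1 + \<epsilon>))"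
        using dG[OF x0] \<epsilon>(2) by (simp only: mult.assoc)
      moreover have "a ^ N \<noteq> 0" using a0 by simp
      ultimately have "(\<Prod>i<N. (x - \<zeta> i) * (1 - (b / a) / (\<zeta> i * x))) = U_seq x y (Suc N) * (1 + \<epsilon>)"
        using mult_left_cancel by blast
      then show ?thesis unfolding Uy w_def by (simp only: times_divide_eq_right times_divide_eq_left mult.assoc)
    qed
    moreover have "(\<Prod>i<N. (x - \<zeta> i) * (1 - (b / a) / (\<zeta> i * x))) = x ^ N * (\<Prod>i<N. (1 - \<zeta> i / x) * (1 - (b / a) / (\<zeta> i * x)))"
    proof -
      have "(\<Prod>i<N. (x - \<zeta> i) * (1 - (b / a) / (\<zeta> i * x))) = (\<Prod>i<N. x * ((1 - \<zeta> i / x) * (1 - (b / a) / (\<zeta> i * x))))"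
        using x0 by (intro prod.cong) (auto simp: field_simps)
      then show ?thesis by (simp only: prod.distrib prod_constant) simp
    qed
    ultimately have *: "x ^ N * (\<Prod>i<N. (1 - \<zeta> i / x) * (1 - (b / a) / (\<zeta> i * x))) = x ^ N * (w / (1 - t))" by (simp only:)
    have e: "(\<Prod>i<N. (1 - \<zeta> i / x) * (1 - (b / a) / (\<zeta> i * x))) = w / (1 - t)"
    proof -
      have "x ^ N \<noteq> 0" using x0 by simp
      from iffD1[OF mult_left_cancel[OF this]] * show ?thesis by blast
    qed
    show "(\<Prod>i<N. (1 - \<zeta> i / x) * (1 - b / a / (\<zeta> i * x))) \<notin> \<real>\<^sub>\<le>\<^sub>0 \<and>
       cmod (\<Prod>i<N. (1 - \<zeta> i / x) * (1 - b / a / (\<zeta> i * x))) \<in> {1 / (4 / (1 - cmod (b / a)))..4 / (1 - cmod (b / a))}"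
      unfolding e using slit_plane_ratio[OF tt t1 w] by (simp add: \<tau>_def)
  qed
qed

text \<open>The interior points, in the coordinate \<open>x\<close>, at which a lower bound of the determinant is needed: a net at a fixed
  depth for the sum of the depths of the zeros, and points approaching \<open>\<alpha>\<close> and \<open>\<beta>\<close> dyadically.\<close>

definition test_points :: "complex \<Rightarrow> real \<Rightarrow> real \<Rightarrow> nat \<Rightarrow> nat \<Rightarrow> complex set" where
  "test_points \<tau> \<alpha> \<beta> M n = (let s = - 9 / 100 * ln (cmod \<tau>) in
     (\<lambda>k. exp (\<i> * of_real (2 * pi * real k / real M) - of_real s)) ` {..<M} \<union>
     (\<lambda>k. exp (\<i> * of_real \<alpha> - of_real (s / 2 ^ k))) ` {..n} \<union>
     (\<lambda>k. exp (\<i> * of_real \<beta> - of_real (s / 2 ^ k))) ` {..n})"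

lemma finite_test_points: "finite (test_points \<tau> \<alpha> \<beta> M n)"
  by (simp add: test_points_def Let_def)

lemma card_test_points_le: "card (test_points \<tau> \<alpha> \<beta> M n) \<le> M + 2 * Suc n"
proof -
  have cu: "card (A \<union> B \<union> C) \<le> card A + card B + card C" for A B C :: "complex set"
    using card_Un_le[of "A \<union> B" C] card_Un_le[of A B] by linarith
  have 1: "card (f ` {..<M}) \<le> M" for f :: "nat \<Rightarrow> complex" using card_image_le[of "{..<M}" f] by simp
  have 2: "card (f ` {..n}) \<le> Suc n" for f :: "nat \<Rightarrow> complex" using card_image_le[of "{..n}" f] by simp
  have "card (f ` {..<M} \<union> g ` {..n} \<union> h ` {..n}) \<le> M + 2 * Suc n" for f g h :: "nat \<Rightarrow> complex"
    using cu[of "f ` {..<M}" "g ` {..n}" "h ` {..n}"] 1[of f] 2[of g] 2[of h] unfolding mult_2 by linarith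
  then show ?thesis unfolding test_points_def Let_def .
qed

text \<open>The bound sqrt |tau| keeps the second root b/(a x) at modulus at most sqrt |tau| < 1,
  which the estimate of the corner minor requires.\<close>

lemma norm_test_points:
  assumes "0 < cmod \<tau>" "cmod \<tau> < 1" and x: "x \<in> test_points \<tau> \<alpha> \<beta> M n"
  shows "sqrt (cmod \<tau>) \<le> cmod x" "cmod x \<le> 1"
proof -
  define s where "s = - 9 / 100 * ln (cmod \<tau>)"
  have s0: "0 \<le> s" using assms ln_less_zero[of "cmod \<tau>"] by (simp add: s_def)
  have le: "s / 2 ^ k \<le> s" for k using s0 one_le_power[of "2::real" k] by (simp add: divide_le_eq mult_left_le mult_left_mono[of 1 "2 ^ k" s, simplified])
  obtain t where t: "cmod x = exp (- t)" "0 \<le> t" "t \<le> s"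
    using x s0 le unfolding test_points_def Let_def s_def[symmetric] by auto
  show "cmod x \<le> 1" using t by simp
  have "sqrt (cmod \<tau>) = exp (ln (cmod \<tau>) / 2)"
    using assms by (intro real_sqrt_unique) (auto simp flip: exp_double)
  also have "\<dots> \<le> exp (- t)" using t s0 ln_less_zero[OF assms(1,2)] by (simp add: s_def)
  finally show "sqrt (cmod \<tau>) \<le> cmod x" using t by simp
qed

section \<open>From lower bounds at the test points to the eigenvalue count\<close>

context circle_zeros
begin

text \<open>\<open>A\<close> is the logarithmic loss of the determinant at the test points and
  \<open>L\<close> stands for ln N. The constants \<open>d1\<close>, \<open>t1\<close> and
  \<open>s1\<close> depend on neither, which makes the final constant independent of N.\<close>

lemma sums_of_test_points:
  assumes N: "1 \<le> N" and M: "2 \<le> M" "pi / real M \<le> 3 / 10 * ell" and A: "1 \<le> A" and L: "1 \<le> L"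
    and n: "rad / 10 / 2 ^ n \<le> 1 / (2 * real N)" "real (Suc n) \<le> n1 * L" and n1: "0 \<le> n1"
    and k: "2 * real N * cmod \<tau> ^ k \<le> 1" "real k \<le> k1 * L" and k1: "0 \<le> k1"
    and low: "\<And>x. x \<in> test_points \<tau> \<alpha> \<beta> M n \<Longrightarrow> exp (- A) \<le> cmod (G x)"
  defines "d1 \<equiv> 20 * real M * rad * (ln K + 1)"
  defines "t1 \<equiv> (ell + 2 * pi) * (3 / (2 * rad)) * d1 + 56 * (ell + 2 * pi) * n1 * (ln K + 1) + (10 + 2 * ln K) / ln 2"
  defines "s1 \<equiv> k1 * (ln K + pi + 2 * d1 / (1 - sqrt (cmod \<tau>))) + 1"
  shows "(\<Sum>i<N. depth i) \<le> d1 * A"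
    and "(\<Sum>i<N. tilt \<alpha> i) \<le> t1 * (A * L)" "(\<Sum>i<N. tilt \<beta> i) \<le> t1 * (A * L)"
    and "cmod (log_sum (exp (\<i> * of_real \<alpha>))) \<le> s1 * (A * L)" "cmod (log_sum (exp (\<i> * of_real \<beta>))) \<le> s1 * (A * L)"
proof -
  have rad: "0 < rad" using ell_pos by (simp add: rad_def)
  have lnK: "0 \<le> ln K" using K1 by simp
  \<comment> \<open>The depth used in \<open>test_points\<close> is \<open>rad / 10\<close>, written
    there without the locale.\<close>
  have r10: "rad / 10 = - 9 / 100 * ln (cmod \<tau>)" by (simp add: rad_def ell_def)
  have lnKm: "ln (K / exp (- A)) = ln K + A" using K1 by (simp add: ln_div)
  have lnKA: "ln K + A \<le> (ln K + 1) * A" using A lnK mult_left_mono[of 1 A "ln K"] by (simp add: algebra_simps)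
  have AL: "1 \<le> A * L" "A \<le> A * L" "L \<le> A * L"
    using A L mult_mono[of 1 A 1 L] mult_left_mono[of 1 L A] mult_right_mono[of 1 A L] by auto
  have "(\<Sum>i<N. depth i) \<le> 20 * real M * rad * ln (K / exp (- A))"
  proof (intro depth_sum M)
    fix k assume "k < M"
    then have "exp (\<i> * of_real (2 * pi * real k / real M) - of_real (rad / 10)) \<in> test_points \<tau> \<alpha> \<beta> M n"
      unfolding r10 test_points_def Let_def by blast
    then show "exp (- A) \<le> cmod (G (exp (\<i> * of_real (2 * pi * real k / real M) - of_real (rad / 10))))" by (rule low)
  qed simp
  also have "\<dots> \<le> 20 * real M * rad * ((ln K + 1) * A)"
    unfolding lnKm using lnKA rad by (intro mult_left_mono) auto
  finally show D: "(\<Sum>i<N. depth i) \<le> d1 * A" by (simp add: d1_def mult_ac)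
  have d10: "0 \<le> d1" using rad lnK by (simp add: d1_def)
  have ep: "0 < ell + 2 * pi" using ell_pos by (simp add: add_pos_pos)
  have tl: "(\<Sum>i<N. tilt a i) \<le> t1 * (A * L)"
    if lo: "\<And>k. k \<le> n \<Longrightarrow> exp (- A) \<le> cmod (G (exp (\<i> * of_real a - of_real (rad / 10 / 2 ^ k))))" for a
  proof -
    have "(\<Sum>i<N. tilt a i) \<le> (ell + 2 * pi) * (3 / (2 * rad)) * (\<Sum>i<N. depth i)
      + 56 * (ell + 2 * pi) * real (Suc n) * ln (K / exp (- A)) + (10 + 2 * ln K) / ln 2"
      by (intro tilt_sum N n(1) lo) auto
    also have "(ell + 2 * pi) * (3 / (2 * rad)) * (\<Sum>i<N. depth i) \<le> (ell + 2 * pi) * (3 / (2 * rad)) * (d1 * (A * L))"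
    proof (intro mult_left_mono)
      show "(\<Sum>i<N. depth i) \<le> d1 * (A * L)" using D mult_left_mono[OF AL(2) d10] by linarith
    qed (use ep rad in auto)
    also have "56 * (ell + 2 * pi) * real (Suc n) * ln (K / exp (- A)) \<le> 56 * (ell + 2 * pi) * (n1 * L) * ((ln K + 1) * A)"
      unfolding lnKm using lnKA n(2) ep n1 L lnK A by (intro mult_mono) auto
    also have "(10 + 2 * ln K) / ln 2 \<le> (10 + 2 * ln K) / ln 2 * (A * L)"
      using AL(1) lnK mult_left_mono[of 1 "A * L" "(10 + 2 * ln K) / ln 2"] by simp
    finally show ?thesis by (simp add: t1_def algebra_simps)
  qed
  show "(\<Sum>i<N. tilt \<alpha> i) \<le> t1 * (A * L)"
    by (rule tl, rule low) (auto simp: test_points_def Let_def r10)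
  show "(\<Sum>i<N. tilt \<beta> i) \<le> t1 * (A * L)"
    by (rule tl, rule low) (auto simp: test_points_def Let_def r10)
  have sq: "0 < 1 - sqrt (cmod \<tau>)" using sqrt_tau_lt by simp
  have sl: "cmod (log_sum (exp (\<i> * of_real a))) \<le> s1 * (A * L)" for a
  proof -
    have "cmod (log_sum (exp (\<i> * of_real a))) \<le> real k * (ln K + pi + 2 * (\<Sum>i<N. depth i) / (1 - sqrt (cmod \<tau>))) + 1"
      by (intro norm_log_sum_le N k(1)) simp
    also have "real k * (ln K + pi + 2 * (\<Sum>i<N. depth i) / (1 - sqrt (cmod \<tau>))) \<le> (k1 * L) * ((ln K + pi + 2 * d1 / (1 - sqrt (cmod \<tau>))) * A)"
    proof (intro mult_mono k(2))
      have "ln K + pi \<le> (ln K + pi) * A" using A lnK pi_gt_zero mult_left_mono[of 1 A "ln K + pi"] by simp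
      moreover have "2 * (\<Sum>i<N. depth i) / (1 - sqrt (cmod \<tau>)) \<le> 2 * (d1 * A) / (1 - sqrt (cmod \<tau>))"
        using D sq by (intro divide_right_mono) auto
      ultimately show "ln K + pi + 2 * (\<Sum>i<N. depth i) / (1 - sqrt (cmod \<tau>)) \<le> (ln K + pi + 2 * d1 / (1 - sqrt (cmod \<tau>))) * A"
        by (simp add: algebra_simps)
      have "0 \<le> (\<Sum>i<N. depth i)" by (intro sum_nonneg) (auto intro: less_imp_le depth_pos)
      then show "0 \<le> ln K + pi + 2 * (\<Sum>i<N. depth i) / (1 - sqrt (cmod \<tau>))"
        using lnK sq by (intro add_nonneg_nonneg divide_nonneg_nonneg) auto
    qed (use k1 L in auto)
    finally have *: "cmod (log_sum (exp (\<i> * of_real a))) \<le> (k1 * L) * ((ln K + pi + 2 * d1 / (1 - sqrt (cmod \<tau>))) * A) + 1" by simp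
    have "(k1 * E + 1) * (A * L) = (k1 * L) * (E * A) + A * L" for E by (simp add: algebra_simps)
    then have "s1 * (A * L) = (k1 * L) * ((ln K + pi + 2 * d1 / (1 - sqrt (cmod \<tau>))) * A) + A * L"
      unfolding s1_def .
    then show ?thesis using * AL(1) by linarith
  qed
  show "cmod (log_sum (exp (\<i> * of_real \<alpha>))) \<le> s1 * (A * L)" "cmod (log_sum (exp (\<i> * of_real \<beta>))) \<le> s1 * (A * L)"
    by (rule sl)+
qed

text \<open>Membership in the neighbourhood and in the sector are compared index by index. A
  disagreement is paid for by \<open>c\<close> times a tilt at one of the ends, or by 2 |a|/r times
  the depth; the latter is the origin of 1/r in the result.\<close>

lemma Gamma_count:
  assumes tau: "\<tau> = b / a" and ab: "0 < cmod b" "cmod b < cmod a"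
    and \<gamma>: "\<alpha> < \<beta>" "\<beta> \<le> \<alpha> + 2 * pi" "\<gamma> = symbol_I a b ` {\<alpha>..\<beta>}" and r: "0 < r"
  defines "c \<equiv> 4 * cmod a / (cmod a - cmod b) + 1"
  shows "\<bar>real (card {i. i < N \<and> a * \<zeta> i + b / \<zeta> i \<in> Gamma_nbhd a b r \<gamma>}) - real N * (\<beta> - \<alpha>) / (2 * pi)\<bar>
    \<le> cmod (log_sum (exp (\<i> * of_real \<alpha>))) + cmod (log_sum (exp (\<i> * of_real \<beta>)))
      + (10 + c) * ((\<Sum>i<N. tilt \<alpha> i) + (\<Sum>i<N. tilt \<beta> i)) + 2 * cmod a / r * (\<Sum>i<N. depth i)"
proof -
  have "\<exists>t. \<alpha> \<le> t \<and> t < \<alpha> + 2 * pi \<and> \<zeta> i = of_real (cmod (\<zeta> i)) * exp (\<i> * of_real t)" for i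
  proof -
    obtain k :: int where k: "\<alpha> \<le> Arg2pi (\<zeta> i) + 2 * pi * of_int k" "Arg2pi (\<zeta> i) + 2 * pi * of_int k < \<alpha> + 2 * pi"
      using angle_in_window by blast
    have "exp (\<i> * of_real (Arg2pi (\<zeta> i) + 2 * pi * of_int k)) = exp (\<i> * complex_of_real (Arg2pi (\<zeta> i)))"
      by (subst exp_eq) (auto simp: algebra_simps intro!: exI[of _ k])
    then have "\<zeta> i = of_real (cmod (\<zeta> i)) * exp (\<i> * of_real (Arg2pi (\<zeta> i) + 2 * pi * of_int k))"
      using Arg2pi[of "\<zeta> i"] unfolding is_Arg_def by simp
    then show ?thesis using k by blast
  qed
  then obtain \<theta> where \<theta>: "\<And>i. \<alpha> \<le> \<theta> i \<and> \<theta> i < \<alpha> + 2 * pi" "\<And>i. \<zeta> i = of_real (cmod (\<zeta> i)) * exp (\<i> * of_real (\<theta> i))"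
    by metis
  define P where "P = {i. i < N \<and> a * \<zeta> i + b / \<zeta> i \<in> Gamma_nbhd a b r \<gamma>}"
  define S where "S = {i. i < N \<and> \<theta> i < \<beta>}"
  have "1 \<le> c" using ab by (auto simp: c_def divide_nonneg_nonneg)
  then have c1: "1 \<le> c" "0 < c" by auto
  have a0: "0 < cmod a" using ab by linarith
  have fin: "finite P" "finite S" by (auto simp: P_def S_def)
  have pt: "\<bar>(if i \<in> P then 1 else 0) - (if i \<in> S then 1 else (0::real))\<bar> \<le> c * (tilt \<alpha> i + tilt \<beta> i) + 2 * cmod a / r * depth i" if i: "i < N" for i
  proof (cases "(i \<in> P) = (i \<in> S)")
    case True
    then show ?thesis using tilt_nonneg[OF i] depth_pos[OF i] c1 r a0 by (auto intro!: add_nonneg_nonneg mult_nonneg_nonneg less_imp_le)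
  next
    case False
    have nn: "0 \<le> c * tilt \<alpha> i" "0 \<le> c * tilt \<beta> i" "0 \<le> 2 * cmod a / r * depth i"
      using tilt_nonneg[OF i] depth_pos[OF i] c1 r a0 by (auto intro!: mult_nonneg_nonneg less_imp_le)
    have "(a * \<zeta> i + b / \<zeta> i \<in> Gamma_nbhd a b r \<gamma>) \<noteq> (\<theta> i < \<beta>)" using False i by (auto simp: P_def S_def)
    then have "r \<le> 2 * cmod a * (1 - cmod (\<zeta> i)) \<or> cmod (\<zeta> i - exp (\<i> * of_real \<alpha>)) \<le> c * (1 - cmod (\<zeta> i)) \<or>
       cmod (\<zeta> i - exp (\<i> * of_real \<beta>)) \<le> c * (1 - cmod (\<zeta> i))"
      unfolding c_def using \<theta> i zeta_ge[OF i] zeta_lt[OF i] by (intro sector_disagreement[OF ab \<gamma>]) (auto simp: tau)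
    then have "1 \<le> c * tilt \<alpha> i \<or> 1 \<le> c * tilt \<beta> i \<or> 1 \<le> 2 * cmod a / r * depth i"
    proof (elim disjE)
      assume "r \<le> 2 * cmod a * (1 - cmod (\<zeta> i))"
      also have "\<dots> \<le> 2 * cmod a * depth i" using one_minus_le_depth[OF i] by (intro mult_left_mono) auto
      finally show ?thesis using r by (simp add: pos_le_divide_eq)
    qed (use norm_diff_pos[OF i] in \<open>auto simp: tilt_def pos_le_divide_eq\<close>)
    then have "1 \<le> c * (tilt \<alpha> i + tilt \<beta> i) + 2 * cmod a / r * depth i" using nn unfolding distrib_left by linarith
    then show ?thesis by auto
  qed
  have card_eq: "real (card X) = (\<Sum>i<N. if i \<in> X then 1 else 0)" if "X \<subseteq> {..<N}" for X
  proof -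
    have "(\<Sum>i<N. if i \<in> X then 1 else (0::real)) = (\<Sum>i\<in>{..<N} \<inter> X. 1)" by (subst sum.inter_restrict) auto
    also have "{..<N} \<inter> X = X" using that by auto
    finally show ?thesis by simp
  qed
  have "real (card P) - real (card S) = (\<Sum>i<N. (if i \<in> P then 1 else 0) - (if i \<in> S then 1 else (0::real)))"
    by (subst (1 2) card_eq) (auto simp: P_def S_def sum_subtractf)
  then have "\<bar>real (card P) - real (card S)\<bar> \<le> (\<Sum>i<N. \<bar>(if i \<in> P then 1 else 0) - (if i \<in> S then 1 else (0::real))\<bar>)"
    by (simp only: sum_abs)
  also have "\<dots> \<le> (\<Sum>i<N. c * (tilt \<alpha> i + tilt \<beta> i) + 2 * cmod a / r * depth i)"
    by (intro sum_mono pt) auto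
  also have "\<dots> = c * ((\<Sum>i<N. tilt \<alpha> i) + (\<Sum>i<N. tilt \<beta> i)) + 2 * cmod a / r * (\<Sum>i<N. depth i)"
    by (simp only: sum.distrib sum_distrib_left[symmetric])
  finally have 1: "\<bar>real (card P) - real (card S)\<bar> \<le> c * ((\<Sum>i<N. tilt \<alpha> i) + (\<Sum>i<N. tilt \<beta> i)) + 2 * cmod a / r * (\<Sum>i<N. depth i)" .
  define X where "X = cmod (log_sum (exp (\<i> * of_real \<alpha>))) + cmod (log_sum (exp (\<i> * of_real \<beta>))) + 10 * ((\<Sum>i<N. tilt \<alpha> i) + (\<Sum>i<N. tilt \<beta> i))"
  have X0: "0 \<le> X" unfolding X_def using tilt_nonneg by (intro add_nonneg_nonneg mult_nonneg_nonneg sum_nonneg) auto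
  have "\<bar>pi * real (card S) - real N * (\<beta> - \<alpha>) / 2\<bar> \<le> X"
    unfolding S_def X_def using \<theta> by (intro sector_count \<gamma>(1,2)) auto
  moreover have "pi * real (card S) - real N * (\<beta> - \<alpha>) / 2 = pi * (real (card S) - real N * (\<beta> - \<alpha>) / (2 * pi))"
    by (simp add: field_simps)
  ultimately have "pi * \<bar>real (card S) - real N * (\<beta> - \<alpha>) / (2 * pi)\<bar> \<le> X" by (simp add: abs_mult)
  moreover have "1 * \<bar>real (card S) - real N * (\<beta> - \<alpha>) / (2 * pi)\<bar> \<le> pi * \<bar>real (card S) - real N * (\<beta> - \<alpha>) / (2 * pi)\<bar>"
    using pi_gt3 by (intro mult_right_mono) auto
  ultimately have "\<bar>real (card S) - real N * (\<beta> - \<alpha>) / (2 * pi)\<bar> \<le> X" by argo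
  then have "\<bar>real (card P) - real N * (\<beta> - \<alpha>) / (2 * pi)\<bar> \<le> X + (c * ((\<Sum>i<N. tilt \<alpha> i) + (\<Sum>i<N. tilt \<beta> i)) + 2 * cmod a / r * (\<Sum>i<N. depth i))"
    using 1 by argo
  then show ?thesis unfolding P_def X_def by (simp add: algebra_simps)
qed

end

text \<open>The deterministic half of the argument. \<open>M\<close> and \<open>n\<close> are chosen
  before the noise, so that the test points do not depend on it and a union bound over them is
  possible.\<close>

theorem eigenvalue_count_estimate:
  assumes ab: "0 < cmod b" "cmod b < cmod a"
    and \<gamma>: "\<alpha> < \<beta>" "\<beta> \<le> \<alpha> + 2 * pi" "\<gamma> = symbol_I a b ` {\<alpha>..\<beta>}"
  shows "\<exists>C M n. 0 < C \<and> (\<forall>N\<ge>3. real (Suc (n N)) \<le> C * ln (real N)) \<and>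
    (\<forall>N \<delta> B q A r X. 3 \<le> N \<longrightarrow> 0 \<le> \<delta> \<longrightarrow> 0 \<le> B \<longrightarrow> (\<forall>i<N. \<forall>j<N. cmod (q (i,j)) \<le> B) \<longrightarrow>
      (real N)\<^sup>2 * \<delta> * B * (2 / (cmod a * (1 - cmod (b / a)) ^ 3)) \<le> 1 / 10 \<longrightarrow>
      cmod (b / a) ^ Suc N \<le> 1 / 5 \<longrightarrow> 1 \<le> A \<longrightarrow> 0 < r \<longrightarrow>
      (\<forall>x\<in>test_points (b / a) \<alpha> \<beta> M (n N). cmod a ^ N * exp (- A) \<le> cmod (det (resolvent_mat a b N \<delta> q (a * x + b / x)))) \<longrightarrow>
      X \<in> carrier_mat N N \<longrightarrow> (\<forall>z. poly (char_poly X) z = det (resolvent_mat a b N \<delta> q z)) \<longrightarrow>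
      \<bar>real (eigenvalue_count X (Gamma_nbhd a b r \<gamma>)) - real N * (\<beta> - \<alpha>) / (2 * pi)\<bar> \<le> C * A * (1 / r + ln (real N)))"
proof -
  define \<tau> where "\<tau> = b / a"
  have a0: "a \<noteq> 0" "b \<noteq> 0" using ab by auto
  have t: "0 < cmod \<tau>" "cmod \<tau> < 1" using ab a0 by (simp_all add: \<tau>_def norm_divide)
  define e R K where "e = - ln (cmod \<tau>)" and "R = 9 / 10 * e" and "K = 4 / (1 - cmod \<tau>)"
  have e0: "0 < e" using t by (simp add: e_def)
  have R0: "0 < R" using e0 by (simp add: R_def)
  have K1: "1 \<le> K"
    unfolding K_def using t by (subst pos_le_divide_eq) (simp, argo)
  define M where "M = max 2 (nat \<lceil>10 * pi / (3 * e)\<rceil>)"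
  have M: "2 \<le> M" "pi / real M \<le> 3 / 10 * e"
  proof -
    show "2 \<le> M" by (simp add: M_def)
    have "10 * pi / (3 * e) \<le> real (nat \<lceil>10 * pi / (3 * e)\<rceil>)" by (rule real_nat_ceiling_ge)
    also have "\<dots> \<le> real M" by (simp add: M_def)
    finally have "10 * pi \<le> real M * (3 * e)" using e0 by (simp add: pos_divide_le_eq)
    then show "pi / real M \<le> 3 / 10 * e" using \<open>2 \<le> M\<close> by (simp add: divide_le_eq field_simps)
  qed
  \<comment> \<open>The number of dyadic scales down to 1/(2 N) and, next, the number of reflections
    out to modulus 2 N; both are O(ln N). The summand 1 keeps the logarithm nonnegative.\<close>
  define n where "n = (\<lambda>N::nat. nat \<lceil>log 2 (1 + R * real N)\<rceil>)"
  define k where "k = (\<lambda>N::nat. nat \<lceil>ln (2 * real N) / e\<rceil>)"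
  define n1 where "n1 = (ln (1 + R) + 1) / ln 2 + 2"
  define k1 where "k1 = (ln 2 + 1) / e + 1"
  have L: "1 \<le> ln (real N)" if "3 \<le> N" for N
  proof -
    have "exp 1 \<le> (3::real)" by (rule exp_le)
    also have "\<dots> \<le> real N" using that by simp
    finally show ?thesis using that by (simp add: ln_ge_iff)
  qed
  have nb: "real (Suc (n N)) \<le> n1 * ln (real N)" if N: "3 \<le> N" for N
  proof -
    have "1 + R * real N \<le> (1 + R) * real N" using N by (simp add: algebra_simps)
    then have "ln (1 + R * real N) \<le> ln ((1 + R) * real N)" using R0 N by (intro ln_mono) (auto intro: add_pos_nonneg)
    also have "\<dots> = ln (1 + R) + ln (real N)" using R0 N by (subst ln_mult) auto
    also have "\<dots> \<le> (ln (1 + R) + 1) * ln (real N)"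
      using L[OF N] R0 mult_left_mono[of 1 "ln (real N)" "ln (1 + R)"] by (simp add: algebra_simps)
    finally have "log 2 (1 + R * real N) \<le> (ln (1 + R) + 1) / ln 2 * ln (real N)"
      unfolding log_def by (simp add: divide_right_mono field_simps)
    moreover have "0 \<le> log 2 (1 + R * real N)"
      using R0 by (subst zero_le_log_cancel_iff) (auto intro: add_pos_nonneg)
    then have "real (n N) \<le> log 2 (1 + R * real N) + 1" unfolding n_def by linarith
    ultimately show ?thesis using L[OF N] by (simp add: n1_def algebra_simps)
  qed
  have n2: "R / 10 / 2 ^ n N \<le> 1 / (2 * real N)" if N: "3 \<le> N" for N
  proof -
    have "1 + R * real N = 2 powr (log 2 (1 + R * real N))" using R0 by (subst powr_log_cancel) (auto intro: add_pos_nonneg)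
    also have "\<dots> \<le> 2 powr real (n N)" unfolding n_def by (intro powr_mono real_nat_ceiling_ge) auto
    also have "\<dots> = 2 ^ n N" by (simp add: powr_realpow)
    finally have "R * real N \<le> 2 ^ n N" by simp
    moreover have "0 \<le> R * real N" using R0 by simp
    ultimately have "R * (2 * real N) \<le> 10 * 2 ^ n N" by linarith
    then show ?thesis using N by (simp add: field_simps)
  qed
  have kb: "real (k N) \<le> k1 * ln (real N)" if N: "3 \<le> N" for N
  proof -
    have "ln (2 * real N) = ln 2 + ln (real N)" using N by (simp add: ln_mult)
    also have "\<dots> \<le> (ln 2 + 1) * ln (real N)" using L[OF N] mult_left_mono[of 1 "ln (real N)" "ln 2"] by (simp add: algebra_simps)
    finally have "ln (2 * real N) / e \<le> (ln 2 + 1) / e * ln (real N)" using e0 by (simp add: divide_right_mono field_simps)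
    moreover have "0 \<le> ln (2 * real N) / e" using e0 N by simp
    then have "real (k N) \<le> ln (2 * real N) / e + 1" unfolding k_def by linarith
    ultimately show ?thesis using L[OF N] by (simp add: k1_def algebra_simps)
  qed
  have k2: "2 * real N * cmod \<tau> ^ k N \<le> 1" if N: "3 \<le> N" for N
  proof -
    have "ln (2 * real N) / e \<le> real (k N)" unfolding k_def by (rule real_nat_ceiling_ge)
    then have "ln (2 * real N) \<le> real (k N) * e" using e0 by (simp add: pos_divide_le_eq)
    then have "exp (ln (2 * real N)) \<le> exp (real (k N) * e)" by simp
    also have "\<dots> = exp e ^ k N" by (simp add: exp_of_nat_mult)
    also have "exp e = 1 / cmod \<tau>" using t by (simp add: e_def exp_minus divide_inverse)
    finally show ?thesis using N t by (simp add: power_one_over pos_le_divide_eq)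
  qed
  have n10: "0 \<le> n1" and k10: "0 \<le> k1" using R0 e0 by (auto simp: n1_def k1_def)
  define d1 where "d1 = 20 * real M * R * (ln K + 1)"
  define t1 where "t1 = (e + 2 * pi) * (3 / (2 * R)) * d1 + 56 * (e + 2 * pi) * n1 * (ln K + 1) + (10 + 2 * ln K) / ln 2"
  define s1 where "s1 = k1 * (ln K + pi + 2 * d1 / (1 - sqrt (cmod \<tau>))) + 1"
  define c where "c = 4 * cmod a / (cmod a - cmod b) + 1"
  define C where "C = max 1 (max n1 (max (2 * s1 + 2 * (10 + c) * t1) (2 * cmod a * d1)))"
  have C: "0 < C" "n1 \<le> C" "2 * s1 + 2 * (10 + c) * t1 \<le> C" "2 * cmod a * d1 \<le> C" by (auto simp: C_def)
  have c0: "0 \<le> c" using ab by (simp add: c_def)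
  have main: "\<bar>real (eigenvalue_count X (Gamma_nbhd a b r \<gamma>)) - real N * (\<beta> - \<alpha>) / (2 * pi)\<bar> \<le> C * A * (1 / r + ln (real N))"
    if N: "3 \<le> N" and \<delta>: "0 \<le> \<delta>" and B: "0 \<le> B" and q: "\<forall>i<N. \<forall>j<N. cmod (q (i,j)) \<le> B"
      and small: "(real N)\<^sup>2 * \<delta> * B * (2 / (cmod a * (1 - cmod (b / a)) ^ 3)) \<le> 1 / 10"
      and tN: "cmod (b / a) ^ Suc N \<le> 1 / 5" and A: "1 \<le> A" and r: "0 < r"
      and low: "\<forall>x\<in>test_points (b / a) \<alpha> \<beta> M (n N). cmod a ^ N * exp (- A) \<le> cmod (det (resolvent_mat a b N \<delta> q (a * x + b / x)))"
      and X: "X \<in> carrier_mat N N" and cp: "\<forall>z. poly (char_poly X) z = det (resolvent_mat a b N \<delta> q z)"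
    for N \<delta> B q A r X
  proof -
    obtain l where l: "char_poly X = (\<Prod>i<N. [:- l i, 1:])" using char_poly_enumeration[OF X] by blast
    obtain \<zeta> where \<zeta>: "\<And>i. cmod (b / a) \<le> (cmod (\<zeta> i))\<^sup>2" "\<And>i. a * \<zeta> i + b / \<zeta> i = l i"
      using joukowski_root[OF a0, of "l _"] by metis
    have dt: "det (resolvent_mat a b N \<delta> q (a * x + b / x)) = (\<Prod>i<N. (a * x + b / x) - (a * \<zeta> i + b / \<zeta> i))" for x
    proof -
      have "det (resolvent_mat a b N \<delta> q (a * x + b / x)) = poly (\<Prod>i<N. [:- l i, 1:]) (a * x + b / x)"
        using cp l by simp
      also have "\<dots> = (\<Prod>i<N. (a * x + b / x) - l i)" by (simp add: poly_prod)
      finally show ?thesis by (simp add: \<zeta>(2))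
    qed
    have N0: "0 < N" using N by simp
    have q': "\<And>i j. i < N \<Longrightarrow> j < N \<Longrightarrow> cmod (q (i,j)) \<le> B" using q by blast
    interpret circle_zeros "b / a" N \<zeta> "4 / (1 - cmod (b / a))"
      by (rule circle_zeros_of_matrix(1)[OF ab N0 \<delta> B q' small tN \<zeta>(1) dt])
    have detG: "det (resolvent_mat a b N \<delta> q (a * x + b / x)) = a ^ N * G x" if "x \<noteq> 0" for x
      unfolding G_def by (rule circle_zeros_of_matrix(2)[OF ab N0 \<delta> B q' small tN \<zeta>(1) dt that])
    have ee: "ell = e" "rad = R" by (simp_all add: ell_def rad_def e_def R_def \<tau>_def)
    have lowG: "exp (- A) \<le> cmod (G x)" if x: "x \<in> test_points (b / a) \<alpha> \<beta> M (n N)" for x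
    proof -
      have "0 < sqrt (cmod (b / a))" using t by (simp add: \<tau>_def)
      then have "x \<noteq> 0" using norm_test_points(1)[OF _ _ x] t by (auto simp: \<tau>_def)
      then have "cmod a ^ N * exp (- A) \<le> cmod a ^ N * cmod (G x)"
        using low[rule_format, OF x] unfolding detG[OF \<open>x \<noteq> 0\<close>] by (simp add: norm_mult norm_power)
      then show ?thesis using a0 by (simp add: mult_le_cancel_left_pos)
    qed
    have N1: "1 \<le> N" using N by simp
    note S = sums_of_test_points[OF N1 M(1) _ A L[OF N] _ nb[OF N] n10 _ kb[OF N] k10 lowG, unfolded ee, OF M(2) n2[OF N] k2[OF N, unfolded \<tau>_def],
        folded \<tau>_def, folded K_def, folded d1_def, folded t1_def s1_def]
    define AL where "AL = A * ln (real N)"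
    have AL: "0 \<le> AL" using A L[OF N] by (simp add: AL_def)
    have "\<bar>real (eigenvalue_count X (Gamma_nbhd a b r \<gamma>)) - real N * (\<beta> - \<alpha>) / (2 * pi)\<bar>
      \<le> cmod (log_sum (exp (\<i> * of_real \<alpha>))) + cmod (log_sum (exp (\<i> * of_real \<beta>)))
      + (10 + c) * ((\<Sum>i<N. tilt \<alpha> i) + (\<Sum>i<N. tilt \<beta> i)) + 2 * cmod a / r * (\<Sum>i<N. depth i)"
      using Gamma_count[OF refl ab \<gamma> r] by (simp only: eigenvalue_count_eq_card[OF X l] \<zeta>(2) c_def)
    also have "\<dots> \<le> s1 * AL + s1 * AL + (10 + c) * (t1 * AL + t1 * AL) + 2 * cmod a / r * (d1 * A)"
      using S c0 r by (intro add_mono mult_left_mono) (auto simp: AL_def)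
    also have "\<dots> = (2 * s1 + 2 * (10 + c) * t1) * AL + (2 * cmod a * d1) * (A / r)" by (simp add: algebra_simps)
    also have "\<dots> \<le> C * AL + C * (A / r)"
      using C AL A r by (intro add_mono mult_right_mono) auto
    also have "\<dots> = C * A * (1 / r + ln (real N))" by (simp add: AL_def algebra_simps)
    finally show ?thesis .
  qed
  have "real (Suc (n N)) \<le> C * ln (real N)" if "3 \<le> N" for N
  proof -
    have "n1 * ln (real N) \<le> C * ln (real N)" using C(2) L[OF that] by (intro mult_right_mono) auto
    then show ?thesis using nb[OF that] by linarith
  qed
  then show ?thesis using C(1) main by (intro exI[of _ C] exI[of _ M] exI[of _ n]) auto
qed

section \<open>Measurability of the eigenvalue count\<close>

lemma measurable_det:
  fixes A :: "'w \<Rightarrow> complex mat"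
  assumes c: "\<And>\<omega>. A \<omega> \<in> carrier_mat n n"
    and m: "\<And>i j. i < n \<Longrightarrow> j < n \<Longrightarrow> (\<lambda>\<omega>. A \<omega> $$ (i,j)) \<in> borel_measurable M"
  shows "(\<lambda>\<omega>. det (A \<omega>)) \<in> borel_measurable M"
proof -
  have "(\<lambda>\<omega>. \<Sum>p\<in>{p. p permutes {0..<n}}. signof p * (\<Prod>i = 0..<n. A \<omega> $$ (i, p i))) \<in> borel_measurable M"
  proof (intro borel_measurable_sum borel_measurable_times borel_measurable_prod borel_measurable_const m)
    fix p i assume "p \<in> {p. p permutes {0..<n}}" "i \<in> {0..<n}"
    then show "i < n" "p i < n" using permutes_in_image[of p "{0..<n}" i] by auto
  qed
  then show ?thesis by (simp add: det_def'[OF c])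
qed

lemma measurable_det_resolvent:
  assumes "\<And>i j. i < N \<Longrightarrow> j < N \<Longrightarrow> (\<lambda>\<omega>. q \<omega> (i,j)) \<in> borel_measurable M"
  shows "(\<lambda>\<omega>. det (resolvent_mat a b N \<delta> (q \<omega>) z)) \<in> borel_measurable M"
proof (rule measurable_det[where n = N])
  fix i j assume ij: "i < N" "j < N"
  then have "(\<lambda>\<omega>. resolvent_mat a b N \<delta> (q \<omega>) z $$ (i,j)) = (\<lambda>\<omega>. tridiag z a b N $$ (i,j) - complex_of_real \<delta> * q \<omega> (i,j))"
    by (auto simp: resolvent_mat_def tridiag_def)
  then show "(\<lambda>\<omega>. resolvent_mat a b N \<delta> (q \<omega>) z $$ (i,j)) \<in> borel_measurable M"
    using assms[OF ij] by simp
qed simp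

text \<open>Equality of the two distances is a closed condition, and the strict bound by r is a
  countable union of closed ones; balls make the pieces compact.\<close>

lemma Gamma_nbhd_compact_union:
  assumes "\<gamma> \<noteq> {}"
  shows "\<exists>K::nat \<Rightarrow> complex set. (\<forall>n. compact (K n)) \<and> incseq K \<and> (\<Union>n. K n) = Gamma_nbhd a b r \<gamma>"
proof (intro exI conjI allI)
  define K where "K = (\<lambda>n::nat. {z. infdist z (ellipse_E1 a b) = infdist z \<gamma>} \<inter> {z. infdist z \<gamma> \<le> r - 1 / real (Suc n)} \<inter> cball 0 (real n))"
  show "compact (K n)" for n
    unfolding K_def
    by (intro closed_Int_compact closed_Int closed_Collect_eq closed_Collect_le continuous_intros compact_cball)
  show "incseq K"
  proof (rule incseq_SucI)
    fix n
    have "1 / real (Suc (Suc n)) \<le> 1 / real (Suc n)" by (simp add: frac_le)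
    then show "K n \<subseteq> K (Suc n)" unfolding K_def by auto
  qed
  show "(\<Union>n. K n) = Gamma_nbhd a b r \<gamma>"
  proof
    show "(\<Union>n. K n) \<subseteq> Gamma_nbhd a b r \<gamma>"
    proof
      fix z assume "z \<in> (\<Union>n. K n)"
      then obtain n where "infdist z (ellipse_E1 a b) = infdist z \<gamma>" "infdist z \<gamma> \<le> r - 1 / real (Suc n)"
        unfolding K_def by blast
      moreover have "0 < 1 / real (Suc n)" by simp
      ultimately show "z \<in> Gamma_nbhd a b r \<gamma>" unfolding Gamma_nbhd_def mem_Collect_eq by linarith
    qed
    show "Gamma_nbhd a b r \<gamma> \<subseteq> (\<Union>n. K n)"
    proof
      fix z assume z: "z \<in> Gamma_nbhd a b r \<gamma>"
      then have "0 < r - infdist z \<gamma>" by (simp add: Gamma_nbhd_def)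
      then obtain n1 where n1: "1 / real (Suc n1) < r - infdist z \<gamma>" using nat_approx_posE by (metis of_nat_Suc)
      obtain n2 where n2: "cmod z \<le> real n2" using real_arch_simple by blast
      define n where "n = max n1 n2"
      have "1 / real (Suc n) \<le> 1 / real (Suc n1)" by (intro divide_left_mono) (auto simp: n_def)
      then have "infdist z \<gamma> \<le> r - 1 / real (Suc n)" using n1 by linarith
      moreover have "cmod z \<le> real n" using n2 by (simp add: n_def)
      ultimately have "z \<in> K n" using z by (simp add: K_def Gamma_nbhd_def)
      then show "z \<in> (\<Union>n. K n)" by blast
    qed
  qed
qed

lemma compact_PiE_UNIV:
  fixes S :: "nat \<Rightarrow> complex set"
  assumes "\<And>i. compact (S i)"
  shows "compact (PiE UNIV S)"
proof -
  have "compactin (product_topology (\<lambda>i::nat. euclidean :: complex topology) UNIV) (PiE UNIV S)"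
    using assms by (subst compactin_PiE) (auto simp: compactin_euclidean_iff)
  then show ?thesis by (simp add: euclidean_product_topology compactin_euclidean_iff)
qed

text \<open>Encodes a monic polynomial with root list \<open>l\<close> by its values at the natural
  numbers, which determine it. Polynomials thus live in a product space, where continuity and
  measurability can be checked coordinatewise.\<close>

definition root_values :: "nat \<Rightarrow> (nat \<Rightarrow> complex) \<Rightarrow> nat \<Rightarrow> complex" where
  "root_values N l t = (\<Prod>i<N. of_nat t - l i)"

lemma continuous_on_root_values: "continuous_on S (root_values N)"
proof (rule continuous_on_coordinatewise_then_product)
  fix t
  show "continuous_on S (\<lambda>l. root_values N l t)"
    unfolding root_values_def
    by (intro continuous_intros continuous_on_product_coordinates[THEN continuous_on_subset]) auto
qed

lemma poly_eq_of_nat_eqI: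
  fixes p q :: "complex poly"
  assumes "\<And>t::nat. poly p (of_nat t) = poly q (of_nat t)"
  shows "p = q"
proof (rule ccontr)
  assume "p \<noteq> q"
  then have "finite {x. poly (p - q) x = 0}" by (intro poly_roots_finite) simp
  moreover have "range (of_nat :: nat \<Rightarrow> complex) \<subseteq> {x. poly (p - q) x = 0}" using assms by auto
  ultimately have "finite (range (of_nat :: nat \<Rightarrow> complex))" by (rule rev_finite_subset)
  moreover have "inj (of_nat :: nat \<Rightarrow> complex)" by (rule injI) simp
  ultimately show False using range_inj_infinite by blast
qed

text \<open>There are at least m eigenvalues in S exactly when the roots can be listed with the
  first m in S. For each n the bounded lists with these entries in \<open>K n\<close> form a compact
  set; coordinates from N on are frozen at 0 so that the infinite product stays compact.\<close>

lemma eigenvalue_count_ge_iff: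
  fixes X :: "complex mat"
  assumes X: "X \<in> carrier_mat N N" and m: "m \<le> N"
    and K: "incseq K" "(\<Union>n. K n) = S"
  shows "m \<le> eigenvalue_count X S \<longleftrightarrow>
    (\<lambda>t. poly (char_poly X) (of_nat t)) \<in> (\<Union>n. root_values N ` PiE UNIV (\<lambda>i. if i < m then K n else if i < N then cball 0 (real n) else {0}))"
proof
  assume "(\<lambda>t. poly (char_poly X) (of_nat t)) \<in> (\<Union>n. root_values N ` PiE UNIV (\<lambda>i. if i < m then K n else if i < N then cball 0 (real n) else {0}))"
  then obtain n l where l: "l \<in> PiE UNIV (\<lambda>i. if i < m then K n else if i < N then cball 0 (real n) else {0})"
    "(\<lambda>t. poly (char_poly X) (of_nat t)) = root_values N l" by blast
  have "char_poly X = (\<Prod>i<N. [:- l i, 1:])"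
    by (rule poly_eq_of_nat_eqI) (use l(2) in \<open>auto simp: fun_eq_iff root_values_def poly_prod\<close>)
  then have "eigenvalue_count X S = card {i. i < N \<and> l i \<in> S}" by (rule eigenvalue_count_eq_card[OF X])
  moreover have "l i \<in> S" if "i < m" for i
  proof -
    have "l i \<in> K n" using PiE_mem[OF l(1), of i] that by simp
    then show ?thesis using K(2) by blast
  qed
  then have "{..<m} \<subseteq> {i. i < N \<and> l i \<in> S}" using m by auto
  then have "card {..<m} \<le> card {i. i < N \<and> l i \<in> S}" by (intro card_mono) auto
  ultimately show "m \<le> eigenvalue_count X S" by simp
next
  assume ge: "m \<le> eigenvalue_count X S"
  obtain as where as: "char_poly X = (\<Prod>a\<leftarrow>as. [:- a, 1:])" "length as = N"
    using char_poly_factorized[OF X] by blast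
  \<comment> \<open>The same roots with those in S listed first; the polynomial depends only on the
    multiset.\<close>
  define bs where "bs = filter (\<lambda>z. z \<in> S) as @ filter (\<lambda>z. z \<notin> S) as"
  have "mset bs = mset as" using multiset_partition[of "mset as" "\<lambda>z. z \<in> S"] by (simp add: bs_def)
  then have lb: "length bs = N" and pb: "char_poly X = (\<Prod>a\<leftarrow>bs. [:- a, 1:])"
    using as mset_eq_length[of bs as] by (simp_all only: prod_mset_prod_list[symmetric] mset_map)
  define l where "l = (\<lambda>i. if i < N then bs ! i else 0)"
  have cp: "char_poly X = (\<Prod>i<N. [:- l i, 1:])"
    unfolding pb using lb by (simp add: prod.list_conv_set_nth atLeast0LessThan l_def)
  have "eigenvalue_count X S = card {i. i < N \<and> l i \<in> S}" by (rule eigenvalue_count_eq_card[OF X cp])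
  also have "{i. i < N \<and> l i \<in> S} = {i. i < length bs \<and> bs ! i \<in> S}" by (auto simp: l_def lb)
  also have "card \<dots> = length (filter (\<lambda>z. z \<in> S) bs)" by (simp add: length_filter_conv_card)
  also have "\<dots> = length (filter (\<lambda>z. z \<in> S) as)" by (simp add: bs_def)
  finally have mle: "m \<le> length (filter (\<lambda>z. z \<in> S) as)" using ge by simp
  have lS: "l i \<in> S" if "i < m" for i
  proof -
    have i: "i < length (filter (\<lambda>z. z \<in> S) as)" using that mle by simp
    then have "l i = filter (\<lambda>z. z \<in> S) as ! i" using that m by (simp add: l_def bs_def nth_append)
    moreover have "filter (\<lambda>z. z \<in> S) as ! i \<in> set (filter (\<lambda>z. z \<in> S) as)" using i by (rule nth_mem)
    ultimately show ?thesis by auto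
  qed
  have "\<forall>i. \<exists>n. i < m \<longrightarrow> l i \<in> K n" using lS K(2) by blast
  then obtain f where f: "\<And>i. i < m \<Longrightarrow> l i \<in> K (f i)" by metis
  have "\<forall>i. \<exists>n::nat. cmod (l i) \<le> real n" using real_arch_simple by blast
  then obtain g where g: "\<And>i. cmod (l i) \<le> real (g i)" by metis
  define n where "n = Max (insert 0 (f ` {..<m} \<union> g ` {..<N}))"
  have fn: "f i \<le> n" if "i < m" for i unfolding n_def using that by (intro Max_ge) auto
  have gn: "g i \<le> n" if "i < N" for i unfolding n_def using that by (intro Max_ge) auto
  have "l \<in> PiE UNIV (\<lambda>i. if i < m then K n else if i < N then cball 0 (real n) else {0})"
  proof (intro PiE_I)
    fix i
    consider "i < m" | "\<not> i < m" "i < N" | "\<not> i < m" "\<not> i < N" by blast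
    then show "l i \<in> (if i < m then K n else if i < N then cball 0 (real n) else {0})"
    proof cases
      case 1
      then show ?thesis using f[OF 1] incseqD[OF K(1) fn[OF 1]] by auto
    next
      case 2
      have "cmod (l i) \<le> real n" using g[of i] gn[OF 2(2)] by linarith
      then show ?thesis using 2 by simp
    next
      case 3
      then show ?thesis by (simp add: l_def)
    qed
  qed simp
  moreover have "(\<lambda>t. poly (char_poly X) (of_nat t)) = root_values N l"
    by (simp add: fun_eq_iff root_values_def cp poly_prod)
  ultimately show "(\<lambda>t. poly (char_poly X) (of_nat t)) \<in> (\<Union>n. root_values N ` PiE UNIV (\<lambda>i. if i < m then K n else if i < N then cball 0 (real n) else {0}))"
    by blast
qed

text \<open>Measurability is a real obligation, since \<open>measure\<close> is 0 on sets that are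
  not measurable. No measurable choice of eigenvalues is made: the event that the count is at least
  m is the preimage of a sigma-compact set of polynomials.\<close>

lemma measurable_eigenvalue_count:
  fixes X :: "'w \<Rightarrow> complex mat"
  assumes X: "\<And>\<omega>. X \<omega> \<in> carrier_mat N N"
    and meas: "\<And>z. (\<lambda>\<omega>. poly (char_poly (X \<omega>)) z) \<in> borel_measurable M"
    and g0: "\<gamma> \<noteq> {}"
  shows "(\<lambda>\<omega>. eigenvalue_count (X \<omega>) (Gamma_nbhd a b r \<gamma>)) \<in> measurable M (count_space UNIV)"
proof -
  let ?G = "Gamma_nbhd a b r \<gamma>"
  from Gamma_nbhd_compact_union[OF g0, of a b r] obtain K :: "nat \<Rightarrow> complex set"
    where K: "\<forall>n. compact (K n)" "incseq K" "(\<Union>n. K n) = ?G"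
    by (elim exE conjE)
  define P where "P = (\<lambda>m n. PiE UNIV (\<lambda>i. if i < m then K n else if i < N then cball 0 (real n) else {0}))"
  have meas': "(\<lambda>\<omega> t. poly (char_poly (X \<omega>)) (of_nat t)) \<in> borel_measurable M"
    by (rule measurable_coordinatewise_then_product) (rule meas)
  have ge: "{\<omega> \<in> space M. m \<le> eigenvalue_count (X \<omega>) ?G} \<in> sets M" for m
  proof (cases "m \<le> N")
    case True
    have "compact (P m n)" for n unfolding P_def by (rule compact_PiE_UNIV) (simp add: K(1))
    then have "compact (root_values N ` P m n)" for n by (intro compact_continuous_image continuous_on_root_values)
    moreover define U where "U = (\<Union>n. root_values N ` P m n)"
    ultimately have "U \<in> sets borel" unfolding U_def by (intro sets.countable_UN) (auto intro: borel_compact)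
    then have "(\<lambda>\<omega> t. poly (char_poly (X \<omega>)) (of_nat t)) -` U \<inter> space M \<in> sets M"
      by (rule measurable_sets[OF meas'])
    also have "m \<le> eigenvalue_count (X \<omega>) ?G \<longleftrightarrow> (\<lambda>t. poly (char_poly (X \<omega>)) (of_nat t)) \<in> U" for \<omega>
      unfolding U_def P_def by (rule eigenvalue_count_ge_iff[OF X True K(2,3)])
    then have "(\<lambda>\<omega> t. poly (char_poly (X \<omega>)) (of_nat t)) -` U \<inter> space M
      = {\<omega> \<in> space M. m \<le> eigenvalue_count (X \<omega>) ?G}"
      by auto
    finally show ?thesis .
  next
    case False
    have "eigenvalue_count (X \<omega>) ?G \<le> N" for \<omega>
    proof -
      obtain l where "char_poly (X \<omega>) = (\<Prod>i<N. [:- l i, 1:])" using char_poly_enumeration[OF X] by blast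
      then have "eigenvalue_count (X \<omega>) ?G = card {i. i < N \<and> l i \<in> ?G}" by (rule eigenvalue_count_eq_card[OF X])
      also have "\<dots> \<le> card {..<N}" by (intro card_mono) auto
      finally show ?thesis by simp
    qed
    then have "\<not> m \<le> eigenvalue_count (X \<omega>) ?G" for \<omega> using False le_trans by blast
    then show ?thesis by simp
  qed
  have "{\<omega> \<in> space M. eigenvalue_count (X \<omega>) ?G = m} \<in> sets M" for m
  proof -
    have "{\<omega> \<in> space M. eigenvalue_count (X \<omega>) ?G = m} =
      {\<omega> \<in> space M. m \<le> eigenvalue_count (X \<omega>) ?G} - {\<omega> \<in> space M. Suc m \<le> eigenvalue_count (X \<omega>) ?G}" by auto
    then show ?thesis using ge by auto
  qed
  then show ?thesis
    by (subst measurable_count_space_eq2_countable) (auto simp: vimage_def Int_def conj_commute)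
qed

section \<open>Gaussian estimates\<close>

definition gaussian_density :: "complex \<Rightarrow> ennreal" where
  "gaussian_density z = ennreal (exp (- (cmod z)\<^sup>2) / pi)"

lemma gaussian_density_measurable [measurable]: "gaussian_density \<in> borel_measurable borel"
  unfolding gaussian_density_def by measurable

lemma (in prob_space) gaussian_total:
  assumes "distributed M lborel X gaussian_density"
  shows "(\<integral>\<^sup>+z. gaussian_density z \<partial>lborel) = 1"
proof -
  have X: "X \<in> measurable M lborel" using assms by (rule distributed_measurable)
  have "emeasure M (X -` UNIV \<inter> space M) = (\<integral>\<^sup>+z. gaussian_density z * indicator UNIV z \<partial>lborel)"
    by (rule distributed_emeasure[OF assms]) simp
  then show ?thesis by (simp add: emeasure_space_1)
qed

text \<open>Markov's inequality for exp (|X|^2/2). Its expectation is 2: the scaling z -> sqrt 2 z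
  of the plane has Jacobian 2 and reduces the integral to the total mass of the density.\<close>

lemma (in prob_space) gaussian_tail:
  assumes D: "distributed M lborel X gaussian_density" and t: "0 \<le> t"
  shows "emeasure M {\<omega> \<in> space M. t < cmod (X \<omega>)} \<le> ennreal (2 * exp (- t\<^sup>2 / 2))"
proof -
  have X[measurable]: "X \<in> borel_measurable M" using distributed_measurable[OF D] by simp
  define u where "u = (\<lambda>z::complex. ennreal (exp ((cmod z)\<^sup>2 / 2)))"
  have [measurable]: "u \<in> borel_measurable borel" unfolding u_def by measurable
  have "(\<integral>\<^sup>+\<omega>. u (X \<omega>) \<partial>M) = (\<integral>\<^sup>+z. gaussian_density z * u z \<partial>lborel)"
    by (rule distributed_nn_integral[OF D, symmetric]) simp
  also have "\<dots> = (\<integral>\<^sup>+z. ennreal (exp (- (cmod z)\<^sup>2 / 2) / pi) \<partial>lborel)"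
  proof (intro nn_integral_cong)
    fix z :: complex
    have "gaussian_density z * u z = ennreal (exp (- (cmod z)\<^sup>2) / pi * exp ((cmod z)\<^sup>2 / 2))"
      unfolding gaussian_density_def u_def by (rule ennreal_mult[symmetric]) auto
    also have "exp (- (cmod z)\<^sup>2) / pi * exp ((cmod z)\<^sup>2 / 2) = exp (- (cmod z)\<^sup>2 / 2) / pi"
      by (simp add: exp_add[symmetric] field_simps)
    finally show "gaussian_density z * u z = ennreal (exp (- (cmod z)\<^sup>2 / 2) / pi)" .
  qed
  also have "\<dots> = 2"
  proof -
    have "(lborel :: complex measure) = density (distr lborel borel (\<lambda>x. 0 + sqrt 2 *\<^sub>R x)) (\<lambda>_. \<bar>sqrt 2\<bar> ^ DIM(complex))"
      by (rule lborel_affine) simp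
    then have "(\<integral>\<^sup>+z. ennreal (exp (- (cmod z)\<^sup>2 / 2) / pi) \<partial>lborel) =
      (\<integral>\<^sup>+z. ennreal (exp (- (cmod z)\<^sup>2 / 2) / pi) \<partial>(density (distr lborel borel (\<lambda>x. 0 + sqrt 2 *\<^sub>R x)) (\<lambda>_. \<bar>sqrt 2\<bar> ^ DIM(complex))))"
      by (rule arg_cong)
    also have "\<dots> = (\<integral>\<^sup>+z. ennreal 2 * ennreal (exp (- (cmod (sqrt 2 *\<^sub>R z))\<^sup>2 / 2) / pi) \<partial>lborel)"
      by (subst nn_integral_density) (auto simp: nn_integral_distr)
    also have "\<dots> = ennreal 2 * (\<integral>\<^sup>+z. gaussian_density z \<partial>lborel)"
      by (subst nn_integral_cmult[symmetric]) (auto intro!: nn_integral_cong simp: gaussian_density_def power_mult_distrib)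
    finally show ?thesis by (simp add: gaussian_total[OF D])
  qed
  finally have int: "(\<integral>\<^sup>+\<omega>. u (X \<omega>) \<partial>M) = 2" .
  have "{\<omega> \<in> space M. t < cmod (X \<omega>)} \<subseteq> {\<omega> \<in> space M. 1 \<le> ennreal (exp (- t\<^sup>2 / 2)) * u (X \<omega>)}"
  proof safe
    fix \<omega> assume "t < cmod (X \<omega>)"
    then have "t\<^sup>2 \<le> (cmod (X \<omega>))\<^sup>2" using t by (intro power_mono) auto
    then have "1 \<le> exp (- t\<^sup>2 / 2 + (cmod (X \<omega>))\<^sup>2 / 2)" by simp
    then have "ennreal 1 \<le> ennreal (exp (- t\<^sup>2 / 2) * exp ((cmod (X \<omega>))\<^sup>2 / 2))" unfolding exp_add by (rule ennreal_leI)
    then show "1 \<le> ennreal (exp (- t\<^sup>2 / 2)) * u (X \<omega>)" by (simp add: u_def ennreal_mult)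
  qed
  then have "emeasure M {\<omega> \<in> space M. t < cmod (X \<omega>)} \<le> emeasure M {\<omega> \<in> space M. 1 \<le> ennreal (exp (- t\<^sup>2 / 2)) * u (X \<omega>)}"
    by (intro emeasure_mono) auto
  also have "\<dots> \<le> ennreal (exp (- t\<^sup>2 / 2)) * (\<integral>\<^sup>+\<omega>. u (X \<omega>) * indicator (space M) \<omega> \<partial>M)"
    by (intro nn_integral_Markov_inequality) auto
  also have "(\<integral>\<^sup>+\<omega>. u (X \<omega>) * indicator (space M) \<omega> \<partial>M) = (\<integral>\<^sup>+\<omega>. u (X \<omega>) \<partial>M)"
    by (intro nn_integral_cong) auto
  also have "ennreal (exp (- t\<^sup>2 / 2)) * (\<integral>\<^sup>+\<omega>. u (X \<omega>) \<partial>M) = ennreal (2 * exp (- t\<^sup>2 / 2))"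
    unfolding int by (simp add: ennreal_mult mult.commute)
  finally show ?thesis .
qed

text \<open>The density is at most 1/pi and the disc has area pi rho^2.\<close>

lemma (in prob_space) gaussian_cball:
  assumes D: "distributed M lborel X gaussian_density" and \<rho>: "0 \<le> \<rho>"
  shows "emeasure (distr M borel X) (cball c \<rho>) \<le> ennreal (\<rho>\<^sup>2)"
proof -
  have X[measurable]: "X \<in> borel_measurable M" using distributed_measurable[OF D] by simp
  have "emeasure (distr M borel X) (cball c \<rho>) = emeasure M (X -` cball c \<rho> \<inter> space M)"
    by (rule emeasure_distr) auto
  also have "\<dots> = (\<integral>\<^sup>+z. gaussian_density z * indicator (cball c \<rho>) z \<partial>lborel)"
    by (rule distributed_emeasure[OF D]) simp
  also have "\<dots> \<le> (\<integral>\<^sup>+z. ennreal (1 / pi) * indicator (cball c \<rho>) z \<partial>lborel)"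
    by (intro nn_integral_mono mult_right_mono) (auto simp: gaussian_density_def intro!: ennreal_leI divide_right_mono)
  also have "\<dots> = ennreal (1 / pi) * emeasure lborel (cball c \<rho>)" by (simp add: nn_integral_cmult_indicator)
  also have "\<dots> = ennreal (1 / pi) * ennreal (pi * \<rho>\<^sup>2)" using \<rho> by (simp add: emeasure_cball unit_ball_vol_2)
  also have "\<dots> = ennreal (\<rho>\<^sup>2)" by (subst ennreal_mult[symmetric]) auto
  finally show ?thesis .
qed

text \<open>Fubini over \<open>Y\<close>: for a fixed value with slope at least
  \<open>\<beta>\<close>, the event confines the Gaussian variable to a disc of radius rho/beta. The
  form \<open>h (Z \<omega>)\<close> is needed because independence of subfamilies delivers
  \<open>Z\<close> as a function on an index set.\<close>

lemma (in prob_space) affine_anticoncentration: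
  assumes ind: "indep_var S Z N' Y" and h[measurable]: "h \<in> borel_measurable S"
    and D: "distributed M lborel (\<lambda>\<omega>. h (Z \<omega>)) gaussian_density"
    and u[measurable]: "u \<in> borel_measurable N'" and v[measurable]: "v \<in> borel_measurable N'"
    and \<beta>: "0 < \<beta>" and \<rho>: "0 \<le> \<rho>"
  shows "emeasure M {\<omega> \<in> space M. \<beta> \<le> cmod (v (Y \<omega>)) \<and> cmod (u (Y \<omega>) + v (Y \<omega>) * h (Z \<omega>)) \<le> \<rho>} \<le> ennreal ((\<rho> / \<beta>)\<^sup>2)"
proof -
  have rv[measurable]: "random_variable S Z" "random_variable N' Y"
    and eq: "distr M S Z \<Otimes>\<^sub>M distr M N' Y = distr M (S \<Otimes>\<^sub>M N') (\<lambda>x. (Z x, Y x))"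
    using ind unfolding indep_var_distribution_eq by auto
  interpret Z: prob_space "distr M S Z" by (rule prob_space_distr) fact
  interpret Y: prob_space "distr M N' Y" by (rule prob_space_distr) fact
  interpret ZY: pair_prob_space "distr M S Z" "distr M N' Y" ..
  define A where "A = {p \<in> space (S \<Otimes>\<^sub>M N'). \<beta> \<le> cmod (v (snd p)) \<and> cmod (u (snd p) + v (snd p) * h (fst p)) \<le> \<rho>}"
  have A[measurable]: "A \<in> sets (S \<Otimes>\<^sub>M N')" unfolding A_def by measurable
  have "emeasure M {\<omega> \<in> space M. \<beta> \<le> cmod (v (Y \<omega>)) \<and> cmod (u (Y \<omega>) + v (Y \<omega>) * h (Z \<omega>)) \<le> \<rho>}
    = emeasure M ((\<lambda>x. (Z x, Y x)) -` A \<inter> space M)"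
    using measurable_space[OF rv(1)] measurable_space[OF rv(2)]
    by (intro arg_cong[of _ _ "emeasure M"]) (auto simp: A_def space_pair_measure)
  also have "\<dots> = emeasure (distr M (S \<Otimes>\<^sub>M N') (\<lambda>x. (Z x, Y x))) A"
    by (rule emeasure_distr[symmetric]) auto
  also have "\<dots> = emeasure (distr M S Z \<Otimes>\<^sub>M distr M N' Y) A" by (simp add: eq)
  also have "\<dots> = (\<integral>\<^sup>+y. emeasure (distr M S Z) ((\<lambda>x. (x, y)) -` A) \<partial>(distr M N' Y))"
    by (rule ZY.emeasure_pair_measure_alt2) (simp add: A)
  also have "\<dots> \<le> (\<integral>\<^sup>+y. ennreal ((\<rho> / \<beta>)\<^sup>2) \<partial>(distr M N' Y))"
  proof (intro nn_integral_mono)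
    fix y
    show "emeasure (distr M S Z) ((\<lambda>x. (x, y)) -` A) \<le> ennreal ((\<rho> / \<beta>)\<^sup>2)"
    proof (cases "\<beta> \<le> cmod (v y)")
      case True
      then have v0: "v y \<noteq> 0" using \<beta> by auto
      let ?D = "cball (- u y / v y) (\<rho> / \<beta>)"
      have "(\<lambda>x. (x, y)) -` A \<subseteq> h -` ?D \<inter> space S"
      proof
        fix x assume x: "x \<in> (\<lambda>x. (x, y)) -` A"
        then have "cmod (u y + v y * h x) \<le> \<rho>" by (simp add: A_def)
        moreover have "u y + v y * h x = v y * (h x - (- u y / v y))" using v0 by (simp add: field_simps)
        ultimately have "cmod (v y) * cmod (h x - (- u y / v y)) \<le> \<rho>" by (simp only: norm_mult)
        then have "\<beta> * cmod (h x - (- u y / v y)) \<le> \<rho>" using mult_right_mono[OF True norm_ge_zero[of "h x - (- u y / v y)"]] by linarith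
        then have "dist (- u y / v y) (h x) \<le> \<rho> / \<beta>"
          using \<beta> unfolding dist_norm norm_minus_commute[of "- u y / v y"] by (simp only: pos_le_divide_eq mult.commute)
        then show "x \<in> h -` ?D \<inter> space S" using x by (simp add: A_def space_pair_measure)
      qed
      then have "emeasure (distr M S Z) ((\<lambda>x. (x, y)) -` A) \<le> emeasure (distr M S Z) (h -` ?D \<inter> space S)"
        by (intro emeasure_mono) auto
      also have "\<dots> = emeasure (distr (distr M S Z) borel h) ?D" by (subst emeasure_distr) auto
      also have "distr (distr M S Z) borel h = distr M borel (\<lambda>\<omega>. h (Z \<omega>))" by (subst distr_distr) (auto simp: o_def)
      also have "emeasure (distr M borel (\<lambda>\<omega>. h (Z \<omega>))) ?D \<le> ennreal ((\<rho> / \<beta>)\<^sup>2)" using \<beta> \<rho> by (intro gaussian_cball D) auto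
      finally show ?thesis .
    next
      case False
      then have "(\<lambda>x. (x, y)) -` A = {}" by (auto simp: A_def)
      then show ?thesis by simp
    qed
  qed
  also have "\<dots> = ennreal ((\<rho> / \<beta>)\<^sup>2)" using Y.emeasure_space_1 by simp
  finally show ?thesis .
qed

section \<open>Probability of a small determinant and the union bound\<close>

text \<open>The determinant is affine in the corner entry, with coefficients depending on the other
  entries only; when these are at most B, the slope is at least delta |a|^(N - 1)/2. The square in
  the small ball estimate produces both 1/delta^2 and the factor 2 in the exponent.\<close>

lemma det_resolvent_lower_probability:
  assumes iid: "iid_complex_gaussian M N q" and N: "3 \<le> N" and a: "a \<noteq> 0"
    and x: "x \<noteq> 0" "cmod x \<le> 1" and t: "cmod (b / a / x) \<le> \<rho>" "\<rho> < 1"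
    and \<delta>: "0 < \<delta>" and B: "0 \<le> B"
    and small: "(real N)\<^sup>2 * \<delta> * B * (1 / (cmod a * (1 - \<rho>))) \<le> 1 / 4"
  shows "emeasure M {\<omega> \<in> space M. (\<forall>i<N. \<forall>j<N. cmod (q i j \<omega>) \<le> B) \<and>
      cmod (det (resolvent_mat a b N \<delta> (\<lambda>(j,k). q j k \<omega>) (a * x + b / x))) < cmod a ^ N * exp (- A)}
    \<le> ennreal ((2 * cmod a * exp (- A) / \<delta>)\<^sup>2)"
proof -
  define I where "I = {..<N} \<times> {..<N}"
  define p where "p = (N - 1, 0::nat)"
  define Q where "Q = (\<lambda>(j,k). q j k)"
  interpret prob_space M using iid by (simp add: iid_complex_gaussian_def)
  have ind: "indep_vars (\<lambda>_. borel) Q I" using iid by (simp add: iid_complex_gaussian_def Q_def I_def)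
  have pI: "p \<in> I" using N by (simp add: p_def I_def)
  have D: "distributed M lborel (Q p) gaussian_density"
    using iid N by (simp add: iid_complex_gaussian_def Q_def p_def gaussian_density_def[abs_def])
  define N' where "N' = PiM (I - {p}) (\<lambda>_. borel :: complex measure)"
  define Y where "Y = (\<lambda>\<omega>. restrict (\<lambda>i. Q i \<omega>) (I - {p}))"
  define Z where "Z = (\<lambda>\<omega>. restrict (\<lambda>i. Q i \<omega>) {p})"
  have indZY: "indep_var (PiM {p} (\<lambda>_. borel)) Z N' Y"
    unfolding N'_def Y_def Z_def using pI by (intro indep_var_restrict[OF ind]) auto
  have ZQ: "Z \<omega> p = Q p \<omega>" for \<omega> by (simp add: Z_def)
  define z where "z = a * x + b / x"
  \<comment> \<open>The coefficients are read off from the corner values 0 and 1, which makes their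
    measurability immediate.\<close>
  define u where "u = (\<lambda>y. det (resolvent_mat a b N \<delta> (y(p := 0)) z))"
  define v where "v = (\<lambda>y. det (resolvent_mat a b N \<delta> (y(p := 1)) z) - u y)"
  have comp: "(\<lambda>y. (y(p := w)) (i,j)) \<in> borel_measurable N'" if "i < N" "j < N" for i j w
  proof (cases "(i,j) = p")
    case False
    then have "(i,j) \<in> I - {p}" using that by (simp add: I_def)
    then have "(\<lambda>y. y (i,j)) \<in> borel_measurable N'" unfolding N'_def by measurable
    then show ?thesis using False by simp
  qed simp
  have um: "u \<in> borel_measurable N'" unfolding u_def by (rule measurable_det_resolvent) (rule comp)
  have vm: "v \<in> borel_measurable N'"
    unfolding v_def using um by (intro borel_measurable_diff measurable_det_resolvent comp) auto
  have aff: "det (resolvent_mat a b N \<delta> (y(p := w)) z) = u y + v y * w" and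
    vnorm: "cmod (v y) = \<delta> * cmod (det (resolvent_minor a b N \<delta> y z))" for y w
  proof -
    obtain \<sigma> c where \<sigma>: "cmod \<sigma> = 1" and
      c: "\<And>w. det (resolvent_mat a b N \<delta> (y(p := w)) z) = c + \<sigma> * complex_of_real \<delta> * w * det (resolvent_minor a b N \<delta> y z)"
      using det_resolvent_corner[OF N, of a b \<delta> y z] unfolding p_def by blast
    have "u y = c" "v y = \<sigma> * complex_of_real \<delta> * det (resolvent_minor a b N \<delta> y z)" by (simp_all add: u_def v_def c)
    then show "det (resolvent_mat a b N \<delta> (y(p := w)) z) = u y + v y * w"
      "cmod (v y) = \<delta> * cmod (det (resolvent_minor a b N \<delta> y z))"
      using \<sigma> \<delta> by (simp_all add: c norm_mult)
  qed
  \<comment> \<open>The restricted family carries no noise at the corner; the update puts it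
    back.\<close>
  have ext: "resolvent_mat a b N \<delta> (\<lambda>(j,k). q j k \<omega>) z = resolvent_mat a b N \<delta> ((Y \<omega>)(p := Q p \<omega>)) z" for \<omega>
    by (rule eq_matI) (auto simp: resolvent_mat_def tridiag_def Y_def Q_def I_def)
  define \<beta> where "\<beta> = \<delta> * (cmod a ^ (N - 1) / 2)"
  have b0: "0 < \<beta>" using \<delta> a by (simp add: \<beta>_def)
  have "{\<omega> \<in> space M. (\<forall>i<N. \<forall>j<N. cmod (q i j \<omega>) \<le> B) \<and>
      cmod (det (resolvent_mat a b N \<delta> (\<lambda>(j,k). q j k \<omega>) (a * x + b / x))) < cmod a ^ N * exp (- A)}
    \<subseteq> {\<omega> \<in> space M. \<beta> \<le> cmod (v (Y \<omega>)) \<and> cmod (u (Y \<omega>) + v (Y \<omega>) * Q p \<omega>) \<le> cmod a ^ N * exp (- A)}"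
  proof safe
    fix \<omega> assume \<omega>: "\<omega> \<in> space M" and q: "\<forall>i<N. \<forall>j<N. cmod (q i j \<omega>) \<le> B"
      and d: "cmod (det (resolvent_mat a b N \<delta> (\<lambda>(j,k). q j k \<omega>) (a * x + b / x))) < cmod a ^ N * exp (- A)"
    show "cmod (u (Y \<omega>) + v (Y \<omega>) * Q p \<omega>) \<le> cmod a ^ N * exp (- A)"
      using d by (simp add: z_def[symmetric] ext aff)
    have "cmod a ^ (N - 1) / 2 \<le> cmod (det (resolvent_minor a b N \<delta> (Y \<omega>) z))"
      unfolding z_def
    proof (rule norm_det_resolvent_minor_ge[OF a x(2,1) t _ B _ small])
      fix i j assume "i < N" "j < N" "(i, j) \<noteq> (N - 1, 0)"
      then show "cmod (Y \<omega> (i, j)) \<le> B" using q by (simp add: Y_def I_def p_def Q_def)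
    qed (use \<delta> in simp)
    then show "\<beta> \<le> cmod (v (Y \<omega>))" unfolding vnorm \<beta>_def using \<delta> by (intro mult_left_mono) auto
  qed
  then have "emeasure M {\<omega> \<in> space M. (\<forall>i<N. \<forall>j<N. cmod (q i j \<omega>) \<le> B) \<and>
      cmod (det (resolvent_mat a b N \<delta> (\<lambda>(j,k). q j k \<omega>) (a * x + b / x))) < cmod a ^ N * exp (- A)}
    \<le> emeasure M {\<omega> \<in> space M. \<beta> \<le> cmod (v (Y \<omega>)) \<and> cmod (u (Y \<omega>) + v (Y \<omega>) * Q p \<omega>) \<le> cmod a ^ N * exp (- A)}"
  proof (rule emeasure_mono)
    have [measurable]: "Y \<in> measurable M N'" "u \<in> borel_measurable N'" "v \<in> borel_measurable N'"
      using indZY um vm by (auto simp: indep_var_distribution_eq)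
    have [measurable]: "Q p \<in> borel_measurable M" using distributed_measurable[OF D] by simp
    show "{\<omega> \<in> space M. \<beta> \<le> cmod (v (Y \<omega>)) \<and> cmod (u (Y \<omega>) + v (Y \<omega>) * Q p \<omega>) \<le> cmod a ^ N * exp (- A)} \<in> sets M"
      by measurable
  qed
  also have "\<dots> \<le> ennreal ((cmod a ^ N * exp (- A) / \<beta>)\<^sup>2)"
    unfolding ZQ[symmetric]
    by (rule affine_anticoncentration[OF indZY _ _ um vm b0]) (use D in \<open>simp_all add: ZQ\<close>)
  also have "cmod a ^ N * exp (- A) / \<beta> = 2 * cmod a * exp (- A) / \<delta>"
  proof -
    have "cmod a ^ N = cmod a * cmod a ^ (N - 1)" using N by (cases N) auto
    then show ?thesis using a \<delta> by (simp add: \<beta>_def field_simps)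
  qed
  finally show ?thesis .
qed

lemma eventually_thresholds:
  fixes C\<^sub>0 c g1 g2 :: real
  assumes "0 \<le> c" "c < 1"
  shows "\<exists>N\<^sub>0::nat. \<forall>N\<ge>N\<^sub>0. 3 \<le> N \<and> 2 * C\<^sub>0 * g1 * real N powr (- (1 / 4)) \<le> 1 / 10 \<and>
    2 * C\<^sub>0 * g2 * real N powr (- (1 / 4)) \<le> 1 / 4 \<and> c ^ Suc N \<le> 1 / 5"
proof -
  have lim: "(\<lambda>N. K * real N powr (- (1 / 4))) \<longlonglongrightarrow> K * 0" for K :: real
    by (intro tendsto_mult tendsto_const tendsto_neg_powr filterlim_real_sequentially) auto
  have pw: "(\<lambda>N. c ^ Suc N) \<longlonglongrightarrow> 0" using assms by (intro LIMSEQ_Suc LIMSEQ_power_zero) auto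
  have "\<forall>\<^sub>F N in sequentially. 2 * C\<^sub>0 * g1 * real N powr (- (1 / 4)) < 1 / 10"
    using lim[of "2 * C\<^sub>0 * g1"] by (rule order_tendstoD) simp
  moreover have "\<forall>\<^sub>F N in sequentially. 2 * C\<^sub>0 * g2 * real N powr (- (1 / 4)) < 1 / 4"
    using lim[of "2 * C\<^sub>0 * g2"] by (rule order_tendstoD) simp
  moreover have "\<forall>\<^sub>F N in sequentially. c ^ Suc N < 1 / 5"
    using pw by (rule order_tendstoD) simp
  moreover have "\<forall>\<^sub>F N in sequentially. (3::nat) \<le> N" by (rule eventually_ge_at_top)
  ultimately have "\<forall>\<^sub>F N in sequentially. 3 \<le> N \<and> 2 * C\<^sub>0 * g1 * real N powr (- (1 / 4)) \<le> 1 / 10 \<and>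
    2 * C\<^sub>0 * g2 * real N powr (- (1 / 4)) \<le> 1 / 4 \<and> c ^ Suc N \<le> 1 / 5"
    by eventually_elim auto
  then show ?thesis by (simp add: eventually_sequentially)
qed

theorem theorem1p1:
  fixes a b :: complex and \<kappa> C\<^sub>0 :: real and \<gamma> :: "complex set"
  assumes "0 < cmod b" and "cmod b < cmod a"
    and "\<kappa> > 5 / 2"
    and "C\<^sub>0 \<ge> 1"
    and "ellipse_segment a b \<gamma>"
  shows "\<exists>\<epsilon>>0. \<forall>\<delta>\<^sub>0::real. 0 < \<delta>\<^sub>0 \<and> \<delta>\<^sub>0 < \<epsilon> \<longrightarrow>
    (\<exists>C>0. \<exists>N\<^sub>0::nat. \<forall>N\<ge>N\<^sub>0. \<forall>\<delta> r :: real.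
       real N powr (- \<kappa>) / C\<^sub>0 \<le> \<delta> \<and> \<delta> \<le> C\<^sub>0 * real N powr (- \<kappa>) \<and>
       C * ln (real N) / real N \<le> r \<and> r \<le> 1 / C \<longrightarrow>
       (\<forall>(M :: 'w measure) q. iid_complex_gaussian M N q \<longrightarrow>
          measure M {\<omega> \<in> space M.
            \<bar>real (eigenvalue_count (perturbed_I a b N \<delta> q \<omega>) (Gamma_nbhd a b r \<gamma>))
              - vol_preimage a b N (Gamma_nbhd a b r \<gamma>) / (2 * pi)\<bar>
            \<le> C * real N powr \<delta>\<^sub>0 * (1 / r + ln (real N))}
          \<ge> 1 - C * (1 / r + ln (real N)) * real N powr (2 * \<kappa>)
                * exp (- 2 * real N powr \<delta>\<^sub>0)))"
proof -
  note ab = assms(1,2)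
  obtain \<alpha> \<beta> where \<gamma>: "\<alpha> < \<beta>" "\<beta> \<le> \<alpha> + 2 * pi" "\<gamma> = symbol_I a b ` {\<alpha>..\<beta>}"
    using assms(5) by (auto simp: ellipse_segment_def)
  have g0: "\<gamma> \<noteq> {}" using \<gamma> by auto
  have a0: "a \<noteq> 0" "b \<noteq> 0" using ab by auto
  define c where "c = cmod (b / a)"
  have c: "0 < c" "c < 1" using ab a0 by (simp_all add: c_def norm_divide)
  define g1 g2 where "g1 = 2 / (cmod a * (1 - c) ^ 3)" and "g2 = 1 / (cmod a * (1 - sqrt c))"
  have g: "0 \<le> g1" "0 \<le> g2" using c by (auto simp: g1_def g2_def)
  obtain C1 m n where C1: "0 < C1" and nb: "\<And>N. 3 \<le> N \<Longrightarrow> real (Suc (n N)) \<le> C1 * ln (real N)"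
    and est: "\<And>N \<delta> B q A r X. 3 \<le> N \<Longrightarrow> 0 \<le> \<delta> \<Longrightarrow> 0 \<le> B \<Longrightarrow> (\<forall>i<N. \<forall>j<N. cmod (q (i,j)) \<le> B) \<Longrightarrow>
      (real N)\<^sup>2 * \<delta> * B * g1 \<le> 1 / 10 \<Longrightarrow> c ^ Suc N \<le> 1 / 5 \<Longrightarrow> 1 \<le> A \<Longrightarrow> 0 < r \<Longrightarrow>
      (\<forall>x\<in>test_points (b / a) \<alpha> \<beta> m (n N). cmod a ^ N * exp (- A) \<le> cmod (det (resolvent_mat a b N \<delta> q (a * x + b / x)))) \<Longrightarrow>
      X \<in> carrier_mat N N \<Longrightarrow> (\<forall>z. poly (char_poly X) z = det (resolvent_mat a b N \<delta> q z)) \<Longrightarrow>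
      \<bar>real (eigenvalue_count X (Gamma_nbhd a b r \<gamma>)) - real N * (\<beta> - \<alpha>) / (2 * pi)\<bar> \<le> C1 * A * (1 / r + ln (real N))"
    using eigenvalue_count_estimate[OF ab \<gamma>] unfolding g1_def c_def by metis
  obtain N\<^sub>0 :: nat where N\<^sub>0: "\<And>N. N\<^sub>0 \<le> N \<Longrightarrow> 3 \<le> N \<and> 2 * C\<^sub>0 * g1 * real N powr (- (1 / 4)) \<le> 1 / 10 \<and>
    2 * C\<^sub>0 * g2 * real N powr (- (1 / 4)) \<le> 1 / 4 \<and> c ^ Suc N \<le> 1 / 5"
    using eventually_thresholds[of c C\<^sub>0 g1 g2] c by auto
  \<comment> \<open>The 2 accounts for the noise entries, the rest for the test points, of which
    there are at most (m + 2 C1) ln N.\<close>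
  define C2 where "C2 = 2 + (real m + 2 * C1) * (4 * (cmod a)\<^sup>2 * C\<^sub>0\<^sup>2)"
  define C where "C = max C1 C2"
  have C: "C1 \<le> C" "C2 \<le> C" "0 < C" using C1 by (auto simp: C_def)
  show ?thesis
  proof (rule exI[of _ "1 / 2"], intro conjI allI impI exI[of _ C] exI[of _ N\<^sub>0] C(3))
    show "(0::real) < 1 / 2" by simp
  next
    fix \<delta>\<^sub>0 \<delta> r :: real and N :: nat and M :: "'w measure" and q :: "nat \<Rightarrow> nat \<Rightarrow> 'w \<Rightarrow> complex"
    assume d0: "0 < \<delta>\<^sub>0 \<and> \<delta>\<^sub>0 < 1 / 2" and NN: "N\<^sub>0 \<le> N" and iid: "iid_complex_gaussian M N q"
      and "real N powr (- \<kappa>) / C\<^sub>0 \<le> \<delta> \<and> \<delta> \<le> C\<^sub>0 * real N powr (- \<kappa>) \<and> C * ln (real N) / real N \<le> r \<and> r \<le> 1 / C"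
    then have dl: "real N powr (- \<kappa>) / C\<^sub>0 \<le> \<delta>" and du: "\<delta> \<le> C\<^sub>0 * real N powr (- \<kappa>)"
      and rl: "C * ln (real N) / real N \<le> r" by auto
    interpret prob_space M using iid by (simp add: iid_complex_gaussian_def)
    \<comment> \<open>\<open>B\<close> is chosen so that the tail bound exp (- B^2/2) equals exp (-
      2 A), the square of the loss exp (- A) allowed at the test points.\<close>
    define A B L where "A = real N powr \<delta>\<^sub>0" and "B = 2 * real N powr (\<delta>\<^sub>0 / 2)" and "L = ln (real N)"
    have N: "3 \<le> N" using N\<^sub>0[OF NN] by blast
    have N1: "1 \<le> real N" using N by simp
    have L: "1 \<le> L"
    proof -
      have "exp 1 \<le> (3::real)" by (rule exp_le)
      also have "\<dots> \<le> real N" using N by simp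
      finally show ?thesis using N by (simp add: ln_ge_iff L_def)
    qed
    have A: "1 \<le> A" unfolding A_def using N1 d0 by (intro ge_one_powr_ge_zero) auto
    have B: "0 \<le> B" by (simp add: B_def)
    have BA: "- B\<^sup>2 / 2 = - 2 * A"
    proof -
      have "(real N powr (\<delta>\<^sub>0 / 2))\<^sup>2 = A" using N1 by (simp add: A_def power2_eq_square powr_add[symmetric])
      then show ?thesis by (simp add: B_def power_mult_distrib)
    qed
    have "0 < C * ln (real N) / real N" using C(3) L N1 unfolding L_def by (intro divide_pos_pos mult_pos_pos) linarith+
    then have r: "0 < r" using rl by linarith
    have "0 < real N powr (- \<kappa>) / C\<^sub>0" using N1 assms(4) by simp
    then have \<delta>: "0 < \<delta>" using dl by linarith
    have NdB: "(real N)\<^sup>2 * \<delta> * B \<le> 2 * C\<^sub>0 * real N powr (- (1 / 4))"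
    proof -
      have "(real N)\<^sup>2 * \<delta> * B \<le> (real N)\<^sup>2 * (C\<^sub>0 * real N powr (- \<kappa>)) * B"
        using du B by (intro mult_right_mono mult_left_mono) auto
      also have "\<dots> = 2 * C\<^sub>0 * (real N powr 2 * real N powr (- \<kappa>) * real N powr (\<delta>\<^sub>0 / 2))"
        using N1 by (simp add: B_def powr_numeral)
      also have "real N powr 2 * real N powr (- \<kappa>) * real N powr (\<delta>\<^sub>0 / 2) = real N powr (2 - \<kappa> + \<delta>\<^sub>0 / 2)"
        unfolding powr_add[symmetric] by simp
      \<comment> \<open>As kappa > 5/2 and delta0 < 1/2, the exponent is less than - 1/2 +
        1/4.\<close>
      also have "\<dots> \<le> real N powr (- (1 / 4))" using N1 assms(3) d0 by (intro powr_mono) auto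
      finally show ?thesis using assms(4) by (simp add: mult_left_mono)
    qed
    have small1: "(real N)\<^sup>2 * \<delta> * B * g1 \<le> 1 / 10"
      using mult_right_mono[OF NdB g(1)] N\<^sub>0[OF NN] by (simp add: mult_ac)
    have small2: "(real N)\<^sup>2 * \<delta> * B * (1 / (cmod a * (1 - sqrt c))) \<le> 1 / 4"
      using mult_right_mono[OF NdB g(2)] N\<^sub>0[OF NN] unfolding g2_def[symmetric] by (simp add: mult_ac)
    define TP where "TP = test_points (b / a) \<alpha> \<beta> m (n N)"
    define Q where "Q = (\<lambda>\<omega> (j,k). q j k \<omega>)"
    have D: "distributed M lborel (q j k) gaussian_density" if "j < N" "k < N" for j k
      using iid that by (simp add: iid_complex_gaussian_def gaussian_density_def[abs_def])
    have qm: "q j k \<in> borel_measurable M" if "j < N" "k < N" for j k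
      using distributed_measurable[OF D[OF that]] by simp
    have Qm: "(\<lambda>\<omega>. Q \<omega> (i,j)) \<in> borel_measurable M" if "i < N" "j < N" for i j
      using qm[OF that] by (simp add: Q_def)
    define T1 where "T1 = (\<lambda>(j,k). {\<omega> \<in> space M. B < cmod (q j k \<omega>)})"
    define T2 where "T2 = (\<lambda>x. {\<omega> \<in> space M. (\<forall>i<N. \<forall>j<N. cmod (q i j \<omega>) \<le> B) \<and>
      cmod (det (resolvent_mat a b N \<delta> (Q \<omega>) (a * x + b / x))) < cmod a ^ N * exp (- A)})"
    have T1s: "T1 p \<in> sets M" if "p \<in> {..<N} \<times> {..<N}" for p
    proof -
      obtain j k where p: "p = (j,k)" "j < N" "k < N" using \<open>p \<in> _\<close> by auto
      have [measurable]: "q j k \<in> borel_measurable M" using qm p by blast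
      show ?thesis unfolding T1_def p(1) prod.case by measurable
    qed
    have T2s: "T2 x \<in> sets M" for x
    proof -
      have [measurable]: "(\<lambda>\<omega>. det (resolvent_mat a b N \<delta> (Q \<omega>) (a * x + b / x))) \<in> borel_measurable M"
        by (rule measurable_det_resolvent) (rule Qm)
      have "T2 x = {\<omega> \<in> space M. \<forall>i\<in>{..<N}. \<forall>j\<in>{..<N}. cmod (q i j \<omega>) \<le> B} \<inter>
        {\<omega> \<in> space M. cmod (det (resolvent_mat a b N \<delta> (Q \<omega>) (a * x + b / x))) < cmod a ^ N * exp (- A)}"
        by (auto simp: T2_def)
      also have "\<dots> \<in> sets M"
      proof (intro sets.Int sets.sets_Collect_finite_All)
        fix i j assume "i \<in> {..<N}" "j \<in> {..<N}"
        then have [measurable]: "q i j \<in> borel_measurable M" using qm by blast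
        show "{\<omega> \<in> space M. cmod (q i j \<omega>) \<le> B} \<in> sets M" by measurable
      next
        show "{\<omega> \<in> space M. cmod (det (resolvent_mat a b N \<delta> (Q \<omega>) (a * x + b / x))) < cmod a ^ N * exp (- A)} \<in> sets M"
          by measurable
      qed auto
      finally show ?thesis .
    qed
    have P1: "prob (T1 p) \<le> 2 * exp (- 2 * A)" if "p \<in> {..<N} \<times> {..<N}" for p
    proof -
      obtain j k where p: "p = (j,k)" "j < N" "k < N" using \<open>p \<in> _\<close> by auto
      have "emeasure M (T1 p) \<le> ennreal (2 * exp (- B\<^sup>2 / 2))"
        unfolding T1_def p(1) prod.case by (rule gaussian_tail[OF D[OF p(2,3)] B])
      then show ?thesis unfolding BA emeasure_eq_measure by simp
    qed
    have P2: "prob (T2 x) \<le> 4 * (cmod a)\<^sup>2 * C\<^sub>0\<^sup>2 * (real N powr (2 * \<kappa>) * exp (- 2 * A))" if x: "x \<in> TP" for x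
    proof -
      have xn: "sqrt c \<le> cmod x" "cmod x \<le> 1"
        using norm_test_points[of "b / a" x] x c unfolding TP_def c_def by auto
      have x0: "x \<noteq> 0" using xn c by auto
      have "cmod (b / a / x) = c / cmod x" unfolding c_def by (rule norm_divide)
      also have "\<dots> \<le> c / sqrt c" by (intro divide_left_mono mult_pos_pos) (use x0 c xn in auto)
      also have "\<dots> = sqrt c" using c by (simp add: real_div_sqrt)
      finally have t: "cmod (b / a / x) \<le> sqrt c" .
      have "emeasure M (T2 x) \<le> ennreal ((2 * cmod a * exp (- A) / \<delta>)\<^sup>2)"
        unfolding T2_def Q_def
        by (rule det_resolvent_lower_probability[OF iid N a0(1) x0 xn(2) t _ \<delta> B small2]) (use c in simp)
      then have "prob (T2 x) \<le> (2 * cmod a * exp (- A) / \<delta>)\<^sup>2" unfolding emeasure_eq_measure by simp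
      also have "\<dots> = 4 * (cmod a)\<^sup>2 * exp (- 2 * A) * (1 / \<delta>)\<^sup>2"
      proof -
        have "exp (- 2 * A) = (exp (- A))\<^sup>2" by (simp flip: exp_double)
        then show ?thesis by (simp add: power_mult_distrib power_divide)
      qed
      also have "\<dots> \<le> 4 * (cmod a)\<^sup>2 * exp (- 2 * A) * (C\<^sub>0 * real N powr \<kappa>)\<^sup>2"
      proof (intro mult_left_mono power_mono)
        have "1 / \<delta> \<le> 1 / (real N powr (- \<kappa>) / C\<^sub>0)" using dl N1 assms(4) \<delta> by (intro divide_left_mono mult_pos_pos) auto
        also have "\<dots> = C\<^sub>0 * real N powr \<kappa>" by (simp add: powr_minus divide_inverse)
        finally show "1 / \<delta> \<le> C\<^sub>0 * real N powr \<kappa>" .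
      qed (use \<delta> in auto)
      also have "(C\<^sub>0 * real N powr \<kappa>)\<^sup>2 = C\<^sub>0\<^sup>2 * real N powr (2 * \<kappa>)"
        by (simp add: power_mult_distrib power2_eq_square powr_add[symmetric])
      finally show ?thesis by (simp add: mult_ac)
    qed
    define W where "W = real N powr (2 * \<kappa>) * exp (- 2 * A)"
    have W0: "0 \<le> W" by (simp add: W_def)
    define Bad where "Bad = (\<Union>p\<in>{..<N} \<times> {..<N}. T1 p) \<union> (\<Union>x\<in>TP. T2 x)"
    have fTP: "finite TP" unfolding TP_def by (rule finite_test_points)
    have Bs: "(\<Union>p\<in>{..<N} \<times> {..<N}. T1 p) \<in> sets M" "(\<Union>x\<in>TP. T2 x) \<in> sets M"
      using T1s T2s fTP by (intro sets.finite_UN; auto)+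
    have "prob Bad \<le> prob (\<Union>p\<in>{..<N} \<times> {..<N}. T1 p) + prob (\<Union>x\<in>TP. T2 x)"
      unfolding Bad_def by (rule measure_Un_le[OF Bs])
    also have "prob (\<Union>p\<in>{..<N} \<times> {..<N}. T1 p) \<le> (\<Sum>p\<in>{..<N} \<times> {..<N}. prob (T1 p))"
      using T1s by (intro finite_measure_subadditive_finite) auto
    also have "\<dots> \<le> (\<Sum>p\<in>{..<N} \<times> {..<N}. 2 * exp (- 2 * A))" by (intro sum_mono P1)
    also have "\<dots> = 2 * ((real N)\<^sup>2 * exp (- 2 * A))" by (simp add: power2_eq_square)
    also have "(real N)\<^sup>2 * exp (- 2 * A) \<le> W"
    proof -
      have "(real N)\<^sup>2 = real N powr 2" using N1 by (simp add: powr_numeral)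
      also have "\<dots> \<le> real N powr (2 * \<kappa>)" using N1 assms(3) by (intro powr_mono) auto
      finally show ?thesis unfolding W_def by (intro mult_right_mono) auto
    qed
    also have "W \<le> L * W" using mult_right_mono[OF L W0] by simp
    also have "prob (\<Union>x\<in>TP. T2 x) \<le> (\<Sum>x\<in>TP. prob (T2 x))"
      using T2s fTP by (intro finite_measure_subadditive_finite) auto
    also have "\<dots> \<le> (\<Sum>x\<in>TP. 4 * (cmod a)\<^sup>2 * C\<^sub>0\<^sup>2 * W)" unfolding W_def by (intro sum_mono P2)
    also have "\<dots> = real (card TP) * (4 * (cmod a)\<^sup>2 * C\<^sub>0\<^sup>2 * W)" by simp
    also have "\<dots> \<le> ((real m + 2 * C1) * L) * (4 * (cmod a)\<^sup>2 * C\<^sub>0\<^sup>2 * W)"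
    proof (intro mult_right_mono)
      have "real (card TP) \<le> real m + 2 * real (Suc (n N))"
        using of_nat_mono[OF card_test_points_le[of "b / a" \<alpha> \<beta> m "n N"], where 'a = real] unfolding TP_def by simp
      also have "\<dots> \<le> real m * L + 2 * (C1 * L)"
        using nb[OF N] mult_left_mono[OF L, of "real m"] unfolding L_def by simp
      finally show "real (card TP) \<le> (real m + 2 * C1) * L" by (simp add: algebra_simps)
    qed (use W0 in simp)
    finally have "prob Bad \<le> 2 * (L * W) + ((real m + 2 * C1) * L) * (4 * (cmod a)\<^sup>2 * C\<^sub>0\<^sup>2 * W)" by simp
    also have "\<dots> = C2 * (L * W)" by (simp add: C2_def algebra_simps)
    also have "\<dots> \<le> C * ((1 / r + L) * W)"
      using C L W0 r by (intro mult_mono mult_right_mono) (auto intro: mult_nonneg_nonneg)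
    finally have PB: "prob Bad \<le> C * (1 / r + L) * real N powr (2 * \<kappa>) * exp (- 2 * A)" by (simp add: W_def mult_ac)
    define G where "G = {\<omega> \<in> space M.
          \<bar>real (eigenvalue_count (perturbed_I a b N \<delta> q \<omega>) (Gamma_nbhd a b r \<gamma>))
            - vol_preimage a b N (Gamma_nbhd a b r \<gamma>) / (2 * pi)\<bar> \<le> C * A * (1 / r + L)}"
    have pc: "perturbed_I a b N \<delta> q \<omega> \<in> carrier_mat N N" for \<omega>
      by (simp add: perturbed_I_def toeplitz_I_def)
    have cp: "poly (char_poly (perturbed_I a b N \<delta> q \<omega>)) z = det (resolvent_mat a b N \<delta> (Q \<omega>) z)" for \<omega> z
      unfolding Q_def by (rule poly_char_poly_perturbed_I)
    have Gs: "G \<in> sets M"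
    proof -
      have [measurable]: "(\<lambda>\<omega>. eigenvalue_count (perturbed_I a b N \<delta> q \<omega>) (Gamma_nbhd a b r \<gamma>)) \<in> measurable M (count_space UNIV)"
      proof (rule measurable_eigenvalue_count[OF pc _ g0])
        show "(\<lambda>\<omega>. poly (char_poly (perturbed_I a b N \<delta> q \<omega>)) z) \<in> borel_measurable M" for z
          unfolding cp by (rule measurable_det_resolvent) (rule Qm)
      qed
      show ?thesis unfolding G_def by measurable
    qed
    have sub: "space M - Bad \<subseteq> G"
    proof
      fix \<omega> assume \<omega>: "\<omega> \<in> space M - Bad"
      have q: "\<forall>i<N. \<forall>j<N. cmod (q i j \<omega>) \<le> B"
      proof (intro allI impI)
        fix i j assume "i < N" "j < N"
        then have "\<omega> \<notin> T1 (i,j)" using \<omega> by (auto simp: Bad_def)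
        then show "cmod (q i j \<omega>) \<le> B" using \<omega> by (auto simp: T1_def)
      qed
      have low: "cmod a ^ N * exp (- A) \<le> cmod (det (resolvent_mat a b N \<delta> (Q \<omega>) (a * x + b / x)))" if "x \<in> TP" for x
      proof -
        have "\<omega> \<notin> T2 x" using \<omega> that by (auto simp: Bad_def)
        then show ?thesis using \<omega> q unfolding T2_def by (auto simp: not_less)
      qed
      have "\<bar>real (eigenvalue_count (perturbed_I a b N \<delta> q \<omega>) (Gamma_nbhd a b r \<gamma>)) - real N * (\<beta> - \<alpha>) / (2 * pi)\<bar> \<le> C1 * A * (1 / r + ln (real N))"
      proof (rule est[where q = "Q \<omega>" and B = B])
        show "\<forall>i<N. \<forall>j<N. cmod (Q \<omega> (i,j)) \<le> B" using q by (simp add: Q_def)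
        show "\<forall>x\<in>test_points (b / a) \<alpha> \<beta> m (n N). cmod a ^ N * exp (- A) \<le> cmod (det (resolvent_mat a b N \<delta> (Q \<omega>) (a * x + b / x)))"
          using low unfolding TP_def by blast
        show "\<forall>z. poly (char_poly (perturbed_I a b N \<delta> q \<omega>)) z = det (resolvent_mat a b N \<delta> (Q \<omega>) z)"
          using cp by blast
      qed (use N B small1 A r pc \<delta> N\<^sub>0[OF NN] in \<open>simp_all only: less_imp_le\<close>)
      also have "\<dots> \<le> C * A * (1 / r + L)" unfolding L_def using C A r L by (intro mult_right_mono) (auto simp: L_def)
      finally show "\<omega> \<in> G" unfolding G_def vol_preimage_Gamma[OF ab(2) \<gamma> r] using \<omega> by simp
    qed
    have Bad_s: "Bad \<in> sets M" unfolding Bad_def using Bs by (rule sets.Un)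
    have "1 - prob Bad = prob (space M - Bad)" using prob_compl[OF Bad_s] by simp
    also have "\<dots> \<le> prob G" by (rule finite_measure_mono[OF sub Gs])
    finally have "1 - C * (1 / r + L) * real N powr (2 * \<kappa>) * exp (- 2 * A) \<le> prob G" using PB by linarith
    then show "1 - C * (1 / r + ln (real N)) * real N powr (2 * \<kappa>) * exp (- 2 * real N powr \<delta>\<^sub>0)
      \<le> measure M {\<omega> \<in> space M.
          \<bar>real (eigenvalue_count (perturbed_I a b N \<delta> q \<omega>) (Gamma_nbhd a b r \<gamma>))
            - vol_preimage a b N (Gamma_nbhd a b r \<gamma>) / (2 * pi)\<bar>
          \<le> C * real N powr \<delta>\<^sub>0 * (1 / r + ln (real N))}"
      unfolding G_def A_def L_def .
  qed
qed

end
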